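(* Suppose Assumption 1 (in the context) holds, and let $u^*$ be any optimal solution of the dual problem $\min_{u\in\mathbb{R}^{\widehat n}}D(u)$. Let $\upsilon>1$, let $K\ge 0$ be an integer and let $K_0$ be a nonnegative integer with $K_0\le K$ and $K_0\le\left\lfloor\frac{K}{\upsilon(1+1/\widehat n)}+1\right\rfloor$. Run ARDCA$(u^0,K_0,K)$ from some $u^0\in\mathbb{D}$. Then $$\left|\mathbb{E}_{\xi_K}[F(\hat x^K)]-F(x^* )\right|\le\frac{9\widehat n^2\left((1-\theta_0)(D(u^0)-D(u^* ))+\|u^0-u^*\|_L^2+\|u^*\|_L^2+M^2\sum_{i=1}^nL_i\right)}{(K^2/4+\widehat nK)(1-1/\upsilon)},$$ $$\mathbb{E}_{\xi_K}\left[\left\|\begin{bmatrix}B\hat x^K+b\\ \max\{0,g(\hat x^K)\}\end{bmatrix}\right\|_L^*\right]\le\frac{7\widehat n^2}{(K^2/4+\widehat nK)(1-1/\upsilon)}\sqrt{(1-\theta_0)(D(u^0)-D(u^* ))+\|u^0-u^*\|_L^2}.$$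
   Context: Data: integers $n,t\ge1$, $p,m\ge0$; $A\in\mathbb{R}^{t\times n}$ with columns $A_1,\dots,A_n$; $B\in\mathbb{R}^{p\times t}$ with rows $B_{j,:}$; $b\in\mathbb{R}^p$; functions $f:\mathbb{R}^t\to\mathbb{R}$, $\phi_i:\mathbb{R}\to\mathbb{R}$ ($i\le n$), $g_i:\mathbb{R}^t\to\mathbb{R}$ ($i\le m$), $g(x)=(g_1(x),\dots,g_m(x))$. Primal problem: minimize $F(x)=f(x)+\frac1n\sum_{i=1}^n\phi_i(A_i^Tx)$ subject to $Bx+b=0$, $g_i(x)\le0$ ($i=1,\dots,m$); $x^*$ denotes its optimal solution. Assumption 1: (1) $f$ is $\mu$-strongly convex ($\mu>0$); (2) each $\phi_i$ is convex and $M$-Lipschitz; (3) each $g_i$ is convex and every subgradient $s\in\partial g_i(x)$ satisfies $\|s\|\le L_{g_i}$; (4) there is $\bar x$ with $g_i(\bar x)<0$ for all $i$ and $B\bar x+b=0$; (5) the optimal value is finite. Dual setup: $\widehat n=n+p+m$, $\mathbb{D}=\{u\in\mathbb{R}^{\widehat n}:u_{n+p+1},\dots,u_{\widehat n}\ge0\}$. $L_f(x,u)=f(x)+\langle u_{1:n},A^Tx/n\rangle+\langle u_{n+1:n+p},Bx+b\rangle+\sum_{i=1}^mu_{n+p+i}g_i(x)$, $x^*(u)=\arg\min_xL_f(x,u)$, $d(u)=-L_f(x^*(u),u)$. $h_i(s)=\frac1n\phi_i^*(s)$ for $i\le n$ (with $\phi_i^*(s)=\sup_w(sw-\phi_i(w))$),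 $h_i\equiv0$ for $n<i\le n+p$, $h_i(s)=0$ if $s\ge0$ and $+\infty$ otherwise for $i>n+p$. $D(u)=d(u)+\sum_{i=1}^{\widehat n}h_i(u_i)$ (negative dual function). On $\mathbb{D}$, $d$ is differentiable with $\nabla d(u)=-[(A^Tx^*(u)/n)^T,(Bx^*(u)+b)^T,g_1(x^*(u)),\dots,g_m(x^*(u))]^T$; $\nabla_id$ is its $i$-th entry. Constants: $L_j=\|A_j\|^2/(n^2\mu)$ for $j\le n$, $L_j=\|B_{j-n,:}\|^2/\mu$ for $n<j\le n+p$, $L_j=L_{g_{j-n-p}}^2/\mu$ for $j>n+p$. $\|w\|_L=\sqrt{\sum_iL_iw_i^2}$, $\|w\|_L^*=\sqrt{\sum_iw_i^2/L_i}$; for the vector $[Bx+b;\max\{0,g(x)\}]\in\mathbb{R}^{p+m}$ the weights are $L_{n+1},\dots,L_{\widehat n}$. Algorithm ARDCA$(u^0,K_0,K)$: $\theta_0=1/\widehat n$, $\theta_{k+1}=\frac{\sqrt{\theta_k^4+4\theta_k^2}-\theta_k^2}{2}$; $z^0=u^0\in\mathbb{D}$; for $k=0,\dots,K$: $v^k=\theta_kz^k+(1-\theta_k)u^k$; draw $i_k$ uniformly from $\{1,\dots,\widehat n\}$ independently of the past; $z^{k+1}_{i_k}=\arg\min_{w\in\mathbb{R}}\widehat n\theta_kL_{i_k}(w-z^k_{i_k})^2+\nabla_{i_k}d(v^k)(w-z^k_{i_k})+h_{i_k}(w)$, $z^{k+1}_j=z^k_j$ for $j\ne i_k$; $u^{k+1}=v^k+\widehat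 n\theta_k(z^{k+1}-z^k)$. Outputs: $\hat x^K=\frac{\sum_{k=K_0}^Kx^*(v^k)/\theta_k}{\sum_{k=K_0}^K1/\theta_k}$ and $u^{K+1}$. $\xi_K=\{i_0,\dots,i_K\}$ and $\mathbb{E}_{\xi_K}$ is expectation over it. *)

theory Defs
  imports "HOL-Analysis.Analysis"
begin

(* Problem data.  Vectors x in R^t are "real^'t" (t = CARD('t)).
   Dual vectors u in R^{nhat} are "nat \<Rightarrow> real", coordinates 0..nhat-1
   (0-based: block 1 = {0..<n}, block 2 = {n..<n+p}, block 3 = {n+p..<nhat}). *)
record ('t::finite) cdata =
  nn   :: nat
  pp   :: nat
  mm   :: nat
  Acol :: "nat \<Rightarrow> real^'t"          (* columns A_1..A_n (indices 0..n-1) *)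
  Brow :: "nat \<Rightarrow> real^'t"          (* rows of B (indices 0..p-1) *)
  bvec :: "nat \<Rightarrow> real"              (* b (indices 0..p-1) *)
  fobj :: "real^'t \<Rightarrow> real"
  phis :: "nat \<Rightarrow> real \<Rightarrow> real"     (* phi_i (indices 0..n-1) *)
  gs   :: "nat \<Rightarrow> real^'t \<Rightarrow> real"  (* g_i (indices 0..m-1) *)
  mu   :: real
  Mlip :: real
  Lgs  :: "nat \<Rightarrow> real"

definition nhat :: "'t::finite cdata \<Rightarrow> nat" where
  "nhat P = nn P + pp P + mm P"

definition strongly_convex :: "real \<Rightarrow> ('a::real_inner \<Rightarrow> real) \<Rightarrow> bool" where
  "strongly_convex \<mu> f \<longleftrightarrow> (\<forall>x y. \<forall>t::real. 0 \<le> t \<and> t \<le> 1 \<longrightarrow>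
      f (t *\<^sub>R x + (1 - t) *\<^sub>R y) \<le> t * f x + (1 - t) * f y - \<mu> / 2 * t * (1 - t) * (norm (x - y))\<^sup>2)"

definition subgradients :: "('a::real_inner \<Rightarrow> real) \<Rightarrow> 'a \<Rightarrow> 'a set" where
  "subgradients h x = {s. \<forall>y. h y \<ge> h x + s \<bullet> (y - x)}"

definition Fobj :: "'t::finite cdata \<Rightarrow> real^'t \<Rightarrow> real" where
  "Fobj P x = fobj P x + (1 / real (nn P)) * (\<Sum>i<nn P. phis P i (Acol P i \<bullet> x))"

definition feasible :: "'t::finite cdata \<Rightarrow> real^'t \<Rightarrow> bool" where
  "feasible P x \<longleftrightarrow> (\<forall>j<pp P. Brow P j \<bullet> x + bvec P j = 0) \<and> (\<forall>i<mm P. gs P i x \<le> 0)"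

definition assumption1 :: "'t::finite cdata \<Rightarrow> bool" where
  "assumption1 P \<longleftrightarrow>
     mu P > 0 \<and> strongly_convex (mu P) (fobj P) \<and>
     (\<forall>i<nn P. convex_on UNIV (phis P i) \<and> (Mlip P)-lipschitz_on UNIV (phis P i)) \<and>
     (\<forall>i<mm P. convex_on UNIV (gs P i) \<and>
         (\<forall>x. \<forall>s\<in>subgradients (gs P i) x. norm s \<le> Lgs P i)) \<and>
     (\<exists>xb. (\<forall>i<mm P. gs P i xb < 0) \<and> (\<forall>j<pp P. Brow P j \<bullet> xb + bvec P j = 0)) \<and>
     bdd_below (Fobj P ` {x. feasible P x})"

definition Lag :: "'t::finite cdata \<Rightarrow> real^'t \<Rightarrow> (nat \<Rightarrow> real) \<Rightarrow> real" where
  "Lag P x u = fobj P x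
     + (\<Sum>i<nn P. u i * ((Acol P i \<bullet> x) / real (nn P)))
     + (\<Sum>j<pp P. u (nn P + j) * (Brow P j \<bullet> x + bvec P j))
     + (\<Sum>i<mm P. u (nn P + pp P + i) * gs P i x)"

definition xdual :: "'t::finite cdata \<Rightarrow> (nat \<Rightarrow> real) \<Rightarrow> real^'t" where
  "xdual P u = (SOME x. \<forall>y. Lag P x u \<le> Lag P y u)"

definition ddual :: "'t::finite cdata \<Rightarrow> (nat \<Rightarrow> real) \<Rightarrow> ereal" where
  "ddual P u = - (INF x. ereal (Lag P x u))"

definition graddual :: "'t::finite cdata \<Rightarrow> (nat \<Rightarrow> real) \<Rightarrow> nat \<Rightarrow> real" where
  "graddual P u i = (let x = xdual P u in
     if i < nn P then - ((Acol P i \<bullet> x) / real (nn P))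
     else if i < nn P + pp P then - (Brow P (i - nn P) \<bullet> x + bvec P (i - nn P))
     else - gs P (i - nn P - pp P) x)"

definition conjugate :: "(real \<Rightarrow> real) \<Rightarrow> real \<Rightarrow> ereal" where
  "conjugate \<phi> s = (SUP w. ereal (s * w - \<phi> w))"

definition hfun :: "'t::finite cdata \<Rightarrow> nat \<Rightarrow> real \<Rightarrow> ereal" where
  "hfun P i s =
     (if i < nn P then ereal (1 / real (nn P)) * conjugate (phis P i) s
      else if i < nn P + pp P then 0
      else if s \<ge> 0 then 0 else \<infinity>)"

definition Dfun :: "'t::finite cdata \<Rightarrow> (nat \<Rightarrow> real) \<Rightarrow> ereal" where
  "Dfun P u = ddual P u + (\<Sum>i<nhat P. hfun P i (u i))"

definition inD :: "'t::finite cdata \<Rightarrow> (nat \<Rightarrow> real) \<Rightarrow> bool" where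
  "inD P u \<longleftrightarrow> (\<forall>i. nn P + pp P \<le> i \<and> i < nhat P \<longrightarrow> u i \<ge> 0)"

definition Lc :: "'t::finite cdata \<Rightarrow> nat \<Rightarrow> real" where
  "Lc P j =
     (if j < nn P then (norm (Acol P j))\<^sup>2 / ((real (nn P))\<^sup>2 * mu P)
      else if j < nn P + pp P then (norm (Brow P (j - nn P)))\<^sup>2 / mu P
      else (Lgs P (j - nn P - pp P))\<^sup>2 / mu P)"

definition normL_sq :: "'t::finite cdata \<Rightarrow> (nat \<Rightarrow> real) \<Rightarrow> real" where
  "normL_sq P w = (\<Sum>i<nhat P. Lc P i * (w i)\<^sup>2)"

definition infeas_dualnorm :: "'t::finite cdata \<Rightarrow> real^'t \<Rightarrow> real" where
  "infeas_dualnorm P x = sqrt (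
      (\<Sum>j<pp P. (Brow P j \<bullet> x + bvec P j)\<^sup>2 / Lc P (nn P + j))
    + (\<Sum>i<mm P. (max 0 (gs P i x))\<^sup>2 / Lc P (nn P + pp P + i)))"

fun theta :: "nat \<Rightarrow> nat \<Rightarrow> real" where
  "theta N 0 = 1 / real N"
| "theta N (Suc k) = (sqrt ((theta N k)^4 + 4 * (theta N k)\<^sup>2) - (theta N k)\<^sup>2) / 2"

definition coord_step :: "'t::finite cdata \<Rightarrow> real \<Rightarrow> nat \<Rightarrow> real \<Rightarrow> real \<Rightarrow> real" where
  "coord_step P th i gr z = (SOME w. \<forall>w'.
      ereal (real (nhat P) * th * Lc P i * (w - z)\<^sup>2 + gr * (w - z)) + hfun P i w
      \<le> ereal (real (nhat P) * th * Lc P i * (w' - z)\<^sup>2 + gr * (w' - z)) + hfun P i w')"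

fun ardca :: "'t::finite cdata \<Rightarrow> (nat \<Rightarrow> real) \<Rightarrow> (nat \<Rightarrow> nat) \<Rightarrow> nat
               \<Rightarrow> (nat \<Rightarrow> real) \<times> (nat \<Rightarrow> real)" where
  "ardca P u0 xi 0 = (u0, u0)"
| "ardca P u0 xi (Suc k) =
     (let z = fst (ardca P u0 xi k); u = snd (ardca P u0 xi k);
          th = theta (nhat P) k;
          v = (\<lambda>j. th * z j + (1 - th) * u j);
          i = xi k;
          w = coord_step P th i (graddual P v i) (z i);
          z' = z(i := w)
      in (z', (\<lambda>j. v j + real (nhat P) * th * (z' j - z j))))"

definition vseq :: "'t::finite cdata \<Rightarrow> (nat \<Rightarrow> real) \<Rightarrow> (nat \<Rightarrow> nat) \<Rightarrow> nat \<Rightarrow> nat \<Rightarrow> real" where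
  "vseq P u0 xi k = (let th = theta (nhat P) k in
     (\<lambda>j. th * fst (ardca P u0 xi k) j + (1 - th) * snd (ardca P u0 xi k) j))"

definition xhat :: "'t::finite cdata \<Rightarrow> (nat \<Rightarrow> real) \<Rightarrow> nat \<Rightarrow> nat \<Rightarrow> (nat \<Rightarrow> nat) \<Rightarrow> real^'t" where
  "xhat P u0 K0 K xi =
     (1 / (\<Sum>k=K0..K. 1 / theta (nhat P) k)) *\<^sub>R
     (\<Sum>k=K0..K. (1 / theta (nhat P) k) *\<^sub>R xdual P (vseq P u0 xi k))"

(* E_{xi_K}: i_0..i_K independent, uniform on {0..nhat-1} *)
definition Exi :: "nat \<Rightarrow> nat \<Rightarrow> ((nat \<Rightarrow> nat) \<Rightarrow> real) \<Rightarrow> real" where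
  "Exi N K X = (\<Sum>xi\<in>PiE {0..K} (\<lambda>_. {..<N}). X xi) / real N ^ (K + 1)"

definition esqrt :: "ereal \<Rightarrow> ereal" where
  "esqrt r = (case r of ereal x \<Rightarrow> ereal (sqrt x) | PInfty \<Rightarrow> \<infinity> | MInfty \<Rightarrow> -\<infinity>)"

end

theory Submission
  imports Defs
begin

text \<open>
  For fixed \<open>u\<close>, the linearization of \<open>d\<close> at \<open>v\<^sup>k\<close> evaluated at \<open>u\<close> is \<open>- L\<^sub>f(x\<^sup>*(v\<^sup>k), u)\<close>, so the usual
  estimate sequence of accelerated coordinate descent, summed with weights \<open>1 / \<theta>\<^sub>k\<close>, controls
  \<open>- L\<^sub>f\<close> at the averaged primal point.  The reference point \<open>u\<^sup>*\<close> gives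
  \<open>E \<parallel>u\<^sup>* - z\<^sup>k\<parallel>\<^sup>2 \<le> C\<close> and \<open>\<Sum> E \<parallel>\<Delta>\<^sup>k\<parallel>\<^sup>2 \<le> 2 N C\<close>, where \<open>\<Delta>\<^sup>k\<close> is the full (all coordinates) proximal step and \<open>C\<close>
  is the bracket in the bound on the infeasibility.

  The optimality condition of the proximal step bounds the constraint residual at \<open>x\<^sup>*(v\<^sup>k)\<close>, divided
  by \<open>\<theta>\<^sub>k\<close>, by \<open>2 N L\<^sub>i \<Delta>\<^sup>k\<^sub>i\<close>.  The sum of the \<open>\<Delta>\<^sup>k\<close> is \<open>N\<close> times a difference of two \<open>z\<close>-iterates minus a
  martingale of second moment at most \<open>2 N\<^sup>2 C\<close>.  For the objective, the reference point is the
  random dual vector of subgradients of the \<open>\<phi>\<^sub>i\<close> at the averaged point, and the correlation with the sampling is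
  again absorbed by the martingale.  The lower bound on the objective uses \<open>D(u\<^sup>*) = - F(x\<^sup>*)\<close>.
\<close>

text \<open>The reference point of the objective bound is computed from the finished run and is
  therefore correlated with every draw. The one-step estimate survives this, since it holds path by
  path with the reference point frozen while the current draw is averaged; what fails is the
  telescoping of the squared distances. Expanding the squares isolates the failure in one product,
  reference point times sum of full steps, and that sum is a telescoping part plus noise. No
  derivative of d and no conditional expectation appears. Descent along a coordinate comes from
  strong convexity of the Lagrangian, and conditioning is replaced by averaging over one resampled
  draw of a finite product. Attainment in the dual follows from elementary multiplier rules, one
  constraint at a time, under the Slater condition.\<close>

section \<open>Lagrange multipliers for convex functions\<close>

text \<open>The multiplier is minus the smallest slope \<open>(H x - c) / h x\<close> over the points with \<open>h x > 0\<close>.\<close>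

lemma separating_multiplier:
  fixes H h :: "'a \<Rightarrow> real"
  assumes comb: "\<And>x y. x \<in> S \<Longrightarrow> y \<in> S \<Longrightarrow> h x > 0 \<Longrightarrow> h y < 0 \<Longrightarrow>
      - h y * (H x - c) + h x * (H y - c) \<ge> 0"
    and pos: "\<exists>x\<in>S. h x > 0" and neg: "\<exists>y\<in>S. h y < 0"
  shows "\<exists>\<nu>. \<forall>x\<in>S. h x \<noteq> 0 \<longrightarrow> H x + \<nu> * h x \<ge> c"
proof -
  define A where "A = (\<lambda>x. (H x - c) / h x) ` {x\<in>S. h x > 0}"
  have ne: "A \<noteq> {}" using pos by (auto simp: A_def)
  have lower: "(H y - c) / h y \<le> a" if y: "y \<in> S" "h y < 0" "a \<in> A" for y a
  proof -
    obtain x where x: "x \<in> S" "h x > 0" "a = (H x - c) / h x" using y(3) unfolding A_def by blast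
    show ?thesis unfolding x(3) using comb[OF x(1) y(1) x(2) y(2)] x(2) y(2)
      by (simp add: field_simps)
  qed
  have bdd: "bdd_below A" using neg lower by (meson bdd_belowI)
  have "H x + (- Inf A) * h x \<ge> c" if "x \<in> S" "h x \<noteq> 0" for x
  proof (cases "h x > 0")
    case True
    then have "Inf A \<le> (H x - c) / h x" using that bdd by (auto intro!: cInf_lower simp: A_def)
    then show ?thesis using True by (simp add: field_simps)
  next
    case False
    then have "h x < 0" using that by simp
    then have "(H x - c) / h x \<le> Inf A" using that lower by (intro cInf_greatest[OF ne]) auto
    then show ?thesis using \<open>h x < 0\<close> by (simp add: field_simps)
  qed
  then show ?thesis by blast
qed

text \<open>Affinity of \<open>S\<close> replaces a constraint qualification: reflecting a point
  with \<open>h x \<noteq> 0\<close> in \<open>x0\<close> gives the opposite sign, so both signs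
  occur. Two points of opposite sign are joined by a segment that meets the zero set of
  \<open>h\<close>, where the lower bound \<open>c\<close> holds.\<close>

lemma equality_multiplier:
  fixes H h :: "'a::real_vector \<Rightarrow> real"
  assumes H: "convex_on S H" and S: "affine S"
    and h: "\<And>x y t. h ((1 - t) *\<^sub>R x + t *\<^sub>R y) = (1 - t) * h x + t * h y"
    and x0: "x0 \<in> S" "h x0 = 0"
    and lb: "\<And>x. x \<in> S \<Longrightarrow> h x = 0 \<Longrightarrow> H x \<ge> c"
  shows "\<exists>\<nu>. \<forall>x\<in>S. H x + \<nu> * h x \<ge> c"
proof (cases "\<forall>x\<in>S. h x = 0")
  case True
  then show ?thesis using lb by auto
next
  case False
  then obtain x where x: "x \<in> S" "h x \<noteq> 0" by blast
  define y where "y = (1 - (-1)) *\<^sub>R x0 + (-1) *\<^sub>R x"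
  have "y \<in> S" unfolding y_def using S x0 x by (intro mem_affine) auto
  moreover have "h y = - h x" unfolding y_def h using x0 by simp
  ultimately have pn: "\<exists>x\<in>S. h x > 0" "\<exists>x\<in>S. h x < 0"
    using x by (cases "h x > 0"; force intro: bexI[of _ x] bexI[of _ y])+
  have "\<exists>\<nu>. \<forall>x\<in>S. h x \<noteq> 0 \<longrightarrow> H x + \<nu> * h x \<ge> c"
  proof (rule separating_multiplier[OF _ pn])
    fix x y assume xy: "x \<in> S" "y \<in> S" "h x > 0" "h y < 0"
    define t where "t = h x / (h x - h y)"
    have t: "0 \<le> t" "t \<le> 1" using xy by (auto simp: t_def field_simps)
    have z: "(1 - t) *\<^sub>R x + t *\<^sub>R y \<in> S" using S xy by (intro mem_affine) auto
    have "(1 - t) * h x + t * h y = 0" using xy by (simp add: t_def field_simps)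
    then have "c \<le> H ((1 - t) *\<^sub>R x + t *\<^sub>R y)" using lb[OF z] h by simp
    also have "\<dots> \<le> (1 - t) * H x + t * H y" using convex_onD[OF H t] xy by blast
    finally have "0 \<le> (1 - t) * (H x - c) + t * (H y - c)" by (simp add: algebra_simps)
    then have "0 \<le> (h x - h y) * ((1 - t) * (H x - c) + t * (H y - c))" using xy by simp
    also have "\<dots> = - h y * (H x - c) + h x * (H y - c)"
    proof -
      have eq: "(h x - h y) * t = h x" using xy by (simp add: t_def)
      have "(h x - h y) * ((1 - t) * (H x - c) + t * (H y - c))
          = (h x - h y - (h x - h y) * t) * (H x - c) + (h x - h y) * t * (H y - c)"
        by (simp only: ring_distribs)
      then show ?thesis unfolding eq by simp
    qed
    finally show "- h y * (H x - c) + h x * (H y - c) \<ge> 0" .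
  qed
  then obtain \<nu> where \<nu>: "\<And>x. x \<in> S \<Longrightarrow> h x \<noteq> 0 \<Longrightarrow> H x + \<nu> * h x \<ge> c" by blast
  have "H x + \<nu> * h x \<ge> c" if "x \<in> S" for x
    using \<nu>[OF that] lb[OF that] by (cases "h x = 0") auto
  then show ?thesis by blast
qed

text \<open>Multipliers are produced one at a time: the last constraint is priced on the affine set
  cut out by the others, and its term joins \<open>H\<close> before the induction hypothesis is
  applied.\<close>

lemma equality_multipliers:
  fixes H :: "'a::real_vector \<Rightarrow> real" and h :: "nat \<Rightarrow> 'a \<Rightarrow> real"
  assumes "convex_on UNIV H"
    and h: "\<And>j x y t. h j ((1 - t) *\<^sub>R x + t *\<^sub>R y) = (1 - t) * h j x + t * h j y"
    and x0: "\<And>j. j < p \<Longrightarrow> h j x0 = 0"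
    and "\<And>x. (\<And>j. j < p \<Longrightarrow> h j x = 0) \<Longrightarrow> H x \<ge> c"
  shows "\<exists>\<nu>. \<forall>x. H x + (\<Sum>j<p. \<nu> j * h j x) \<ge> c"
  using assms(1,3,4)
proof (induction p arbitrary: H)
  case 0
  then show ?case by simp
next
  case (Suc p)
  define S where "S = {x. \<forall>j<p. h j x = 0}"
  have S: "affine S"
    unfolding affine_alt S_def
  proof (intro ballI allI, unfold mem_Collect_eq, intro allI impI)
    fix x y t j
    assume "\<forall>j<p. h j x = 0" "\<forall>j<p. h j y = 0" "j < p"
    then show "h j ((1 - t) *\<^sub>R x + t *\<^sub>R y) = 0" by (subst h) simp
  qed
  have "\<exists>\<nu>. \<forall>x\<in>S. H x + \<nu> * h p x \<ge> c"
  proof (rule equality_multiplier[where H = H and S = S and c = c and h = "h p" and ?x0.0 = x0])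
    show "affine S" by (rule S)
    show "h p ((1 - t) *\<^sub>R x + t *\<^sub>R y) = (1 - t) * h p x + t * h p y" for x y t by (rule h)
    show "convex_on S H" by (rule convex_on_subset[OF Suc.prems(1) subset_UNIV affine_imp_convex[OF S]])
    show "x0 \<in> S" "h p x0 = 0" using Suc.prems(2) by (auto simp: S_def)
    show "H x \<ge> c" if "x \<in> S" "h p x = 0" for x
      using that by (intro Suc.prems(3)) (auto simp: S_def less_Suc_eq)
  qed
  then obtain a where a: "\<And>x. x \<in> S \<Longrightarrow> H x + a * h p x \<ge> c" by blast
  have cv: "convex_on UNIV (\<lambda>x. H x + a * h p x)"
  proof (rule convex_on_add[OF Suc.prems(1)], rule convex_onI)
    fix t :: real and x y
    have "a * h p ((1 - t) *\<^sub>R x + t *\<^sub>R y) = (1 - t) * (a * h p x) + t * (a * h p y)"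
      by (subst h) (simp add: algebra_simps)
    then show "a * h p ((1 - t) *\<^sub>R x + t *\<^sub>R y) \<le> (1 - t) * (a * h p x) + t * (a * h p y)"
      by simp
  qed simp
  have "\<exists>\<nu>. \<forall>x. H x + a * h p x + (\<Sum>j<p. \<nu> j * h j x) \<ge> c"
  proof (rule Suc.IH[OF cv])
    show "h j x0 = 0" if "j < p" for j using that Suc.prems(2) by simp
    show "H x + a * h p x \<ge> c" if "\<And>j. j < p \<Longrightarrow> h j x = 0" for x
      using that by (intro a) (simp add: S_def)
  qed
  then obtain \<nu> where \<nu>: "\<forall>x. H x + a * h p x + (\<Sum>j<p. \<nu> j * h j x) \<ge> c" ..
  have "H x + (\<Sum>j<Suc p. (\<nu>(p := a)) j * h j x) \<ge> c" for x
  proof -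
    have "(\<Sum>j<p. (\<nu>(p := a)) j * h j x) = (\<Sum>j<p. \<nu> j * h j x)"
      by (intro sum.cong refl) simp
    then have "H x + (\<Sum>j<Suc p. (\<nu>(p := a)) j * h j x) = H x + a * h p x + (\<Sum>j<p. \<nu> j * h j x)"
      by simp
    then show ?thesis
      by (simp only: spec[OF \<nu>])
  qed
  then show ?case by (intro exI[of _ "\<nu>(p := a)"] allI)
qed

text \<open>The strict point \<open>x0\<close> supplies the negative side for the separating slope.
  Clipping that slope at zero is harmless: where \<open>g x > 0\<close> it can only raise the left
  side, and elsewhere \<open>H x \<ge> c\<close> is known.\<close>

lemma inequality_multiplier:
  fixes H g :: "'a::real_vector \<Rightarrow> real"
  assumes H: "convex_on S H" and g: "convex_on S g"
    and x0: "x0 \<in> S" "g x0 < 0"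
    and lb: "\<And>x. x \<in> S \<Longrightarrow> g x \<le> 0 \<Longrightarrow> H x \<ge> c"
  shows "\<exists>\<nu>\<ge>0. \<forall>x\<in>S. H x + \<nu> * g x \<ge> c"
proof (cases "\<exists>x\<in>S. g x > 0")
  case False
  then show ?thesis using lb by (intro exI[of _ 0]) (auto simp: not_less)
next
  case True
  have "\<exists>\<nu>. \<forall>x\<in>S. g x \<noteq> 0 \<longrightarrow> H x + \<nu> * g x \<ge> c"
  proof (rule separating_multiplier[OF _ True])
    show "\<exists>y\<in>S. g y < 0" using x0 by blast
    fix x y assume xy: "x \<in> S" "y \<in> S" "g x > 0" "g y < 0"
    define t where "t = g x / (g x - g y)"
    have t: "0 \<le> t" "t \<le> 1" using xy by (auto simp: t_def field_simps)
    have z: "(1 - t) *\<^sub>R x + t *\<^sub>R y \<in> S"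
      using convex_on_imp_convex[OF H] xy t by (simp add: convexD_alt)
    have "g ((1 - t) *\<^sub>R x + t *\<^sub>R y) \<le> (1 - t) * g x + t * g y"
      using convex_onD[OF g t] xy by blast
    also have "\<dots> = 0" using xy by (simp add: t_def field_simps)
    finally have "c \<le> H ((1 - t) *\<^sub>R x + t *\<^sub>R y)" using lb[OF z] by simp
    also have "\<dots> \<le> (1 - t) * H x + t * H y" using convex_onD[OF H t] xy by blast
    finally have "0 \<le> (1 - t) * (H x - c) + t * (H y - c)" by (simp add: algebra_simps)
    then have "0 \<le> (g x - g y) * ((1 - t) * (H x - c) + t * (H y - c))" using xy by simp
    also have "\<dots> = - g y * (H x - c) + g x * (H y - c)"
    proof -
      have eq: "(g x - g y) * t = g x" using xy by (simp add: t_def)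
      have "(g x - g y) * ((1 - t) * (H x - c) + t * (H y - c))
          = (g x - g y - (g x - g y) * t) * (H x - c) + (g x - g y) * t * (H y - c)"
        by (simp only: ring_distribs)
      then show ?thesis unfolding eq by simp
    qed
    finally show "- g y * (H x - c) + g x * (H y - c) \<ge> 0" .
  qed
  then obtain \<nu> where \<nu>: "\<And>x. x \<in> S \<Longrightarrow> g x \<noteq> 0 \<Longrightarrow> H x + \<nu> * g x \<ge> c" by blast
  have "H x + max 0 \<nu> * g x \<ge> c" if x: "x \<in> S" for x
  proof (cases "\<nu> \<ge> 0")
    case True
    then show ?thesis using \<nu>[OF x] lb[OF x] by (cases "g x = 0") (auto simp: max_def)
  next
    case False
    show ?thesis
    proof (cases "g x > 0")
      case True
      then have "\<nu> * g x \<le> 0" using False by (simp add: mult_nonpos_nonneg)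
      then show ?thesis using \<nu>[OF x] True False by (simp add: max_def)
    next
      case nonpos: False
      then show ?thesis using lb[OF x] False by (simp add: max_def)
    qed
  qed
  then show ?thesis by (intro exI[of _ "max 0 \<nu>"]) auto
qed

text \<open>Stated relative to a convex set \<open>S\<close> because the Slater point has slack only
  in the inequalities; in the application \<open>S\<close> is the affine set of the
  equations.\<close>

lemma inequality_multipliers:
  fixes H :: "'a::real_vector \<Rightarrow> real" and g :: "nat \<Rightarrow> 'a \<Rightarrow> real"
  assumes "convex_on S H" and "\<And>i. i < m \<Longrightarrow> convex_on S (g i)"
    and "x0 \<in> S" "\<And>i. i < m \<Longrightarrow> g i x0 < 0"
    and "\<And>x. x \<in> S \<Longrightarrow> (\<And>i. i < m \<Longrightarrow> g i x \<le> 0) \<Longrightarrow> H x \<ge> c"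
  shows "\<exists>\<nu>. (\<forall>i<m. \<nu> i \<ge> 0) \<and> (\<forall>x\<in>S. H x + (\<Sum>i<m. \<nu> i * g i x) \<ge> c)"
  using assms
proof (induction m arbitrary: H)
  case 0
  then show ?case by simp
next
  case (Suc m)
  define T where "T = {x\<in>S. \<forall>i<m. g i x \<le> 0}"
  have T: "convex T"
    unfolding convex_alt T_def
  proof clarsimp
    fix x y and u :: real
    assume a: "x \<in> S" "\<forall>i<m. g i x \<le> 0" "y \<in> S" "\<forall>i<m. g i y \<le> 0" "0 \<le> u" "u \<le> 1"
    have "g i ((1 - u) *\<^sub>R x + u *\<^sub>R y) \<le> 0" if "i < m" for i
    proof -
      have "g i ((1 - u) *\<^sub>R x + u *\<^sub>R y) \<le> (1 - u) * g i x + u * g i y"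
        using that Suc.prems(2)[of i] a by (intro convex_onD[of S]) auto
      also have "\<dots> \<le> 0" using a that by (intro add_nonpos_nonpos mult_nonneg_nonpos) auto
      finally show ?thesis .
    qed
    then show "(1 - u) *\<^sub>R x + u *\<^sub>R y \<in> S \<and> (\<forall>i<m. g i ((1 - u) *\<^sub>R x + u *\<^sub>R y) \<le> 0)"
      using convex_on_imp_convex[OF Suc.prems(1)] a by (simp add: convexD_alt)
  qed
  have TS: "T \<subseteq> S" by (auto simp: T_def)
  have "\<exists>\<nu>\<ge>0. \<forall>x\<in>T. H x + \<nu> * g m x \<ge> c"
  proof (rule inequality_multiplier)
    show "convex_on T H" "convex_on T (g m)"
      using Suc.prems(1) Suc.prems(2)[of m] T TS convex_on_subset by blast+
    show "x0 \<in> T" using Suc.prems(3,4) by (auto simp: T_def intro!: less_imp_le)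
    show "g m x0 < 0" using Suc.prems(4) by simp
    show "H x \<ge> c" if "x \<in> T" "g m x \<le> 0" for x
      using that by (intro Suc.prems(5)) (auto simp: T_def less_Suc_eq)
  qed
  then obtain a where a: "a \<ge> 0" "\<And>x. x \<in> T \<Longrightarrow> H x + a * g m x \<ge> c" by blast
  have cv: "convex_on S (\<lambda>x. H x + a * g m x)"
    using Suc.prems(1) Suc.prems(2)[of m] a(1) by (intro convex_on_add convex_on_cmul) auto
  have "\<exists>\<nu>. (\<forall>i<m. \<nu> i \<ge> 0) \<and> (\<forall>x\<in>S. H x + a * g m x + (\<Sum>i<m. \<nu> i * g i x) \<ge> c)"
  proof (rule Suc.IH[OF cv])
    show "convex_on S (g i)" "g i x0 < 0" if "i < m" for i using that Suc.prems(2,4) by simp_all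
    show "x0 \<in> S" by (rule Suc.prems(3))
    show "H x + a * g m x \<ge> c" if "x \<in> S" "\<And>i. i < m \<Longrightarrow> g i x \<le> 0" for x
      using that by (intro a(2)) (simp add: T_def)
  qed
  then obtain \<nu> where \<nu>: "\<And>i. i < m \<Longrightarrow> \<nu> i \<ge> 0"
      "\<And>x. x \<in> S \<Longrightarrow> H x + a * g m x + (\<Sum>i<m. \<nu> i * g i x) \<ge> c"
    by blast
  have "H x + (\<Sum>i<Suc m. (\<nu>(m := a)) i * g i x) \<ge> c" if "x \<in> S" for x
  proof -
    have "(\<Sum>i<m. (\<nu>(m := a)) i * g i x) = (\<Sum>i<m. \<nu> i * g i x)" by (rule sum.cong) auto
    then show ?thesis using \<nu>(2)[OF that] by simp
  qed
  then show ?case using \<nu>(1) a(1) by (intro exI[of _ "\<nu>(m := a)"]) (auto simp: less_Suc_eq)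
qed

section \<open>Subgradients of finite convex functions\<close>

text \<open>A subgradient at \<open>x\<close> is a multiplier for the constraints fixing all coordinates to those of \<open>x\<close>.\<close>

lemma subgradient_exists:
  fixes g :: "'a::euclidean_space \<Rightarrow> real"
  assumes g: "convex_on UNIV g"
  shows "\<exists>s. s \<in> subgradients g x"
proof -
  obtain b where b: "bij_betw b {0..<DIM('a)} (Basis :: 'a set)"
    using ex_bij_betw_nat_finite[OF finite_Basis] by blast
  have bij: "bij_betw b {..<DIM('a)} (Basis :: 'a set)"
    using b by (simp add: lessThan_atLeast0)
  define h where "h = (\<lambda>j y. (y - x) \<bullet> b j)"
  have "\<exists>\<nu>. \<forall>y. g y + (\<Sum>j<DIM('a). \<nu> j * h j y) \<ge> g x"
  proof (rule equality_multipliers[OF g, where ?x0.0 = x])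
    show "h j ((1 - t) *\<^sub>R y + t *\<^sub>R z) = (1 - t) * h j y + t * h j z" for j y z t
      by (simp add: h_def inner_diff_left inner_add_left algebra_simps)
    show "h j x = 0" for j by (simp add: h_def)
    show "g y \<ge> g x" if *: "\<And>j. j < DIM('a) \<Longrightarrow> h j y = 0" for y
    proof -
      have "\<forall>e\<in>Basis. (y - x) \<bullet> e = 0"
        using * bij unfolding h_def bij_betw_def by (metis imageE lessThan_iff)
      then have "y - x = 0" by (simp only: euclidean_all_zero_iff)
      then show ?thesis by simp
    qed
  qed
  then obtain \<nu> where \<nu>: "\<forall>y. g y + (\<Sum>j<DIM('a). \<nu> j * h j y) \<ge> g x" ..
  have "g y \<ge> g x + (- (\<Sum>j<DIM('a). \<nu> j *\<^sub>R b j)) \<bullet> (y - x)" for y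
    using spec[OF \<nu>, of y] by (simp add: h_def inner_sum_left inner_sum_right inner_commute)
  then show ?thesis unfolding subgradients_def by blast
qed

text \<open>Converts the assumed bound on the subgradients of the constraint functions into the
  Lipschitz estimate on which the coordinate smoothness of d rests.\<close>

lemma lipschitz_of_bounded_subgradients:
  fixes g :: "'a::euclidean_space \<Rightarrow> real"
  assumes g: "convex_on UNIV g" and L: "\<And>x s. s \<in> subgradients g x \<Longrightarrow> norm s \<le> L"
  shows "\<bar>g x - g y\<bar> \<le> L * norm (x - y)"
proof -
  have one: "g x - g y \<le> L * norm (x - y)" for x y
  proof -
    obtain s where s: "s \<in> subgradients g x" using subgradient_exists[OF g] by blast
    have "g x - g y \<le> s \<bullet> (x - y)" 
      using s[unfolded subgradients_def, simplified, rule_format, of y] by (simp add: inner_diff_right)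
    also have "\<dots> \<le> norm s * norm (x - y)" by (rule norm_cauchy_schwarz)
    also have "\<dots> \<le> L * norm (x - y)" using L[OF s] by (intro mult_right_mono) auto
    finally show ?thesis .
  qed
  show ?thesis using one[of x y] one[of y x] by (simp add: norm_minus_commute abs_le_iff)
qed

section \<open>Splitting off convex conjugates\<close>

lemma convex_on_sum_functions:
  assumes "finite I" "\<And>i. i \<in> I \<Longrightarrow> convex_on S (f i)" "convex S"
  shows "convex_on S (\<lambda>x. \<Sum>i\<in>I. f i x)"
  using assms
proof (induction I rule: finite_induct)
  case empty
  then show ?case by (simp add: convex_on_def)
next
  case (insert i I)
  then show ?case by (simp add: convex_on_add)
qed

lemma convex_on_compose_linear:
  assumes "convex_on UNIV \<phi>" "linear a"
  shows "convex_on UNIV (\<lambda>x. \<phi> (a x))"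
proof (rule convex_onI)
  fix t :: real and x y assume "0 < t" "t < 1"
  then show "\<phi> (a ((1 - t) *\<^sub>R x + t *\<^sub>R y)) \<le> (1 - t) * \<phi> (a x) + t * \<phi> (a y)"
    using convex_onD[OF assms(1), of t "a x" "a y"]
    by (simp add: linear_add[OF assms(2)] linear_scale[OF assms(2)])
qed simp

lemma convex_on_affine:
  fixes h :: "'a::real_vector \<Rightarrow> real"
  assumes "\<And>x y t. h ((1 - t) *\<^sub>R x + t *\<^sub>R y) = (1 - t) * h x + t * h y"
  shows "convex_on UNIV h"
  by (intro convex_onI) (simp_all add: assms)

text \<open>Applied on the product space to the constraint \<open>a x = r\<close>.\<close>

lemma fenchel_split:
  fixes H :: "'a::real_vector \<Rightarrow> real" and \<phi> :: "real \<Rightarrow> real"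
  assumes H: "convex_on UNIV H" and \<phi>: "convex_on UNIV \<phi>" and a: "linear a"
    and lb: "\<And>x. H x + \<phi> (a x) \<ge> c"
  shows "\<exists>s e. (\<forall>r. s * r - \<phi> r \<le> e) \<and> (\<forall>x. H x + s * a x - e \<ge> c)"
proof -
  have "convex_on UNIV (\<lambda>q::'a\<times>real. H (fst q) + \<phi> (snd q))"
  proof (rule convex_onI)
    fix t :: real and q q' :: "'a \<times> real"
    assume t: "0 < t" "t < 1"
    show "H (fst ((1 - t) *\<^sub>R q + t *\<^sub>R q')) + \<phi> (snd ((1 - t) *\<^sub>R q + t *\<^sub>R q'))
        \<le> (1 - t) * (H (fst q) + \<phi> (snd q)) + t * (H (fst q') + \<phi> (snd q'))"
      using convex_onD[OF H, of t "fst q" "fst q'"] convex_onD[OF \<phi>, of t "snd q" "snd q'"] t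
      by (simp add: algebra_simps)
  qed simp
  then have "\<exists>\<nu>. \<forall>q\<in>UNIV. H (fst q) + \<phi> (snd q) + \<nu> * (a (fst q) - snd q) \<ge> c"
  proof (rule equality_multiplier[where ?x0.0 = "0"])
    show "a (fst ((1 - t) *\<^sub>R q + t *\<^sub>R q')) - snd ((1 - t) *\<^sub>R q + t *\<^sub>R q')
        = (1 - t) * (a (fst q) - snd q) + t * (a (fst q') - snd q')" for q q' :: "'a\<times>real" and t
      by (simp add: linear_add[OF a] linear_diff[OF a] linear_scale[OF a] algebra_simps)
  qed (use a lb in \<open>auto simp: linear_0\<close>)
  then obtain \<nu> where \<nu>': "\<And>q. H (fst q) + \<phi> (snd q) + \<nu> * (a (fst q) - snd q) \<ge> c" by blast
  have \<nu>: "\<nu> * r - \<phi> r \<le> H x + \<nu> * a x - c" for x r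
    using \<nu>'[of "(x, r)"] by (simp add: algebra_simps)
  \<comment> \<open>The convex conjugate of \<open>\<phi>\<close> at \<open>\<nu>\<close>; it is
    finite because any fixed \<open>x\<close> in the multiplier inequality bounds it.\<close>
  define e where "e = (SUP r. \<nu> * r - \<phi> r)"
  have "bdd_above (range (\<lambda>r. \<nu> * r - \<phi> r))" using \<nu>[of _ 0] by (intro bdd_aboveI) auto
  then have "\<nu> * r - \<phi> r \<le> e" for r unfolding e_def by (rule cSUP_upper[OF UNIV_I])
  moreover have "e \<le> H x + \<nu> * a x - c" for x unfolding e_def using \<nu> by (intro cSUP_least) auto
  ultimately have "(\<forall>r. \<nu> * r - \<phi> r \<le> e) \<and> (\<forall>x. H x + \<nu> * a x - e \<ge> c)"
    by (simp add: algebra_simps)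
  then show ?thesis by blast
qed

text \<open>Each round trades one \<open>\<phi> i (a i x)\<close> for the affine function
  \<open>s i * a i x - e i\<close>, which joins \<open>H\<close>. The number \<open>e i\<close> is
  only an upper bound of the conjugate at \<open>s i\<close>, and that suffices to bound the dual
  value.\<close>

lemma fenchel_split_sum:
  fixes H :: "'a::real_vector \<Rightarrow> real" and \<phi> :: "nat \<Rightarrow> real \<Rightarrow> real"
  assumes "convex_on UNIV H" "\<And>i. i < n \<Longrightarrow> convex_on UNIV (\<phi> i)" "\<And>i. linear (a i)"
    and "\<And>x. H x + (\<Sum>i<n. \<phi> i (a i x)) \<ge> c"
  shows "\<exists>s e. (\<forall>i<n. \<forall>r. s i * r - \<phi> i r \<le> e i) \<and> (\<forall>x. H x + (\<Sum>i<n. s i * a i x - e i) \<ge> c)"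
  using assms
proof (induction n arbitrary: H)
  case 0
  then show ?case by simp
next
  case (Suc n)
  have 1: "convex_on UNIV (\<lambda>x. H x + (\<Sum>i<n. \<phi> i (a i x)))"
    using Suc.prems(2)
    by (intro convex_on_add[OF Suc.prems(1)] convex_on_sum_functions
        convex_on_compose_linear[OF _ Suc.prems(3)]) auto
  have "\<exists>s e. (\<forall>r. s * r - \<phi> n r \<le> e)
      \<and> (\<forall>x. (H x + (\<Sum>i<n. \<phi> i (a i x))) + s * a n x - e \<ge> c)"
  proof (rule fenchel_split[OF 1 _ Suc.prems(3)])
    show "convex_on UNIV (\<phi> n)" using Suc.prems(2) by simp
    show "H x + (\<Sum>i<n. \<phi> i (a i x)) + \<phi> n (a n x) \<ge> c" for x
      using Suc.prems(4)[of x] by (simp add: add.assoc)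
  qed
  then obtain s' e' where se: "\<forall>r. s' * r - \<phi> n r \<le> e'"
      "\<forall>x. (H x + (\<Sum>i<n. \<phi> i (a i x))) + s' * a n x - e' \<ge> c"
    by blast
  have "convex_on UNIV (\<lambda>x. s' * a n x - e')"
  proof (rule convex_on_affine)
    show "s' * a n ((1 - t) *\<^sub>R x + t *\<^sub>R y) - e' = (1 - t) * (s' * a n x - e') + t * (s' * a n y - e')"
      for x y t
      by (simp add: linear_add[OF Suc.prems(3)] linear_diff[OF Suc.prems(3)]
          linear_scale[OF Suc.prems(3)] algebra_simps)
  qed
  then have 2: "convex_on UNIV (\<lambda>x. H x + (s' * a n x - e'))"
    using Suc.prems(1) by (rule convex_on_add[rotated])
  have "\<exists>s e. (\<forall>i<n. \<forall>r. s i * r - \<phi> i r \<le> e i)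
      \<and> (\<forall>x. (H x + (s' * a n x - e')) + (\<Sum>i<n. s i * a i x - e i) \<ge> c)"
  proof (rule Suc.IH[OF 2])
    show "convex_on UNIV (\<phi> i)" if "i < n" for i using that Suc.prems(2) by simp
    show "linear (a i)" for i by (rule Suc.prems(3))
    show "H x + (s' * a n x - e') + (\<Sum>i<n. \<phi> i (a i x)) \<ge> c" for x
      using spec[OF se(2), of x] by (simp add: algebra_simps)
  qed
  then obtain s e where se': "\<forall>i<n. \<forall>r. s i * r - \<phi> i r \<le> e i"
      "\<forall>x. (H x + (s' * a n x - e')) + (\<Sum>i<n. s i * a i x - e i) \<ge> c"
    by blast
  have "c \<le> H x + (\<Sum>i<Suc n. (s(n := s')) i * a i x - (e(n := e')) i)" for x
  proof -
    have "(\<Sum>i<n. (s(n := s')) i * a i x - (e(n := e')) i) = (\<Sum>i<n. s i * a i x - e i)"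
      by (intro sum.cong refl) simp
    then have "H x + (\<Sum>i<Suc n. (s(n := s')) i * a i x - (e(n := e')) i)
        = (H x + (s' * a n x - e')) + (\<Sum>i<n. s i * a i x - e i)"
      by simp
    then show ?thesis by (simp only: spec[OF se'(2)])
  qed
  then show ?case using se(1) se'(1)
    by (intro exI[of _ "s(n := s')"] exI[of _ "e(n := e')"]) (simp add: less_Suc_eq)
qed

section \<open>Strongly convex functions\<close>

lemma strongly_convex_imp_convex:
  fixes f :: "'a::real_inner \<Rightarrow> real"
  assumes "strongly_convex \<mu> f" "\<mu> \<ge> 0"
  shows "convex_on UNIV f"
proof (rule convex_onI)
  fix t :: real and x y :: 'a assume t: "0 < t" "t < 1"
  have "0 \<le> \<mu> / 2 * (1 - t) * (1 - (1 - t)) * (norm (x - y))\<^sup>2" using assms(2) t by simp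
  moreover have "f ((1 - t) *\<^sub>R x + (1 - (1 - t)) *\<^sub>R y)
      \<le> (1 - t) * f x + (1 - (1 - t)) * f y - \<mu> / 2 * (1 - t) * (1 - (1 - t)) * (norm (x - y))\<^sup>2"
    using assms(1)[unfolded strongly_convex_def, rule_format, of "1 - t" x y] t by simp
  ultimately show "f ((1 - t) *\<^sub>R x + t *\<^sub>R y) \<le> (1 - t) * f x + t * f y" by simp
qed simp

lemma strongly_convex_add:
  fixes f g :: "'a::real_inner \<Rightarrow> real"
  assumes "strongly_convex \<mu> f" "convex_on UNIV g"
  shows "strongly_convex \<mu> (\<lambda>x. f x + g x)"
  unfolding strongly_convex_def
proof (intro allI impI)
  fix x y and t :: real assume t: "0 \<le> t \<and> t \<le> 1"
  have "g (t *\<^sub>R x + (1 - t) *\<^sub>R y) \<le> t * g x + (1 - t) * g y"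
    using convex_onD[OF assms(2), of "1 - t" x y] t by simp
  moreover have "f (t *\<^sub>R x + (1 - t) *\<^sub>R y)
      \<le> t * f x + (1 - t) * f y - \<mu> / 2 * t * (1 - t) * (norm (x - y))\<^sup>2"
    using assms(1) t by (simp add: strongly_convex_def)
  ultimately show "f (t *\<^sub>R x + (1 - t) *\<^sub>R y) + g (t *\<^sub>R x + (1 - t) *\<^sub>R y)
      \<le> t * (f x + g x) + (1 - t) * (f y + g y) - \<mu> / 2 * t * (1 - t) * (norm (x - y))\<^sup>2"
    by (simp add: algebra_simps)
qed

text \<open>The limit behind all first-order conditions: a comparison along a segment, divided by
  its parameter \<open>t\<close>, leaves an error linear in \<open>t\<close>.\<close>

lemma le_of_small_quadratic:
  fixes A B C :: real
  assumes "\<And>t. 0 < t \<Longrightarrow> t < 1 \<Longrightarrow> A \<le> B + t * C"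
  shows "A \<le> B"
proof (rule tendsto_lowerbound)
  have "((\<lambda>t. B + t * C) \<longlongrightarrow> B + 0 * C) (at_right 0)" by (intro tendsto_intros)
  then show "((\<lambda>t. B + t * C) \<longlongrightarrow> B) (at_right 0)" by simp
  show "\<forall>\<^sub>F t in at_right 0. A \<le> B + t * C"
    unfolding eventually_at_right_field using assms by (intro exI[of _ 1]) auto
qed simp

lemma strongly_convex_growth:
  fixes H :: "'a::real_inner \<Rightarrow> real"
  assumes H: "strongly_convex \<mu> H" and x: "\<And>y. H x \<le> H y"
  shows "H y \<ge> H x + \<mu> / 2 * (norm (y - x))\<^sup>2"
proof (rule le_of_small_quadratic[where C = "\<mu> / 2 * (norm (y - x))\<^sup>2"])
  fix t :: real assume t: "0 < t" "t < 1"
  have "H x \<le> H (t *\<^sub>R y + (1 - t) *\<^sub>R x)" by (rule x)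
  also have "\<dots> \<le> t * H y + (1 - t) * H x - \<mu> / 2 * t * (1 - t) * (norm (y - x))\<^sup>2"
    using H t by (simp add: strongly_convex_def)
  finally have "t * (H x + \<mu> / 2 * (norm (y - x))\<^sup>2) \<le> t * (H y + t * (\<mu> / 2 * (norm (y - x))\<^sup>2))"
    by (simp add: algebra_simps diff_divide_distrib)
  then show "H x + \<mu> / 2 * (norm (y - x))\<^sup>2 \<le> H y + t * (\<mu> / 2 * (norm (y - x))\<^sup>2)"
    using t by simp
qed

lemma strongly_convex_attains_min:
  fixes H :: "'a::euclidean_space \<Rightarrow> real"
  assumes H: "strongly_convex \<mu> H" and \<mu>: "\<mu> > 0"
  shows "\<exists>x. \<forall>y. H x \<le> H y"
proof -
  have cont: "continuous_on S H" for S
    using convex_on_continuous[OF open_UNIV strongly_convex_imp_convex[OF H]] \<mu>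
    by (meson continuous_on_subset less_imp_le subset_UNIV)
  obtain x1 where x1: "\<And>y. y \<in> sphere 0 1 \<Longrightarrow> H x1 \<le> H y"
    using continuous_attains_inf[of "sphere (0::'a) 1" H] cont by (metis compact_sphere sphere_eq_empty not_one_less_zero)
  \<comment> \<open>Chosen so that beyond radius \<open>R\<close> the quadratic gain of strong
    convexity outweighs the possible drop from \<open>H 0\<close> to the minimum over the unit
    sphere.\<close>
  define R where "R = 1 + 2 * \<bar>H 0 - H x1\<bar> / \<mu>"
  have R: "R \<ge> 1" using \<mu> by (simp add: R_def)
  obtain x2 where x2: "x2 \<in> cball 0 R" "\<And>y. y \<in> cball 0 R \<Longrightarrow> H x2 \<le> H y"
    using continuous_attains_inf[of "cball (0::'a) R" H] cont R by (force simp: cball_eq_empty)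
  have "H x2 \<le> H y" for y
  proof (cases "norm y \<le> R")
    case True
    then show ?thesis using x2 by simp
  next
    case False
    define r where "r = norm y"
    have r: "r > R" "r > 1" using False R by (auto simp: r_def)
    have "H x1 \<le> H ((1/r) *\<^sub>R y + (1 - 1/r) *\<^sub>R 0)"
      using r by (intro x1) (auto simp: r_def)
    also have "\<dots> \<le> (1/r) * H y + (1 - 1/r) * H 0 - \<mu> / 2 * (1/r) * (1 - 1/r) * (norm (y - 0))\<^sup>2"
      using r by (intro H[unfolded strongly_convex_def, rule_format]) simp
    finally have "r * H x1 \<le> r * ((1/r) * H y + (1 - 1/r) * H 0 - \<mu> / 2 * (1/r) * (1 - 1/r) * r\<^sup>2)"
      using r by (intro mult_left_mono) (auto simp: r_def)
    also have "\<dots> = H y + (r - 1) * H 0 - \<mu> / 2 * (r - 1) * r"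
    proof -
      have "r * (1/r) = 1" using r by simp
      then show ?thesis by algebra
    qed
    finally have 1: "H y - H 0 \<ge> r * (\<mu> / 2 * (r - 1) - (H 0 - H x1))"
      by (simp add: algebra_simps)
    have "\<mu> / 2 * (r - 1) \<ge> \<mu> / 2 * (R - 1)" using r \<mu> by simp
    also have "\<mu> / 2 * (R - 1) = \<bar>H 0 - H x1\<bar>" using \<mu> by (simp add: R_def)
    finally have "\<mu> / 2 * (r - 1) - (H 0 - H x1) \<ge> 0" by linarith
    then have "r * (\<mu> / 2 * (r - 1) - (H 0 - H x1)) \<ge> 0" using r by (intro mult_nonneg_nonneg) auto
    then have "H 0 \<le> H y" using 1 by simp
    then show ?thesis using x2(2)[of 0] R by simp
  qed
  then show ?thesis by blast
qed

section \<open>Proximal steps of suprema of affine functions\<close>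

text \<open>The function \<open>h\<close> may be infinite and its domain need not be closed; what
  remains is lower semicontinuity, encoded by the affine minorants in \<open>Q\<close>. One minorant
  makes the objective coercive, so a minimizing sequence has a convergent subsequence, and every
  minorant passes to its limit.\<close>

lemma prox_attained:
  fixes h :: "real \<Rightarrow> ereal" and Q :: "(real \<times> real) set"
  assumes h: "\<And>s e. h s \<le> ereal e \<longleftrightarrow> (\<forall>(a, b)\<in>Q. a * s - b \<le> e)"
    and Q: "Q \<noteq> {}" and dom: "h s0 \<noteq> \<infinity>" and c: "c > 0"
  shows "\<exists>w. \<forall>w'. ereal (c * (w - z)\<^sup>2 + gr * (w - z)) + h w
           \<le> ereal (c * (w' - z)\<^sup>2 + gr * (w' - z)) + h w'"
proof -
  define q where "q = (\<lambda>w. c * (w - z)\<^sup>2 + gr * (w - z))"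
  obtain a0 b0 where ab: "(a0, b0) \<in> Q" using Q by auto
  have nm: "h s \<noteq> -\<infinity>" for s
  proof
    assume "h s = -\<infinity>"
    then have "h s \<le> ereal (a0 * s - b0 - 1)" by simp
    then show False using h ab by fastforce
  qed
  define D where "D = {s. h s \<noteq> \<infinity>}"
  define r where "r = (\<lambda>s. real_of_ereal (h s))"
  have hr: "h s = ereal (r s)" if "s \<in> D" for s
    using that nm[of s] unfolding D_def r_def by (cases "h s") auto
  have rle: "s \<in> D \<and> r s \<le> e \<longleftrightarrow> (\<forall>(a, b)\<in>Q. a * s - b \<le> e)" for s e
    unfolding h[symmetric] using hr[of s] by (cases "s \<in> D") (auto simp: D_def)
  \<comment> \<open>Completing the square: the quadratic plus the chosen minorant is a parabola
    centred at \<open>\<beta>\<close>.\<close>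
  define \<beta> where "\<beta> = z - (gr + a0) / (2 * c)"
  have sq: "q w + (a0 * w - b0) = c * (w - \<beta>)\<^sup>2 + (a0 * z - b0 - (gr + a0)\<^sup>2 / (4 * c))" for w
    using c unfolding q_def \<beta>_def by (simp add: power2_eq_square field_simps)
  define \<gamma> where "\<gamma> = a0 * z - b0 - (gr + a0)\<^sup>2 / (4 * c)"
  have low: "q w + r w \<ge> c * (w - \<beta>)\<^sup>2 + \<gamma>" if "w \<in> D" for w
  proof -
    have "a0 * w - b0 \<le> r w" using rle[of w "r w"] that ab by fastforce
    then show ?thesis using sq[of w] by (simp add: \<gamma>_def)
  qed
  define \<Psi> where "\<Psi> = (\<lambda>w. q w + r w)"
  have s0: "s0 \<in> D" using dom by (simp add: D_def)
  have low': "\<gamma> \<le> \<Psi> w" if "w \<in> D" for w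
    using low[OF that] c mult_nonneg_nonneg[OF less_imp_le[OF c] zero_le_power2, of "w - \<beta>"]
    unfolding \<Psi>_def by linarith
  have bdd: "bdd_below (\<Psi> ` D)" using low' by (intro bdd_belowI2)
  define \<mu> where "\<mu> = Inf (\<Psi> ` D)"
  have "\<exists>w\<in>D. \<Psi> w < \<mu> + inverse (real (Suc k))" for k
    using cInf_lessD[of "\<Psi> ` D" "\<mu> + inverse (real (Suc k))"] s0 unfolding \<mu>_def by auto
  then obtain w where w: "\<And>k. w k \<in> D" "\<And>k. \<Psi> (w k) < \<mu> + inverse (real (Suc k))" by metis
  have "\<bar>w k\<bar> \<le> \<bar>\<beta>\<bar> + ((\<mu> + 1 - \<gamma>) / c + 1)" for k
  proof -
    have "inverse (real (Suc k)) \<le> 1" by (simp add: inverse_le_1_iff)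
    then have "c * (w k - \<beta>)\<^sup>2 \<le> \<mu> + 1 - \<gamma>"
      using low[OF w(1)[of k]] w(2)[of k] unfolding \<Psi>_def by linarith
    then have 1: "(w k - \<beta>)\<^sup>2 \<le> (\<mu> + 1 - \<gamma>) / c" using c by (simp add: field_simps)
    have "0 \<le> (\<bar>w k - \<beta>\<bar> - 1)\<^sup>2" by simp
    then have "2 * \<bar>w k - \<beta>\<bar> \<le> (w k - \<beta>)\<^sup>2 + 1" by (simp add: power2_diff)
    moreover have "0 \<le> (w k - \<beta>)\<^sup>2" by simp
    moreover have "a \<le> X + 1" if "2 * a \<le> s + 1" "0 \<le> s" "s \<le> X" for a s X :: real
      using that by linarith
    ultimately have "\<bar>w k - \<beta>\<bar> \<le> (\<mu> + 1 - \<gamma>) / c + 1" using 1 by blast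
    then show ?thesis by linarith
  qed
  then have "bounded (range w)" unfolding bounded_iff by auto
  then obtain l \<rho> where l: "strict_mono \<rho>" "(w \<circ> \<rho>) \<longlonglongrightarrow> l"
    using bounded_imp_convergent_subsequence by blast
  have lim0: "(\<lambda>k. \<mu> + inverse (real (Suc (\<rho> k)))) \<longlonglongrightarrow> \<mu> + 0"
    using LIMSEQ_subseq_LIMSEQ[OF LIMSEQ_inverse_real_of_nat l(1)]
    by (intro tendsto_add tendsto_const) (simp add: comp_def)
  have "a * l - b \<le> \<mu> - q l" if "(a, b) \<in> Q" for a b
  proof -
    have "(\<lambda>k. q (w (\<rho> k)) + (a * w (\<rho> k) - b)) \<longlonglongrightarrow> q l + (a * l - b)"
      unfolding q_def using l(2) by (intro tendsto_intros) (simp_all add: comp_def)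
    moreover have "q (w (\<rho> k)) + (a * w (\<rho> k) - b) \<le> \<mu> + inverse (real (Suc (\<rho> k)))" for k
    proof -
      have "a * w (\<rho> k) - b \<le> r (w (\<rho> k))" using rle[of "w (\<rho> k)" "r (w (\<rho> k))"] w(1) that by fastforce
      then show ?thesis using w(2)[of "\<rho> k"] unfolding \<Psi>_def by linarith
    qed
    ultimately have "q l + (a * l - b) \<le> \<mu> + 0" using lim0 by (intro LIMSEQ_le) auto
    then show ?thesis by simp
  qed
  then have "l \<in> D \<and> r l \<le> \<mu> - q l" unfolding rle by auto
  then have lD: "l \<in> D" and "\<Psi> l \<le> \<mu>" by (auto simp: \<Psi>_def)
  then have min: "\<Psi> l \<le> \<Psi> w'" if "w' \<in> D" for w'
    using cInf_lower[OF _ bdd, of "\<Psi> w'"] that unfolding \<mu>_def by force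
  have "ereal (q l) + h l \<le> ereal (q w') + h w'" for w'
  proof (cases "w' \<in> D")
    case True
    then show ?thesis using min[OF True] lD by (simp add: hr \<Psi>_def)
  next
    case False
    then show ?thesis by (simp add: D_def)
  qed
  then show ?thesis unfolding q_def by blast
qed

lemma sum_lessThan_add:
  "(\<Sum>i<a + b. f i) = (\<Sum>i<a. f i) + (\<Sum>j<b. f (a + j :: nat) :: real)"
  by (induction b) (simp_all add: add.assoc)

section \<open>The Lagrangian and the dual objective\<close>

locale ardca_problem =
  fixes P :: "'t::finite cdata"
  assumes n_pos: "nn P \<ge> 1"
    and A1: "assumption1 P"
    and Lpos: "\<forall>i<nhat P. Lc P i > 0"
begin

abbreviation "N \<equiv> nhat P"
abbreviation "L \<equiv> Lc P"

lemma N_pos: "N \<ge> 1" and n_le_N: "nn P \<le> N"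
  using n_pos by (auto simp: nhat_def)

lemma L_pos: "i < N \<Longrightarrow> L i > 0" and L_nonneg: "i < N \<Longrightarrow> L i \<ge> 0"
  using Lpos by (auto intro: less_imp_le)

lemma mu_pos: "mu P > 0" and f_strongly_convex: "strongly_convex (mu P) (fobj P)"
  using A1 by (auto simp: assumption1_def)

lemma phi_convex: "i < nn P \<Longrightarrow> convex_on UNIV (phis P i)"
  and phi_lipschitz: "i < nn P \<Longrightarrow> (Mlip P)-lipschitz_on UNIV (phis P i)"
  using A1 by (auto simp: assumption1_def)

lemma g_convex: "i < mm P \<Longrightarrow> convex_on UNIV (gs P i)"
  and g_subgradient_bound: "i < mm P \<Longrightarrow> s \<in> subgradients (gs P i) x \<Longrightarrow> norm s \<le> Lgs P i"
  using A1 unfolding assumption1_def by blast+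

text \<open>The factor of \<open>u i\<close> in the Lagrangian, uniform over the three blocks; at
  the minimizer, \<open>- coef i\<close> is the partial derivative of d.\<close>

definition coef :: "nat \<Rightarrow> real^'t \<Rightarrow> real" where
  "coef i x = (if i < nn P then (Acol P i \<bullet> x) / real (nn P)
     else if i < nn P + pp P then Brow P (i - nn P) \<bullet> x + bvec P (i - nn P)
     else gs P (i - nn P - pp P) x)"

lemma graddual_coef: "graddual P u i = - coef i (xdual P u)"
  by (simp add: graddual_def coef_def Let_def)

lemma sum_blocks:
  fixes f :: "nat \<Rightarrow> real"
  shows "(\<Sum>i<N. f i) = (\<Sum>i<nn P. f i) + (\<Sum>j<pp P. f (nn P + j)) + (\<Sum>i<mm P. f (nn P + pp P + i))"
  by (simp add: nhat_def sum_lessThan_add)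

lemma Lag_coef: "Lag P x u = fobj P x + (\<Sum>i<N. u i * coef i x)"
  unfolding sum_blocks Lag_def coef_def by simp

lemma coef_affine:
  assumes "i < nn P + pp P"
  shows "coef i ((1 - t) *\<^sub>R x + t *\<^sub>R y) = (1 - t) * coef i x + t * coef i y"
proof (cases "i < nn P")
  case True
  then show ?thesis using n_pos by (simp add: coef_def inner_add_right inner_diff_right field_simps)
next
  case False
  then show ?thesis using assms by (simp add: coef_def inner_add_right inner_diff_right algebra_simps)
qed

lemma coef_convex:
  assumes "i < N"
  shows "convex_on UNIV (coef i)"
proof (cases "i < nn P + pp P")
  case True
  then show ?thesis by (intro convex_onI) (auto simp: coef_affine)
next
  case False
  then have "i - nn P - pp P < mm P" using assms by (auto simp: nhat_def)
  moreover have "coef i = gs P (i - nn P - pp P)" using False by (auto simp: coef_def)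
  ultimately show ?thesis using g_convex by simp
qed

lemma scaled_coef_convex:
  assumes "i < N" "i < nn P + pp P \<or> a \<ge> 0"
  shows "convex_on UNIV (\<lambda>x. a * coef i x)"
proof (cases "i < nn P + pp P")
  case True
  show ?thesis
  proof (rule convex_onI)
    fix t :: real and x y
    show "a * coef i ((1 - t) *\<^sub>R x + t *\<^sub>R y) \<le> (1 - t) * (a * coef i x) + t * (a * coef i y)"
      unfolding coef_affine[OF True] by (simp add: algebra_simps)
  qed simp
next
  case False
  then show ?thesis using assms coef_convex by (intro convex_on_cmul) auto
qed

text \<open>The constants \<open>L i\<close> are made for this: \<open>mu P * L i\<close> is the
  square of a Lipschitz constant of \<open>coef i\<close>.\<close>

lemma coef_lipschitz:
  assumes "i < N"
  shows "(coef i x - coef i y)\<^sup>2 \<le> mu P * L i * (norm (x - y))\<^sup>2"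
proof -
  have ip: "(a \<bullet> x - a \<bullet> y)\<^sup>2 \<le> (norm a)\<^sup>2 * (norm (x - y))\<^sup>2" for a :: "real^'t"
  proof -
    have "\<bar>a \<bullet> (x - y)\<bar> \<le> norm a * norm (x - y)" by (rule Cauchy_Schwarz_ineq2)
    then show ?thesis unfolding inner_diff_right power_mult_distrib[symmetric]
      by (rule abs_le_square_iff[THEN iffD1, OF order_trans]) simp
  qed
  consider "i < nn P" | "\<not> i < nn P" "i < nn P + pp P" | "\<not> i < nn P + pp P" by linarith
  then show ?thesis
  proof cases
    case 1
    have "(coef i x - coef i y)\<^sup>2 = (Acol P i \<bullet> x - Acol P i \<bullet> y)\<^sup>2 / (real (nn P))\<^sup>2"
      using 1 by (simp add: coef_def diff_divide_distrib[symmetric] power_divide)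
    also have "\<dots> \<le> ((norm (Acol P i))\<^sup>2 * (norm (x - y))\<^sup>2) / (real (nn P))\<^sup>2"
      by (intro divide_right_mono ip) simp
    also have "\<dots> = mu P * L i * (norm (x - y))\<^sup>2" using 1 mu_pos by (simp add: Lc_def)
    finally show ?thesis .
  next
    case 2
    then show ?thesis using ip[of "Brow P (i - nn P)"] mu_pos by (simp add: coef_def Lc_def)
  next
    case 3
    let ?j = "i - nn P - pp P"
    have j: "?j < mm P" using assms 3 by (auto simp: nhat_def)
    have "\<bar>gs P ?j x - gs P ?j y\<bar> \<le> Lgs P ?j * norm (x - y)"
      using lipschitz_of_bounded_subgradients[OF g_convex[OF j]] g_subgradient_bound[OF j] by blast
    then have "(gs P ?j x - gs P ?j y)\<^sup>2 \<le> (Lgs P ?j * norm (x - y))\<^sup>2"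
      by (rule abs_le_square_iff[THEN iffD1, OF order_trans]) simp
    then show ?thesis using 3 mu_pos by (simp add: coef_def Lc_def power_mult_distrib)
  qed
qed

lemma Lag_strongly_convex:
  assumes "inD P u"
  shows "strongly_convex (mu P) (\<lambda>x. Lag P x u)"
  unfolding Lag_coef
proof (rule strongly_convex_add[OF f_strongly_convex])
  show "convex_on UNIV (\<lambda>x. \<Sum>i<N. u i * coef i x)"
    using assms by (intro convex_on_sum_functions scaled_coef_convex) (auto simp: inD_def not_less)
qed

lemma xdual_min:
  assumes "inD P u"
  shows "Lag P (xdual P u) u \<le> Lag P y u"
proof -
  have "\<exists>x. \<forall>y. Lag P x u \<le> Lag P y u"
    by (rule strongly_convex_attains_min[OF Lag_strongly_convex[OF assms] mu_pos])
  from someI_ex[OF this] show ?thesis unfolding xdual_def by blast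
qed

definition dr :: "(nat \<Rightarrow> real) \<Rightarrow> real" where
  "dr u = - Lag P (xdual P u) u"

lemma dr_ge: "inD P u \<Longrightarrow> - Lag P x u \<le> dr u"
  unfolding dr_def using xdual_min[of u x] by simp

lemma ddual_dr:
  assumes "inD P u"
  shows "ddual P u = ereal (dr u)"
proof -
  have "(INF x. ereal (Lag P x u)) = ereal (Lag P (xdual P u) u)"
    using xdual_min[OF assms] by (intro antisym INF_lower INF_greatest) auto
  then show ?thesis by (simp add: ddual_def dr_def)
qed

text \<open>Quadratic growth of the Lagrangian at its minimizer controls how far that minimizer
  moves, and Young's inequality trades this distance against the Lipschitz change of
  \<open>coef i\<close>. The modulus \<open>mu P\<close> cancels and leaves
  \<open>L i / 2\<close>.\<close>

lemma dr_coordinate_descent: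
  assumes v: "inD P v" and v': "inD P (v(i := s))" and i: "i < N"
  shows "dr (v(i := s)) \<le> dr v + graddual P v i * (s - v i) + L i / 2 * (s - v i)\<^sup>2"
proof -
  define x y where "x = xdual P v" and "y = xdual P (v(i := s))"
  define \<delta> where "\<delta> = s - v i"
  have upd: "Lag P y (v(i := s)) = Lag P y v + \<delta> * coef i y"
    unfolding Lag_coef using i
    by (simp add: sum.remove[of "{..<N}" i] \<delta>_def algebra_simps)
  have grow: "Lag P y v \<ge> Lag P x v + mu P / 2 * (norm (y - x))\<^sup>2"
    unfolding x_def
    by (rule strongly_convex_growth[OF Lag_strongly_convex[OF v] xdual_min[OF v]])
  have "2 * \<delta> * (coef i x - coef i y) \<le> L i * \<delta>\<^sup>2 + mu P * (norm (y - x))\<^sup>2"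
  proof -
    have "(coef i x - coef i y)\<^sup>2 / L i \<le> mu P * (norm (y - x))\<^sup>2"
      using coef_lipschitz[OF i, of x y] L_pos[OF i] by (simp add: field_simps norm_minus_commute)
    moreover have "0 \<le> (L i * \<delta> - (coef i x - coef i y))\<^sup>2 / L i" using L_pos[OF i] by simp
    moreover have "(L i * \<delta> - (coef i x - coef i y))\<^sup>2 / L i
        = L i * \<delta>\<^sup>2 - 2 * \<delta> * (coef i x - coef i y) + (coef i x - coef i y)\<^sup>2 / L i"
      using L_pos[OF i] by (simp add: field_simps power2_eq_square)
    ultimately show ?thesis by linarith
  qed
  then show ?thesis using upd grow
    unfolding dr_def graddual_coef x_def[symmetric] y_def[symmetric] \<delta>_def[symmetric]
    by (simp add: algebra_simps)
qed

section \<open>The separable terms: effective domain, convexity, proximal steps\<close>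

text \<open>Pairs \<open>(a, b)\<close> such that \<open>h\<^sub>i\<close> is the supremum of the functions \<open>a s - b\<close>.\<close>

definition minorants :: "nat \<Rightarrow> (real \<times> real) set" where
  "minorants i = (if i < nn P then range (\<lambda>w. (w / real (nn P), phis P i w / real (nn P)))
     else if i < nn P + pp P then {(0, 0)} else (\<lambda>a. (a, 0)) ` {..0})"

lemma hfun_le_iff: "hfun P i s \<le> ereal e \<longleftrightarrow> (\<forall>(a, b)\<in>minorants i. a * s - b \<le> e)"
proof -
  consider "i < nn P" | "\<not> i < nn P" "i < nn P + pp P" | "\<not> i < nn P + pp P" by linarith
  then show ?thesis
  proof cases
    case 1
    have "hfun P i s \<le> ereal e \<longleftrightarrow> conjugate (phis P i) s \<le> ereal (real (nn P) * e)"
      using 1 n_pos by (cases "conjugate (phis P i) s") (auto simp: hfun_def field_simps)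
    also have "\<dots> \<longleftrightarrow> (\<forall>w. s * w - phis P i w \<le> real (nn P) * e)"
      by (simp add: conjugate_def SUP_le_iff)
    also have "\<dots> \<longleftrightarrow> (\<forall>(a, b)\<in>minorants i. a * s - b \<le> e)"
      using 1 n_pos by (auto simp: minorants_def field_simps)
    finally show ?thesis .
  next
    case 2
    then show ?thesis by (simp add: hfun_def minorants_def zero_ereal_def)
  next
    case 3
    show ?thesis
    proof (cases "s \<ge> 0")
      case True
      then have "(\<forall>a\<in>{..0}. a * s \<le> e) \<longleftrightarrow> 0 \<le> e" unfolding Ball_def atMost_iff
        by (metis mult_nonpos_nonneg mult_zero_left order_refl order_trans)
      then show ?thesis using 3 True by (simp add: hfun_def minorants_def zero_ereal_def ball_simps)
    next
      case False
      \<comment> \<open>For negative \<open>s\<close> the witness is a nonpositive slope with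
        product \<open>\<bar>e\<bar> + 1\<close>, so no finite bound holds.\<close>
      have "\<exists>a\<le>0. a * s > e"
        using False by (intro exI[of _ "(\<bar>e\<bar> + 1) / s"]) (auto simp: divide_nonneg_neg divide_nonneg_nonpos)
      then show ?thesis using 3 False by (simp add: hfun_def minorants_def ball_simps not_le) force
    qed
  qed
qed

lemma minorants_nonempty: "minorants i \<noteq> {}"
  by (auto simp: minorants_def)

definition hdom :: "nat \<Rightarrow> real set" where
  "hdom i = {s. hfun P i s \<noteq> \<infinity>}"

definition hr :: "nat \<Rightarrow> real \<Rightarrow> real" where
  "hr i s = real_of_ereal (hfun P i s)"

lemma hfun_not_MInfty: "hfun P i s \<noteq> -\<infinity>"
proof
  assume *: "hfun P i s = -\<infinity>"
  obtain a b where "(a, b) \<in> minorants i" using minorants_nonempty[of i] by auto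
  moreover have "hfun P i s \<le> ereal (a * s - b - 1)" using * by simp
  ultimately show False unfolding hfun_le_iff by fastforce
qed

lemma hfun_hr: "s \<in> hdom i \<Longrightarrow> hfun P i s = ereal (hr i s)"
  using hfun_not_MInfty[of i s] unfolding hdom_def hr_def by (cases "hfun P i s") auto

lemma hr_le_iff: "s \<in> hdom i \<and> hr i s \<le> e \<longleftrightarrow> (\<forall>(a, b)\<in>minorants i. a * s - b \<le> e)"
  unfolding hfun_le_iff[symmetric] using hfun_hr[of s i]
  by (cases "s \<in> hdom i") (auto simp: hdom_def)

lemma hr_ge: "s \<in> hdom i \<Longrightarrow> (a, b) \<in> minorants i \<Longrightarrow> a * s - b \<le> hr i s"
  using hr_le_iff[of s i "hr i s"] by fastforce

lemma hr_convex: "convex_on (hdom i) (hr i)"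
proof -
  have *: "(1 - t) * x + t * y \<in> hdom i \<and> hr i ((1 - t) * x + t * y) \<le> (1 - t) * hr i x + t * hr i y"
    if "0 \<le> t" "t \<le> 1" "x \<in> hdom i" "y \<in> hdom i" for t x y
    unfolding hr_le_iff
  proof clarify
    fix a b assume ab: "(a, b) \<in> minorants i"
    have "(1 - t) * (a * x - b) + t * (a * y - b) \<le> (1 - t) * hr i x + t * hr i y"
      using that hr_ge[OF _ ab] by (intro add_mono mult_left_mono) auto
    then show "a * ((1 - t) * x + t * y) - b \<le> (1 - t) * hr i x + t * hr i y"
      by (simp add: algebra_simps)
  qed
  then have "convex (hdom i)" unfolding convex_alt by simp
  then show ?thesis using * by (intro convex_onI) auto
qed

lemma hr_block1_le:
  assumes "i < nn P" "\<And>w. s * w - phis P i w \<le> e"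
  shows "s \<in> hdom i \<and> hr i s \<le> e / real (nn P)"
  unfolding hr_le_iff using assms n_pos by (auto simp: minorants_def field_simps)

lemma hr_block1_ge:
  assumes "i < nn P" "s \<in> hdom i"
  shows "(s * w - phis P i w) / real (nn P) \<le> hr i s"
  using hr_ge[OF assms(2), of "w / real (nn P)" "phis P i w / real (nn P)"] assms(1)
  by (simp add: minorants_def diff_divide_distrib mult.commute)

lemma hr_blocks23: "\<not> i < nn P \<Longrightarrow> s \<in> hdom i \<Longrightarrow> hr i s = 0"
  by (auto simp: hr_def hdom_def hfun_def split: if_splits)

lemma hdom_block2: "\<not> i < nn P \<Longrightarrow> i < nn P + pp P \<Longrightarrow> s \<in> hdom i"
  by (auto simp: hdom_def hfun_def)

lemma hdom_block3: "\<not> i < nn P + pp P \<Longrightarrow> s \<in> hdom i \<longleftrightarrow> s \<ge> 0"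
  by (auto simp: hdom_def hfun_def)

text \<open>Equality case of Fenchel's inequality at a subgradient of \<open>phis P i\<close>, which
  the Lipschitz constant bounds. It provides the path-dependent reference point of the objective
  bound.\<close>

lemma conjugate_subgradient:
  assumes i: "i < nn P"
  shows "\<exists>s. s \<in> hdom i \<and> hr i s = (s * r - phis P i r) / real (nn P) \<and> \<bar>s\<bar> \<le> Mlip P"
proof -
  obtain s where s: "s \<in> subgradients (phis P i) r"
    using subgradient_exists[OF phi_convex[OF i]] by blast
  then have s': "phis P i y \<ge> phis P i r + s * (y - r)" for y by (simp add: subgradients_def)
  have 1: "s \<in> hdom i \<and> hr i s \<le> (s * r - phis P i r) / real (nn P)"
    using s' by (intro hr_block1_le[OF i]) (simp add: algebra_simps)
  then have 2: "hr i s = (s * r - phis P i r) / real (nn P)"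
    using hr_block1_ge[OF i, of s r] by linarith
  have lip: "\<bar>phis P i y - phis P i r\<bar> \<le> Mlip P * \<bar>y - r\<bar>" for y
    using lipschitz_onD[OF phi_lipschitz[OF i], of y r] by (simp add: dist_real_def)
  have "\<bar>s\<bar> \<le> Mlip P"
    using s'[of "r + 1"] s'[of "r - 1"] lip[of "r + 1"] lip[of "r - 1"] by simp
  then show ?thesis using 1 2 by blast
qed

lemma hdom_nonempty: "\<exists>s. s \<in> hdom i"
proof (cases "i < nn P")
  case True
  then show ?thesis using conjugate_subgradient by blast
next
  case False
  then show ?thesis using hdom_block2 hdom_block3 by (intro exI[of _ 0]) (metis order_refl)
qed

text \<open>Comparing \<open>w\<close> with points on the segment towards \<open>w'\<close> and
  shrinking that segment shows that minus the derivative of the smooth part is a subgradient of the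
  separable term at \<open>w\<close>.\<close>

lemma coord_step_prox:
  fixes gr z :: real
  assumes i: "i < N" and th: "th > 0"
  defines "w \<equiv> coord_step P th i gr z"
  shows "w \<in> hdom i"
    and "w' \<in> hdom i \<Longrightarrow> hr i w - (2 * (real N * th * L i) * (w - z) + gr) * (w' - w) \<le> hr i w'"
proof -
  define c where "c = real N * th * L i"
  have c: "c > 0" using N_pos th L_pos[OF i] by (simp add: c_def)
  obtain s0 where s0: "s0 \<in> hdom i" using hdom_nonempty by blast
  have "\<exists>w. \<forall>w'. ereal (c * (w - z)\<^sup>2 + gr * (w - z)) + hfun P i w
      \<le> ereal (c * (w' - z)\<^sup>2 + gr * (w' - z)) + hfun P i w'"
    using s0 by (intro prox_attained[OF hfun_le_iff minorants_nonempty _ c]) (simp add: hdom_def)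
  from someI_ex[OF this]
  have min: "ereal (c * (w - z)\<^sup>2 + gr * (w - z)) + hfun P i w
      \<le> ereal (c * (w' - z)\<^sup>2 + gr * (w' - z)) + hfun P i w'" for w'
    unfolding w_def coord_step_def c_def by blast
  show w: "w \<in> hdom i"
    using min[of s0] hfun_hr[OF s0] by (auto simp: hdom_def)
  have min': "c * (w - z)\<^sup>2 + gr * (w - z) + hr i w \<le> c * (y - z)\<^sup>2 + gr * (y - z) + hr i y"
    if "y \<in> hdom i" for y
    using min[of y] hfun_hr[OF w] hfun_hr[OF that] by simp
  show "hr i w - (2 * (real N * th * L i) * (w - z) + gr) * (w' - w) \<le> hr i w'" if w': "w' \<in> hdom i"
  proof -
    have "hr i w \<le> (hr i w' + (2 * c * (w - z) + gr) * (w' - w)) + t * (c * (w' - w)\<^sup>2)"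
      if t: "0 < t" "t < 1" for t
    proof -
      define y where "y = (1 - t) * w + t * w'"
      have y: "y \<in> hdom i" "hr i y \<le> (1 - t) * hr i w + t * hr i w'"
        using convex_onD[OF hr_convex, of t w i w'] 
          convexD_alt[OF convex_on_imp_convex[OF hr_convex] w w', of t] t w w'
        by (simp_all add: y_def)
      have "c * (y - z)\<^sup>2 + gr * (y - z) - (c * (w - z)\<^sup>2 + gr * (w - z))
          = t * ((2 * c * (w - z) + gr) * (w' - w) + t * (c * (w' - w)\<^sup>2))"
        unfolding y_def by (simp add: power2_eq_square algebra_simps)
      then have "t * hr i w \<le> t * (hr i w' + ((2 * c * (w - z) + gr) * (w' - w) + t * (c * (w' - w)\<^sup>2)))"
        using min'[OF y(1)] y(2) by (simp add: algebra_simps)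
      then show ?thesis using t by simp
    qed
    then have "hr i w \<le> hr i w' + (2 * c * (w - z) + gr) * (w' - w)"
      by (rule le_of_small_quadratic)
    then show ?thesis by (simp add: c_def)
  qed
qed

text \<open>Outside the first block \<open>hr i\<close> vanishes on its domain, which is closed
  under adding 1 and, in the second block, under subtracting 1. Testing optimality at these points
  gives the sign of \<open>r\<close>, and this ties constraint residuals to proximal steps.\<close>

lemma coord_step_gradient:
  fixes gr z :: real
  assumes i: "i < N" and th: "th > 0"
  defines "r \<equiv> 2 * (real N * th * L i) * (coord_step P th i gr z - z) + gr"
  shows "\<not> i < nn P \<Longrightarrow> r \<ge> 0"
    and "\<not> i < nn P \<Longrightarrow> i < nn P + pp P \<Longrightarrow> r = 0"
proof -
  define w where "w = coord_step P th i gr z"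
  note prox = coord_step_prox[OF i th, where gr = gr and z = z, folded w_def]
  have step: "r * (w' - w) \<ge> 0" if "\<not> i < nn P" "w' \<in> hdom i" for w'
    using prox(2)[OF that(2)] hr_blocks23[OF that(1) prox(1)] hr_blocks23[OF that]
    unfolding r_def w_def[symmetric] by simp
  show "r \<ge> 0" if "\<not> i < nn P"
  proof -
    have "w + 1 \<in> hdom i"
      using prox(1) that hdom_block2[of i "w + 1"] hdom_block3[of i w] hdom_block3[of i "w + 1"] by force
    from step[OF that this] show ?thesis by simp
  qed
  then show "r = 0" if "\<not> i < nn P" "i < nn P + pp P"
    using step[OF that(1) hdom_block2[OF that], of "w - 1"] that by force
qed

section \<open>Strong duality\<close>

definition udom :: "(nat \<Rightarrow> real) \<Rightarrow> bool" where
  "udom u \<longleftrightarrow> (\<forall>i<N. u i \<in> hdom i)"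

definition Dr :: "(nat \<Rightarrow> real) \<Rightarrow> real" where
  "Dr u = dr u + (\<Sum>i<N. hr i (u i))"

lemma udom_inD: "udom u \<Longrightarrow> inD P u"
  using hdom_block3 by (auto simp: udom_def inD_def)

lemma Dfun_Dr:
  assumes "udom u"
  shows "Dfun P u = ereal (Dr u)"
proof -
  have "(\<Sum>i<N. hfun P i (u i)) = (\<Sum>i<N. ereal (hr i (u i)))"
    using assms by (intro sum.cong) (auto simp: udom_def hfun_hr)
  then show ?thesis
    unfolding Dfun_def Dr_def ddual_dr[OF udom_inD[OF assms]] by simp
qed

lemma Dfun_infinite:
  assumes "\<not> udom u"
  shows "Dfun P u = \<infinity>"
proof -
  have "(\<Sum>i<N. hfun P i (u i)) = \<infinity>"
    using assms unfolding sum_Pinfty by (auto simp: udom_def hdom_def)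
  moreover have "ddual P u \<noteq> -\<infinity>"
  proof -
    have "(INF x. ereal (Lag P x u)) \<le> ereal (Lag P 0 u)" by (rule INF_lower) simp
    then show ?thesis unfolding ddual_def by (auto simp: ereal_uminus_eq_reorder)
  qed
  ultimately show ?thesis by (simp add: Dfun_def)
qed

lemma sum_split_n: "(\<Sum>i<N. f i) = (\<Sum>i<nn P. f i) + (\<Sum>i=nn P..<N. f i :: real)"
  using n_le_N by (metis atLeast0LessThan sum.atLeastLessThan_concat le0)

lemma primal_ge_dual:
  assumes u: "udom u"
  shows "- Dr u \<le> Fobj P x + (\<Sum>i=nn P..<N. u i * coef i x)"
proof -
  have "(\<Sum>i=nn P..<N. hr i (u i)) = 0"
    using u by (intro sum.neutral) (auto simp: udom_def hr_blocks23)
  moreover have "(\<Sum>i<nn P. u i * coef i x - (1 / real (nn P)) * phis P i (Acol P i \<bullet> x)) \<le> (\<Sum>i<nn P. hr i (u i))"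
  proof (rule sum_mono)
    fix i assume i: "i \<in> {..<nn P}"
    then have "u i \<in> hdom i" using u n_le_N by (auto simp: udom_def)
    then show "u i * coef i x - (1 / real (nn P)) * phis P i (Acol P i \<bullet> x) \<le> hr i (u i)"
      using hr_block1_ge[of i "u i" "Acol P i \<bullet> x"] i by (simp add: coef_def diff_divide_distrib)
  qed
  ultimately show ?thesis using dr_ge[OF udom_inD[OF u], of x]
    unfolding Dr_def Lag_coef Fobj_def sum_split_n
    by (simp add: sum_subtractf sum_distrib_left)
qed

lemma weak_duality:
  assumes u: "udom u" and x: "feasible P x"
  shows "- Dr u \<le> Fobj P x"
proof -
  have "(\<Sum>i=nn P..<N. u i * coef i x) \<le> 0"
  proof (rule sum_nonpos)
    fix i assume i: "i \<in> {nn P..<N}"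
    show "u i * coef i x \<le> 0"
    proof (cases "i < nn P + pp P")
      case True
      then have "i - nn P < pp P" using i by auto
      then show ?thesis using x i True by (simp add: coef_def feasible_def)
    next
      case False
      then have "u i \<ge> 0" using u i hdom_block3 by (auto simp: udom_def)
      moreover have "coef i x \<le> 0" using x i False by (auto simp: coef_def feasible_def nhat_def)
      ultimately show ?thesis by (simp add: mult_nonneg_nonpos)
    qed
  qed
  then show ?thesis using primal_ge_dual[OF u, of x] by simp
qed

text \<open>The inequalities are priced on the affine set of the equations, where the Slater point
  has slack; then the equations are priced on the whole space, and finally each
  \<open>phis P i\<close> is exchanged for its conjugate.\<close>

lemma strong_duality:
  assumes opt: "\<And>x. feasible P x \<Longrightarrow> c \<le> Fobj P x"
  shows "\<exists>u. udom u \<and> Dr u \<le> - c"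
proof -
  define h where "h = (\<lambda>j x. Brow P j \<bullet> x + bvec P j)"
  have h: "h j ((1 - t) *\<^sub>R x + t *\<^sub>R y) = (1 - t) * h j x + t * h j y" for j x y t
    by (simp add: h_def inner_add_right inner_diff_right algebra_simps)
  define C where "C = {x. \<forall>j<pp P. h j x = 0}"
  have C: "convex C"
    unfolding convex_alt C_def
  proof (intro ballI allI impI, unfold mem_Collect_eq, intro allI impI)
    fix x y j and t :: real
    assume "\<forall>j<pp P. h j x = 0" "\<forall>j<pp P. h j y = 0" "j < pp P"
    then show "h j ((1 - t) *\<^sub>R x + t *\<^sub>R y) = 0" by (subst h) simp
  qed
  obtain xb where xb: "\<And>i. i < mm P \<Longrightarrow> gs P i xb < 0" "\<And>j. j < pp P \<Longrightarrow> h j xb = 0"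
    using A1 unfolding assumption1_def h_def by blast
  have f: "convex_on UNIV (fobj P)"
    using strongly_convex_imp_convex[OF f_strongly_convex] mu_pos by simp
  have F: "convex_on UNIV (Fobj P)"
    unfolding Fobj_def
    by (intro convex_on_add f convex_on_cmul convex_on_sum_functions
        convex_on_compose_linear[OF phi_convex] bounded_linear.linear bounded_linear_inner_right) auto
  have "\<exists>\<nu>. (\<forall>i<mm P. \<nu> i \<ge> 0) \<and> (\<forall>x\<in>C. Fobj P x + (\<Sum>i<mm P. \<nu> i * gs P i x) \<ge> c)"
  proof (rule inequality_multipliers)
    show "convex_on C (Fobj P)" by (rule convex_on_subset[OF F subset_UNIV C])
    show "convex_on C (gs P i)" if "i < mm P" for i
      by (rule convex_on_subset[OF g_convex[OF that] subset_UNIV C])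
    show "xb \<in> C" using xb(2) by (simp add: C_def)
    show "gs P i xb < 0" if "i < mm P" for i using xb(1)[OF that] .
    show "c \<le> Fobj P x" if "x \<in> C" "\<And>i. i < mm P \<Longrightarrow> gs P i x \<le> 0" for x
      using that by (intro opt) (auto simp: feasible_def C_def h_def)
  qed
  then obtain \<nu> where \<nu>: "\<forall>i<mm P. \<nu> i \<ge> 0" "\<forall>x\<in>C. Fobj P x + (\<Sum>i<mm P. \<nu> i * gs P i x) \<ge> c"
    by (elim exE conjE)
  have G: "convex_on UNIV (\<lambda>x. \<Sum>i<mm P. \<nu> i * gs P i x)"
    using \<nu>(1) g_convex by (intro convex_on_sum_functions convex_on_cmul) auto
  have "\<exists>\<kappa>. \<forall>x. (Fobj P x + (\<Sum>i<mm P. \<nu> i * gs P i x)) + (\<Sum>j<pp P. \<kappa> j * h j x) \<ge> c"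
  proof (rule equality_multipliers[where ?x0.0 = xb])
    show "convex_on UNIV (\<lambda>x. Fobj P x + (\<Sum>i<mm P. \<nu> i * gs P i x))"
      by (intro convex_on_add F G)
    show "h j ((1 - t) *\<^sub>R x + t *\<^sub>R y) = (1 - t) * h j x + t * h j y" for j x y t by (rule h)
    show "h j xb = 0" if "j < pp P" for j using xb(2)[OF that] .
    show "c \<le> Fobj P x + (\<Sum>i<mm P. \<nu> i * gs P i x)" if "\<And>j. j < pp P \<Longrightarrow> h j x = 0" for x
      using that by (intro bspec[OF \<nu>(2)]) (simp add: C_def)
  qed
  then obtain \<kappa> where \<kappa>: "\<forall>x. (Fobj P x + (\<Sum>i<mm P. \<nu> i * gs P i x)) + (\<Sum>j<pp P. \<kappa> j * h j x) \<ge> c" ..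
  have E: "convex_on UNIV (\<lambda>x. \<Sum>j<pp P. \<kappa> j * h j x)"
  proof (intro convex_on_sum_functions convex_on_affine)
    show "\<kappa> j * h j ((1 - t) *\<^sub>R x + t *\<^sub>R y) = (1 - t) * (\<kappa> j * h j x) + t * (\<kappa> j * h j y)" for j x y t
      by (subst h) (simp add: algebra_simps)
  qed auto
  define H where "H = (\<lambda>x. fobj P x + (\<Sum>i<mm P. \<nu> i * gs P i x) + (\<Sum>j<pp P. \<kappa> j * h j x))"
  have "\<exists>s e. (\<forall>i<nn P. \<forall>r. s i * r - (1 / real (nn P)) * phis P i r \<le> e i)
      \<and> (\<forall>x. H x + (\<Sum>i<nn P. s i * (Acol P i \<bullet> x) - e i) \<ge> c)"
  proof (rule fenchel_split_sum)
    show "convex_on UNIV H" unfolding H_def by (intro convex_on_add f G E)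
    show "convex_on UNIV (\<lambda>r. (1 / real (nn P)) * phis P i r)" if "i < nn P" for i
      by (intro convex_on_cmul phi_convex that) simp
    show "linear (\<lambda>x. Acol P i \<bullet> x)" for i
      by (intro bounded_linear.linear bounded_linear_inner_right)
    show "c \<le> H x + (\<Sum>i<nn P. (1 / real (nn P)) * phis P i (Acol P i \<bullet> x))" for x
      using spec[OF \<kappa>, of x] by (simp add: H_def Fobj_def sum_distrib_left)
  qed
  then obtain s e where se: "\<And>i r. i < nn P \<Longrightarrow> s i * r - (1 / real (nn P)) * phis P i r \<le> e i"
      "\<forall>x. H x + (\<Sum>i<nn P. s i * (Acol P i \<bullet> x) - e i) \<ge> c"
    by blast
  \<comment> \<open>The splitting used the functions \<open>phis P i\<close> scaled by
    \<open>1 / nn P\<close>; the factor \<open>nn P\<close> matches the coefficient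
    \<open>Acol P i \<bullet> x / nn P\<close> of \<open>u i\<close> in the Lagrangian.\<close>
  define u where "u = (\<lambda>i. if i < nn P then real (nn P) * s i
      else if i < nn P + pp P then \<kappa> (i - nn P) else \<nu> (i - nn P - pp P))"
  have h1: "u i \<in> hdom i \<and> hr i (u i) \<le> e i" if i: "i < nn P" for i
  proof -
    have "u i * r - phis P i r \<le> real (nn P) * e i" for r
      using se(1)[OF i, of r] n_pos i by (simp add: u_def field_simps)
    from hr_block1_le[OF i this] show ?thesis using n_pos by simp
  qed
  have u: "udom u"
    unfolding udom_def
  proof (intro allI impI)
    fix i assume "i < N"
    consider "i < nn P" | "\<not> i < nn P" "i < nn P + pp P" | "\<not> i < nn P + pp P" by linarith
    then show "u i \<in> hdom i"
    proof cases
      case 1 then show ?thesis using h1 by blast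
    next
      case 2 then show ?thesis by (rule hdom_block2)
    next
      case 3 then show ?thesis using \<nu>(1) \<open>i < N\<close> by (auto simp: hdom_block3 u_def nhat_def)
    qed
  qed
  have "(\<Sum>i<N. hr i (u i)) \<le> (\<Sum>i<nn P. e i)"
  proof -
    have "(\<Sum>i=nn P..<N. hr i (u i)) = 0"
      using u by (intro sum.neutral) (auto simp: udom_def hr_blocks23)
    moreover have "(\<Sum>i<nn P. hr i (u i)) \<le> (\<Sum>i<nn P. e i)" using h1 by (intro sum_mono) auto
    ultimately show ?thesis unfolding sum_split_n by simp
  qed
  moreover have "Lag P x u = H x + (\<Sum>i<nn P. s i * (Acol P i \<bullet> x))" for x
    using n_pos by (simp add: Lag_def H_def u_def h_def add_ac)
  then have "Lag P x u \<ge> c + (\<Sum>i<nn P. e i)" for x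
    using spec[OF se(2), of x] by (simp add: sum_subtractf)
  ultimately have "Dr u \<le> - c" unfolding Dr_def dr_def by (smt (verit))
  then show ?thesis using u by blast
qed

end

section \<open>The step sizes\<close>

text \<open>With \<open>s = theta N k\<close>, the next value is the positive root of
  \<open>t\<^sup>2 = (1 - t) * s\<^sup>2\<close>; this identity makes the weighted one-step
  estimates telescope.\<close>

lemma theta_properties:
  assumes N: "N \<ge> (1::nat)"
  shows theta_pos: "theta N k > 0"
    and theta_Suc_sq: "(theta N (Suc k))\<^sup>2 = (1 - theta N (Suc k)) * (theta N k)\<^sup>2"
    and theta_antimono: "theta N (Suc k) \<le> theta N k"
    and theta_le: "theta N k \<le> 1 / real N"
proof -
  have rec: "theta N (Suc k) > 0 \<and> (theta N (Suc k))\<^sup>2 = (1 - theta N (Suc k)) * (theta N k)\<^sup>2"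
    if "theta N k > 0" for k
  proof -
    define t where "t = theta N k"
    define s where "s = sqrt (t^4 + 4 * t\<^sup>2)"
    have t: "t > 0" using that by (simp add: t_def)
    have s2: "s\<^sup>2 = t^4 + 4 * t\<^sup>2" using t by (simp add: s_def)
    have "(t\<^sup>2)\<^sup>2 < t^4 + 4 * t\<^sup>2" using t by (simp add: power_mult[symmetric])
    then have "t\<^sup>2 < s" unfolding s_def by (intro real_less_rsqrt)
    moreover have th: "theta N (Suc k) = (s - t\<^sup>2) / 2" by (simp add: t_def s_def)
    moreover have "((s - t\<^sup>2) / 2)\<^sup>2 = (1 - (s - t\<^sup>2) / 2) * t\<^sup>2"
    proof -
      have "((s - t\<^sup>2) / 2)\<^sup>2 = (s\<^sup>2 - 2 * s * t\<^sup>2 + t^4) / 4"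
        by (simp add: power2_eq_square power4_eq_xxxx field_simps)
      also have "\<dots> = (1 - (s - t\<^sup>2) / 2) * t\<^sup>2"
        unfolding s2 by (simp add: power2_eq_square power4_eq_xxxx field_simps)
      finally show ?thesis .
    qed
    ultimately show ?thesis unfolding th t_def[symmetric] by simp
  qed
  have pos: "theta N k > 0" for k
    by (induction k) (use N rec in \<open>auto simp del: theta.simps(2)\<close>)
  have anti: "theta N (Suc k) \<le> theta N k" for k
  proof -
    have "(1 - theta N (Suc k)) * (theta N k)\<^sup>2 \<le> 1 * (theta N k)\<^sup>2"
      using pos[of "Suc k"] by (intro mult_right_mono) (auto simp del: theta.simps(2))
    then have "(theta N (Suc k))\<^sup>2 \<le> (theta N k)\<^sup>2" using rec[OF pos[of k]] by (simp del: theta.simps(2))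
    then show ?thesis using pos[of k] by (rule power2_le_imp_le[OF _ less_imp_le])
  qed
  show "theta N k > 0" by (rule pos)
  show "(theta N (Suc k))\<^sup>2 = (1 - theta N (Suc k)) * (theta N k)\<^sup>2" using rec[OF pos] by blast
  show "theta N (Suc k) \<le> theta N k" by (rule anti)
  show "theta N k \<le> 1 / real N"
  proof (induction k)
    case (Suc k)
    then show ?case using anti[of k] by linarith
  qed simp
qed

lemma theta_recip_Suc:
  assumes N: "N \<ge> (1::nat)"
  shows "(1 - theta N (Suc k)) / (theta N (Suc k))\<^sup>2 = 1 / (theta N k)\<^sup>2"
  using theta_Suc_sq[OF N, of k] theta_pos[OF N, of k] theta_pos[OF N, of "Suc k"]
  by (simp add: field_simps del: theta.simps(2))

text \<open>For consecutive reciprocals \<open>b\<close> and \<open>a\<close> the recursion reads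
  \<open>a\<^sup>2 - a = b\<^sup>2\<close>. Hence \<open>b\<^sup>2 \<le> (a - 1/2)\<^sup>2\<close>,
  and each reciprocal grows by at least 1/2.\<close>

lemma theta_recip_ge:
  assumes N: "N \<ge> (1::nat)"
  shows "real N + real k / 2 \<le> 1 / theta N k"
proof (induction k)
  case (Suc k)
  define a b where "a = 1 / theta N (Suc k)" and "b = 1 / theta N k"
  have pos: "a > 0" "b > 0" using theta_pos[OF N] by (simp_all add: a_def b_def del: theta.simps(2))
  have "a\<^sup>2 - a = b\<^sup>2"
    using theta_recip_Suc[OF N, of k] theta_pos[OF N, of "Suc k"]
    by (simp add: a_def b_def power2_eq_square diff_divide_distrib del: theta.simps(2))
  then have sq: "a * (a - 1) = b\<^sup>2" by (simp add: power2_eq_square algebra_simps)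
  then have "a * (a - 1) > 0" using pos by simp
  then have "a > 1" using pos by (simp add: zero_less_mult_iff)
  have "b\<^sup>2 \<le> (a - 1 / 2)\<^sup>2" using sq by (simp add: power2_eq_square algebra_simps)
  then have "b \<le> a - 1 / 2" by (rule power2_le_imp_le) (use \<open>a > 1\<close> in simp)
  then have "b + 1 / 2 \<le> a" by simp
  moreover have "real N + real (Suc k) / 2 = real N + real k / 2 + 1 / 2" by (simp add: field_simps)
  ultimately show ?case using Suc unfolding a_def[symmetric] b_def[symmetric] by linarith
qed simp

text \<open>Since \<open>1 / \<theta>\<^sub>k \<ge> N + k / 2\<close>, the sum from \<open>K\<^sub>0\<close> to \<open>K\<close> is at least
  \<open>(K - K\<^sub>0 + 1) N + (K (K + 1) - K\<^sub>0 (K\<^sub>0 - 1)) / 4\<close>.\<close>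

lemma theta_weights_lower_bound:
  assumes N: "N \<ge> (1::nat)" and ups: "ups > 1" and K0K: "K0 \<le> K"
    and K0: "real K0 \<le> real K / ups + 1"
  shows "((real K)\<^sup>2 / 4 + real N * real K) * (1 - 1 / ups) \<le> (\<Sum>k=K0..K. 1 / theta N k)"
proof -
  have closed: "(\<Sum>k=K0..K. real N + real k / 2)
      = (real K - real K0 + 1) * real N + (real K * (real K + 1) - real K0 * (real K0 - 1)) / 4"
    using K0K
  proof (induction K rule: dec_induct)
    case base
    then show ?case by (simp add: field_simps)
  next
    case (step K)
    then show ?case by (simp add: field_simps)
  qed
  define y where "y = real K / ups"
  have y: "0 \<le> y" "y \<le> real K" using ups mult_left_mono[of 1 ups "real K"]
    by (simp_all add: y_def divide_le_eq)
  have yK: "y * y \<le> y * real K" using y by (intro mult_left_mono) auto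
  \<comment> \<open>The \<open>+ 1\<close> in the hypothesis on \<open>K0\<close> is paid for twice:
    here it costs an extra \<open>y\<close>, covered by the extra \<open>K\<close> in
    \<open>K * (K + 1)\<close>, and in the linear part it matches the number
    \<open>K - K0 + 1\<close> of summands.\<close>
  have K0y: "real K0 * (real K0 - 1) \<le> y * y + y"
  proof (cases "K0 = 0")
    case True
    then show ?thesis using y by simp
  next
    case False
    have "real K0 * (real K0 - 1) \<le> (y + 1) * y"
      using K0 False y by (intro mult_mono) (auto simp: y_def)
    then show ?thesis by (simp add: algebra_simps)
  qed
  have "((real K)\<^sup>2 / 4 + real N * real K) * (1 - 1 / ups)
      = (real K * real K - y * real K) / 4 + real N * (real K - y)"
    using ups by (simp add: y_def field_simps power2_eq_square)
  also have "\<dots> \<le> (real K * (real K + 1) - real K0 * (real K0 - 1)) / 4 + (real K - real K0 + 1) * real N"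
  proof (rule add_mono)
    show "(real K * real K - y * real K) / 4 \<le> (real K * (real K + 1) - real K0 * (real K0 - 1)) / 4"
    proof (intro divide_right_mono)
      have "real K * (real K + 1) = real K * real K + real K" by (simp add: algebra_simps)
      then show "real K * real K - y * real K \<le> real K * (real K + 1) - real K0 * (real K0 - 1)"
        using yK K0y y by linarith
    qed simp
    have "real N * (real K - y) \<le> real N * (real K - real K0 + 1)"
      using K0 by (intro mult_left_mono) (auto simp: y_def)
    then show "real N * (real K - y) \<le> (real K - real K0 + 1) * real N" by (simp add: mult.commute)
  qed
  also have "\<dots> = (\<Sum>k=K0..K. real N + real k / 2)" unfolding closed by simp
  also have "\<dots> \<le> (\<Sum>k=K0..K. 1 / theta N k)" by (intro sum_mono theta_recip_ge[OF N])
  finally show ?thesis .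
qed

section \<open>Expectation over the sampled coordinates\<close>

lemma Exi_add: "Exi N K (\<lambda>xi. X xi + Y xi) = Exi N K X + Exi N K Y"
  by (simp add: Exi_def sum.distrib add_divide_distrib)

lemma Exi_diff: "Exi N K (\<lambda>xi. X xi - Y xi) = Exi N K X - Exi N K Y"
  by (simp add: Exi_def sum_subtractf diff_divide_distrib)

lemma Exi_cmult: "Exi N K (\<lambda>xi. c * X xi) = c * Exi N K X"
  by (simp add: Exi_def sum_distrib_left)

lemma Exi_sum: "Exi N K (\<lambda>xi. \<Sum>i\<in>I. X i xi) = (\<Sum>i\<in>I. Exi N K (X i))"
  unfolding Exi_def by (subst sum.swap) (simp add: sum_divide_distrib)

lemma Exi_const: "N \<ge> 1 \<Longrightarrow> Exi N K (\<lambda>xi. c) = c"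
  by (simp add: Exi_def card_PiE)

lemma Exi_mono:
  "(\<And>xi. xi \<in> PiE {0..K} (\<lambda>_. {..<N}) \<Longrightarrow> X xi \<le> Y xi) \<Longrightarrow> Exi N K X \<le> Exi N K Y"
  unfolding Exi_def by (intro divide_right_mono sum_mono) auto

lemma Exi_nonneg:
  "(\<And>xi. xi \<in> PiE {0..K} (\<lambda>_. {..<N}) \<Longrightarrow> 0 \<le> X xi) \<Longrightarrow> 0 \<le> Exi N K X"
  unfolding Exi_def by (intro divide_nonneg_nonneg sum_nonneg) auto

text \<open>Stands in for conditional expectation: averaging over the draw at step \<open>k\<close>
  alone leaves the mean unchanged. It is used together with the fact that the iterates up to index
  \<open>k\<close> ignore \<open>xi k\<close>.\<close>

lemma Exi_resample:
  assumes N: "N \<ge> (1::nat)" and k: "k \<le> K"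
  shows "Exi N K (\<lambda>xi. (\<Sum>j<N. X (xi(k := j))) / real N) = Exi N K X"
proof -
  define J where "J = {0..K} - {k}"
  have ins: "{0..K} = insert k J" and "k \<notin> J" using k by (auto simp: J_def)
  define T where "T = PiE J (\<lambda>_. {..<N})"
  have split: "(\<Sum>xi\<in>PiE {0..K} (\<lambda>_. {..<N}). Z xi) = (\<Sum>j<N. \<Sum>g\<in>T. Z (g(k := j)))"
    for Z :: "(nat \<Rightarrow> nat) \<Rightarrow> real"
  proof -
    have "(\<Sum>xi\<in>PiE {0..K} (\<lambda>_. {..<N}). Z xi) = (\<Sum>(j, g)\<in>{..<N} \<times> T. Z (g(k := j)))"
      unfolding ins PiE_insert_eq T_def[symmetric]
      by (subst sum.reindex) (use inj_combinator[OF \<open>k \<notin> J\<close>, of "\<lambda>_. {..<N}"] in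
          \<open>auto simp: T_def comp_def case_prod_unfold\<close>)
    then show ?thesis by (simp add: sum.cartesian_product)
  qed
  have "(\<Sum>xi\<in>PiE {0..K} (\<lambda>_. {..<N}). (\<Sum>j<N. X (xi(k := j))) / real N)
      = (\<Sum>i<N. (\<Sum>g\<in>T. \<Sum>j<N. X (g(k := j))) / real N)"
    unfolding split by (simp add: sum_divide_distrib)
  also have "\<dots> = (\<Sum>g\<in>T. \<Sum>j<N. X (g(k := j)))" using N by simp
  also have "\<dots> = (\<Sum>xi\<in>PiE {0..K} (\<lambda>_. {..<N}). X xi)" unfolding split by (rule sum.swap)
  finally show ?thesis by (simp add: Exi_def)
qed

lemma Exi_le_sqrt:
  assumes N: "N \<ge> 1"
  shows "Exi N K X \<le> sqrt (Exi N K (\<lambda>xi. (X xi)\<^sup>2))"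
proof -
  define m where "m = Exi N K X"
  have "0 \<le> Exi N K (\<lambda>xi. (X xi - m)\<^sup>2)" by (rule Exi_nonneg) simp
  also have "(\<lambda>xi. (X xi - m)\<^sup>2) = (\<lambda>xi. (X xi)\<^sup>2 - 2 * m * X xi + m\<^sup>2)"
    by (simp add: power2_diff algebra_simps)
  also have "Exi N K \<dots> = Exi N K (\<lambda>xi. (X xi)\<^sup>2) - m\<^sup>2"
    unfolding Exi_add Exi_diff Exi_cmult Exi_const[OF N] m_def[symmetric] by (simp add: power2_eq_square)
  finally show ?thesis unfolding m_def by (intro real_le_rsqrt) simp
qed

section \<open>The iterates\<close>

lemma ardca_cong:
  "(\<And>j. j < k \<Longrightarrow> xi j = xi' j) \<Longrightarrow> ardca P u0 xi k = ardca P u0 xi' k"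
  by (induction k) (simp_all add: Let_def)

text \<open>The linear functional \<open>G\<close> produced by the recursion of \<open>u\<^sup>k\<close> dominates
  \<open>N \<theta>\<^sub>k\<^sub>-\<^sub>1\<close> times the point evaluation at the last \<open>z\<close>, which makes the inductive step positive.\<close>

lemma averaged_nonneg:
  fixes G \<psi> :: "nat \<Rightarrow> real"
  assumes N: "N \<ge> 1" and G0: "G 0 = \<psi> 0"
    and rec: "\<And>k. G (Suc k) = (1 - theta N k) * G k + real N * theta N k * \<psi> (Suc k)
        - (real N - 1) * theta N k * \<psi> k"
    and pos: "\<And>k. 1 \<le> k \<Longrightarrow> k \<le> m \<Longrightarrow> \<psi> k \<ge> 0"
    and k: "Suc k \<le> m"
  shows "G (Suc k) \<ge> real N * theta N k * \<psi> (Suc k)"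
  using k
proof (induction k)
  case 0
  have "G (Suc 0) = \<psi> (Suc 0)" unfolding rec[of 0] G0 using N by (simp add: field_simps)
  then show ?case using N by simp
next
  case (Suc k)
  define s t where "s = theta N k" and "t = theta N (Suc k)"
  have t: "0 < t" "t \<le> s" "t \<le> 1 / real N" "t \<le> 1"
    using theta_pos[OF N, of "Suc k"] theta_antimono[OF N, of k] theta_le[OF N, of "Suc k"] N
    unfolding s_def t_def by (auto intro: order_trans[of _ "1 / real N"] simp del: theta.simps(2))
  \<comment> \<open>The first factors are compared through \<open>t \<le> 1 / N\<close>, the second
    through monotonicity of \<open>theta N\<close>.\<close>
  have "(1 - 1 / real N) * t \<le> (1 - t) * s" using t N by (intro mult_mono) auto
  then have "real N * ((1 - 1 / real N) * t) \<le> real N * ((1 - t) * s)" by (intro mult_left_mono) auto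
  moreover have "real N * ((1 - 1 / real N) * t) = (real N - 1) * t" using N by (simp add: field_simps)
  ultimately have coef: "(real N - 1) * t \<le> (1 - t) * (real N * s)" by (simp only: mult.left_commute)
  have "(real N - 1) * t * \<psi> (Suc k) \<le> (1 - t) * (real N * s * \<psi> (Suc k))"
    using mult_right_mono[OF coef pos[of "Suc k"]] Suc.prems by (simp add: mult.assoc)
  also have "\<dots> \<le> (1 - t) * G (Suc k)"
    using Suc t unfolding s_def by (intro mult_left_mono) auto
  finally show ?case unfolding rec[of "Suc k"] t_def[symmetric] by simp
qed

text \<open>The start \<open>u0\<close> is only known to lie in the cone, so its dual value may be
  infinite. Then the claimed bounds are infinite too, except for \<open>N = 1\<close>, where the
  factor \<open>1 - theta N 0\<close> vanishes; hence the alternative in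
  \<open>u0_dom\<close>.\<close>

locale ardca_run = ardca_problem P for P :: "'t::finite cdata" +
  fixes u0 ustar :: "nat \<Rightarrow> real" and K :: nat
  assumes u0D: "inD P u0"
    and u0_dom: "nhat P = 1 \<or> udom u0"
    and ustar_dom: "udom ustar"
    and ustar_min: "\<And>u. udom u \<Longrightarrow> Dr ustar \<le> Dr u"
begin

abbreviation "\<theta> \<equiv> theta N"
abbreviation "\<Omega> \<equiv> PiE {0..K} (\<lambda>_. {..<N})"
abbreviation "E \<equiv> Exi N K"
abbreviation "nsq \<equiv> normL_sq P"

definition z :: "(nat \<Rightarrow> nat) \<Rightarrow> nat \<Rightarrow> nat \<Rightarrow> real" where "z xi k = fst (ardca P u0 xi k)"
definition u :: "(nat \<Rightarrow> nat) \<Rightarrow> nat \<Rightarrow> nat \<Rightarrow> real" where "u xi k = snd (ardca P u0 xi k)"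
definition v :: "(nat \<Rightarrow> nat) \<Rightarrow> nat \<Rightarrow> nat \<Rightarrow> real" where "v xi k = vseq P u0 xi k"
text \<open>The proximal step in all coordinates at once. The run keeps only entry
  \<open>xi k\<close> of it, so \<open>zt xi k\<close> itself is determined by the draws before
  \<open>k\<close>.\<close>

definition zt :: "(nat \<Rightarrow> nat) \<Rightarrow> nat \<Rightarrow> nat \<Rightarrow> real" where
  "zt xi k i = coord_step P (\<theta> k) i (graddual P (v xi k) i) (z xi k i)"

lemma \<theta>_pos: "\<theta> k > 0" and \<theta>_le1: "\<theta> k \<le> 1"
  using theta_pos[OF N_pos] order_trans[OF theta_le[OF N_pos]] N_pos by auto

lemma z_0: "z xi 0 = u0" and u_0: "u xi 0 = u0"
  by (simp_all add: z_def u_def)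

lemma v_eq: "v xi k j = \<theta> k * z xi k j + (1 - \<theta> k) * u xi k j"
  by (simp add: v_def vseq_def z_def u_def Let_def)

lemma z_Suc: "z xi (Suc k) = (z xi k)(xi k := zt xi k (xi k))"
  by (simp add: z_def zt_def v_def vseq_def Let_def)

lemma u_Suc: "u xi (Suc k) = (\<lambda>j. v xi k j + real N * \<theta> k * (z xi (Suc k) j - z xi k j))"
  by (simp add: z_def u_def v_def vseq_def Let_def)

lemma u_Suc': "u xi (Suc k) j = (1 - \<theta> k) * u xi k j + real N * \<theta> k * z xi (Suc k) j
    - (real N - 1) * \<theta> k * z xi k j"
  unfolding u_Suc v_eq by (simp add: algebra_simps)

declare theta.simps(2) [simp del]

lemma past_cong:
  assumes "\<And>j. j < k \<Longrightarrow> xi j = xi' j"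
  shows "z xi k = z xi' k" "u xi k = u xi' k" "v xi k = v xi' k" "zt xi k = zt xi' k"
proof -
  have *: "ardca P u0 xi k = ardca P u0 xi' k" by (rule ardca_cong[OF assms])
  show "z xi k = z xi' k" "u xi k = u xi' k" "v xi k = v xi' k" "zt xi k = zt xi' k"
    by (simp_all add: fun_eq_iff zt_def z_def u_def v_def vseq_def Let_def *)
qed

lemma past_resample:
  assumes "l \<le> k"
  shows "z (xi(k := j)) l = z xi l" "u (xi(k := j)) l = u xi l"
    "v (xi(k := j)) l = v xi l" "zt (xi(k := j)) l = zt xi l"
  by (rule past_cong, use assms in auto)+

lemma z_resample_Suc: "z (xi(k := j)) (Suc k) = (z xi k)(j := zt xi k j)"
  unfolding z_Suc by (simp add: past_resample)

lemma resample_in: "xi \<in> \<Omega> \<Longrightarrow> k \<le> K \<Longrightarrow> j < N \<Longrightarrow> xi(k := j) \<in> \<Omega>"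
  by (auto simp: PiE_iff extensional_def)

lemma xi_less: "xi \<in> \<Omega> \<Longrightarrow> k \<le> K \<Longrightarrow> xi k < N"
  by (auto simp: PiE_iff)

lemma zt_hdom: "i < N \<Longrightarrow> zt xi k i \<in> hdom i"
  unfolding zt_def by (rule coord_step_prox(1)[OF _ \<theta>_pos])

lemma z_udom:
  assumes "xi \<in> \<Omega>"
  shows "k \<le> Suc K \<Longrightarrow> 1 \<le> k \<or> udom u0 \<Longrightarrow> udom (z xi k)"
proof (induction k)
  case 0
  then show ?case by (simp add: z_0)
next
  case (Suc k)
  show ?case
  proof (cases "udom u0")
    case True
    then have "udom (z xi k)" using Suc by simp
    then show ?thesis using zt_hdom unfolding z_Suc by (auto simp: udom_def)
  next
    case False
    then have "N = 1" using u0_dom by blast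
    then have "xi k = 0" using xi_less[OF assms, of k] Suc.prems by simp
    then show ?thesis using zt_hdom[of 0] \<open>N = 1\<close> unfolding z_Suc by (auto simp: udom_def)
  qed
qed

text \<open>A convex combination of the values \<open>h\<^sub>i (z\<^sup>t\<^sub>i)\<close> that replaces \<open>h\<^sub>i (u\<^sup>k\<^sub>i)\<close> in the potential,
  because its conditional expectation is computable.\<close>

primrec Hh :: "(nat \<Rightarrow> nat) \<Rightarrow> nat \<Rightarrow> nat \<Rightarrow> real" where
  "Hh xi 0 i = hr i (u0 i)"
| "Hh xi (Suc k) i = (1 - \<theta> k) * Hh xi k i + real N * \<theta> k * hr i (z xi (Suc k) i)
     - (real N - 1) * \<theta> k * hr i (z xi k i)"

definition Dh :: "(nat \<Rightarrow> nat) \<Rightarrow> nat \<Rightarrow> real" where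
  "Dh xi k = dr (u xi k) + (\<Sum>i<N. Hh xi k i)"

lemma Hh_cong:
  "(\<And>j. j < k \<Longrightarrow> xi j = xi' j) \<Longrightarrow> Hh xi k i = Hh xi' k i"
proof (induction k)
  case (Suc k)
  then have "z xi (Suc k) = z xi' (Suc k)" "z xi k = z xi' k" "Hh xi k i = Hh xi' k i"
    by (auto intro!: past_cong Suc.IH)
  then show ?case by simp
qed simp

text \<open>It suffices to test each affine minorant: the excess of \<open>Hh\<close> over the
  minorant at \<open>u\<close> obeys the recursion of \<open>u\<close>, driven by nonnegative
  excesses at the iterates of \<open>z\<close>. The value at \<open>u0\<close> cancels after one
  step because \<open>\<theta> 0 = 1 / N\<close>, so membership of \<open>u0\<close> in the domain
  does not enter.\<close>

lemma u_hdom: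
  assumes xi: "xi \<in> \<Omega>" and k: "Suc k \<le> Suc K" and i: "i < N"
  shows "u xi (Suc k) i \<in> hdom i \<and> hr i (u xi (Suc k) i) \<le> Hh xi (Suc k) i"
  unfolding hr_le_iff
proof clarify
  fix a b assume ab: "(a, b) \<in> minorants i"
  define \<psi> where "\<psi> = (\<lambda>k. hr i (z xi k i) - (a * z xi k i - b))"
  define G where "G = (\<lambda>k. Hh xi k i - (a * u xi k i - b))"
  have "G (Suc k) \<ge> real N * \<theta> k * \<psi> (Suc k)"
  proof (rule averaged_nonneg[OF N_pos])
    show "G 0 = \<psi> 0" by (simp add: G_def \<psi>_def z_0 u_0)
    show "G (Suc l) = (1 - \<theta> l) * G l + real N * \<theta> l * \<psi> (Suc l) - (real N - 1) * \<theta> l * \<psi> l" for l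
      unfolding G_def \<psi>_def Hh.simps u_Suc' by (simp add: algebra_simps)
    show "0 \<le> \<psi> l" if "1 \<le> l" "l \<le> Suc K" for l
      using z_udom[OF xi that(2)] that(1) hr_ge[OF _ ab] i by (simp add: \<psi>_def udom_def)
    show "Suc k \<le> Suc K" by (rule k)
  qed
  moreover have "\<psi> (Suc k) \<ge> 0"
    using z_udom[OF xi k] hr_ge[OF _ ab] i by (simp add: \<psi>_def udom_def)
  then have "real N * \<theta> k * \<psi> (Suc k) \<ge> 0" using \<theta>_pos[of k] by simp
  ultimately show "a * u xi (Suc k) i - b \<le> Hh xi (Suc k) i" by (simp add: G_def)
qed

lemma u_udom: "xi \<in> \<Omega> \<Longrightarrow> k \<le> K \<Longrightarrow> udom (u xi (Suc k))"
  using u_hdom by (auto simp: udom_def)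

lemma Dh_ge:
  assumes "xi \<in> \<Omega>" "k \<le> K"
  shows "Dr ustar \<le> Dh xi (Suc k)"
proof -
  have "Dr ustar \<le> Dr (u xi (Suc k))" by (rule ustar_min[OF u_udom[OF assms]])
  also have "\<dots> \<le> Dh xi (Suc k)"
    unfolding Dr_def Dh_def using u_hdom[OF assms(1)] assms(2)
    by (intro add_left_mono sum_mono) (auto simp del: Hh.simps)
  finally show ?thesis .
qed

lemma u_inD: "xi \<in> \<Omega> \<Longrightarrow> k \<le> K \<Longrightarrow> inD P (u xi k)"
  using u_udom[of xi "k - 1"] u0D by (cases k) (auto simp: u_0 udom_inD)

lemma z_inD: "xi \<in> \<Omega> \<Longrightarrow> k \<le> K \<Longrightarrow> inD P (z xi k)"
  using z_udom[of xi k] u0D by (cases k) (auto simp: z_0 udom_inD)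

lemma v_inD: "xi \<in> \<Omega> \<Longrightarrow> k \<le> K \<Longrightarrow> inD P (v xi k)"
  using u_inD[of xi k] z_inD[of xi k] \<theta>_pos[of k] \<theta>_le1[of k] unfolding inD_def v_eq by auto

section \<open>One step of the method, averaged over its draw\<close>

abbreviation "xk xi k \<equiv> xdual P (v xi k)"
abbreviation "gr xi k i \<equiv> graddual P (v xi k) i"
abbreviation "\<Delta> xi k i \<equiv> zt xi k i - z xi k i"

lemma dr_linearization:
  "dr (v xi k) + (\<Sum>i<N. gr xi k i * (w i - v xi k i)) = - Lag P (xk xi k) w"
  unfolding dr_def Lag_coef graddual_coef
  by (simp add: sum_subtractf sum_negf algebra_simps)

text \<open>Drawing \<open>j\<close> moves \<open>v\<close> in coordinate \<open>j\<close> only, by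
  \<open>N * \<theta> k\<close> times the full step there; averaging over \<open>j\<close> cancels
  one power of \<open>N\<close>.\<close>

lemma expected_descent:
  assumes xi: "xi \<in> \<Omega>" and k: "k \<le> K" 
  shows "(\<Sum>j<N. dr (u (xi(k := j)) (Suc k))) / real N
    \<le> dr (v xi k) + \<theta> k * (\<Sum>i<N. gr xi k i * \<Delta> xi k i)
      + real N * (\<theta> k)\<^sup>2 / 2 * nsq (\<lambda>i. \<Delta> xi k i)"
proof -
  have "dr (u (xi(k := j)) (Suc k)) \<le> dr (v xi k) + gr xi k j * (real N * \<theta> k * \<Delta> xi k j)
      + L j / 2 * (real N * \<theta> k * \<Delta> xi k j)\<^sup>2" if j: "j < N" for j
  proof -
    define s where "s = v xi k j + real N * \<theta> k * \<Delta> xi k j"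
    have eq: "u (xi(k := j)) (Suc k) = (v xi k)(j := s)"
      unfolding u_Suc z_resample_Suc by (auto simp: past_resample s_def)
    have "inD P ((v xi k)(j := s))"
      using udom_inD[OF u_udom[OF resample_in[OF xi k j] k]] unfolding eq .
    from dr_coordinate_descent[OF v_inD[OF xi k] this j] show ?thesis
      unfolding eq by (simp add: s_def)
  qed
  then have "(\<Sum>j<N. dr (u (xi(k := j)) (Suc k)))
      \<le> (\<Sum>j<N. dr (v xi k) + gr xi k j * (real N * \<theta> k * \<Delta> xi k j)
      + L j / 2 * (real N * \<theta> k * \<Delta> xi k j)\<^sup>2)"
    by (intro sum_mono) auto
  also have "\<dots> = real N * (dr (v xi k) + \<theta> k * (\<Sum>i<N. gr xi k i * \<Delta> xi k i)
      + real N * (\<theta> k)\<^sup>2 / 2 * nsq (\<lambda>i. \<Delta> xi k i))"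
  proof -
    have "gr xi k j * (real N * \<theta> k * \<Delta> xi k j) + L j / 2 * (real N * \<theta> k * \<Delta> xi k j)\<^sup>2
        = real N * \<theta> k * (gr xi k j * \<Delta> xi k j) + (real N * \<theta> k)\<^sup>2 / 2 * (L j * (\<Delta> xi k j)\<^sup>2)" for j
      by (simp add: power_mult_distrib)
    then have "(\<Sum>j<N. dr (v xi k) + gr xi k j * (real N * \<theta> k * \<Delta> xi k j)
        + L j / 2 * (real N * \<theta> k * \<Delta> xi k j)\<^sup>2)
        = real N * dr (v xi k) + real N * \<theta> k * (\<Sum>i<N. gr xi k i * \<Delta> xi k i)
          + (real N * \<theta> k)\<^sup>2 / 2 * nsq (\<lambda>i. \<Delta> xi k i)"
      unfolding normL_sq_def by (simp only: add.assoc sum.distrib sum_distrib_left sum_constant) simp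
    then show ?thesis by (simp add: power2_eq_square algebra_simps)
  qed
  finally show ?thesis using N_pos by (simp add: divide_le_eq mult.commute)
qed

lemma sum_fun_upd:
  fixes f :: "nat \<Rightarrow> real \<Rightarrow> real"
  assumes "j < n"
  shows "(\<Sum>i<n. f i ((y(j := s)) i)) = (\<Sum>i<n. f i (y i)) + (f j s - f j (y j))"
  using assms by (simp add: sum.remove[of "{..<n}" j])

text \<open>A coordinate is refreshed by one draw in \<open>N\<close>, so \<open>N\<close> times the
  new value averages to \<open>N - 1\<close> times the old value plus the value at the full step;
  the negative term of the recursion removes the old value.\<close>

lemma expected_Hh:
  "(\<Sum>j<N. \<Sum>i<N. Hh (xi(k := j)) (Suc k) i) / real N
    = (1 - \<theta> k) * (\<Sum>i<N. Hh xi k i) + \<theta> k * (\<Sum>i<N. hr i (zt xi k i))"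
proof -
  have "Hh (xi(k := j)) k i = Hh xi k i" for i j by (rule Hh_cong) auto
  then have one: "(\<Sum>i<N. Hh (xi(k := j)) (Suc k) i) = (1 - \<theta> k) * (\<Sum>i<N. Hh xi k i)
      + real N * \<theta> k * (\<Sum>i<N. hr i (((z xi k)(j := zt xi k j)) i))
      - (real N - 1) * \<theta> k * (\<Sum>i<N. hr i (z xi k i))" for j
    unfolding Hh.simps z_resample_Suc
    by (simp add: past_resample sum.distrib sum_subtractf sum_distrib_left)
  have upd: "(\<Sum>i<N. hr i (((z xi k)(j := zt xi k j)) i))
      = (\<Sum>i<N. hr i (z xi k i)) + (hr j (zt xi k j) - hr j (z xi k j))" if "j < N" for j
    using that by (rule sum_fun_upd)
  have "(\<Sum>j<N. \<Sum>i<N. Hh (xi(k := j)) (Suc k) i)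
      = (\<Sum>j<N. (1 - \<theta> k) * (\<Sum>i<N. Hh xi k i) + \<theta> k * (\<Sum>i<N. hr i (z xi k i))
          + real N * \<theta> k * (hr j (zt xi k j) - hr j (z xi k j)))"
  proof (intro sum.cong refl)
    fix j assume "j \<in> {..<N}"
    then have j: "j < N" by simp
    show "(\<Sum>i<N. Hh (xi(k := j)) (Suc k) i)
        = (1 - \<theta> k) * (\<Sum>i<N. Hh xi k i) + \<theta> k * (\<Sum>i<N. hr i (z xi k i))
          + real N * \<theta> k * (hr j (zt xi k j) - hr j (z xi k j))"
      unfolding one upd[OF j] by (simp add: algebra_simps)
  qed
  also have "\<dots> = real N * ((1 - \<theta> k) * (\<Sum>i<N. Hh xi k i) + \<theta> k * (\<Sum>i<N. hr i (zt xi k i)))"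
    by (simp add: sum.distrib sum_subtractf sum_distrib_left[symmetric] algebra_simps)
  finally show ?thesis using N_pos by simp
qed

text \<open>The subgradient inequality of each coordinate step, rewritten by the three-point
  identity for squares.\<close>

lemma prox_inequality:
  assumes y: "udom y"
  shows "(\<Sum>i<N. gr xi k i * \<Delta> xi k i) + (\<Sum>i<N. hr i (zt xi k i))
    \<le> (\<Sum>i<N. gr xi k i * (y i - z xi k i)) + (\<Sum>i<N. hr i (y i))
      + real N * \<theta> k * (nsq (\<lambda>i. y i - z xi k i) - nsq (\<lambda>i. y i - zt xi k i) - nsq (\<lambda>i. \<Delta> xi k i))"
proof -
  have "gr xi k i * \<Delta> xi k i + hr i (zt xi k i) \<le> gr xi k i * (y i - z xi k i) + hr i (y i)
      + real N * \<theta> k * (L i * (y i - z xi k i)\<^sup>2 - L i * (y i - zt xi k i)\<^sup>2 - L i * (\<Delta> xi k i)\<^sup>2)"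
    if i: "i < N" for i
  proof -
    have "hr i (zt xi k i) - (2 * (real N * \<theta> k * L i) * \<Delta> xi k i + gr xi k i) * (y i - zt xi k i)
        \<le> hr i (y i)"
      using y i unfolding zt_def by (intro coord_step_prox(2)[OF i \<theta>_pos]) (auto simp: udom_def)
    moreover have "2 * \<Delta> xi k i * (y i - zt xi k i)
        = (y i - z xi k i)\<^sup>2 - (y i - zt xi k i)\<^sup>2 - (\<Delta> xi k i)\<^sup>2"
      by (simp add: power2_eq_square algebra_simps)
    then have "real N * \<theta> k * L i * (2 * \<Delta> xi k i * (y i - zt xi k i))
        = real N * \<theta> k * L i * ((y i - z xi k i)\<^sup>2 - (y i - zt xi k i)\<^sup>2 - (\<Delta> xi k i)\<^sup>2)"
      by simp
    ultimately show ?thesis by (simp add: algebra_simps)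
  qed
  then have "(\<Sum>i<N. gr xi k i * \<Delta> xi k i + hr i (zt xi k i))
      \<le> (\<Sum>i<N. gr xi k i * (y i - z xi k i) + hr i (y i)
      + real N * \<theta> k * (L i * (y i - z xi k i)\<^sup>2 - L i * (y i - zt xi k i)\<^sup>2 - L i * (\<Delta> xi k i)\<^sup>2))"
    by (intro sum_mono) auto
  then show ?thesis
    by (simp add: normL_sq_def sum.distrib sum_subtractf sum_distrib_left[symmetric])
qed

lemma expected_step:
  assumes xi: "xi \<in> \<Omega>" and k: "k \<le> K" and y: "udom y"
  shows "(\<Sum>j<N. Dh (xi(k := j)) (Suc k)) / real N
    \<le> (1 - \<theta> k) * Dh xi k + \<theta> k * (- Lag P (xk xi k) y + (\<Sum>i<N. hr i (y i)))
      + real N * (\<theta> k)\<^sup>2 * (nsq (\<lambda>i. y i - z xi k i) - nsq (\<lambda>i. y i - zt xi k i))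
      - real N * (\<theta> k)\<^sup>2 / 2 * nsq (\<lambda>i. \<Delta> xi k i)"
proof -
  define t where "t = \<theta> k"
  define W where "W = nsq (\<lambda>i. \<Delta> xi k i)"
  define S where "S = (\<Sum>i<N. gr xi k i * (y i - z xi k i))"
  have t: "0 < t" "t \<le> 1" by (simp_all add: t_def \<theta>_pos \<theta>_le1)
  \<comment> \<open>As \<open>v\<close> averages \<open>z\<close> and \<open>u\<close> with weight
    \<open>t\<close> on \<open>z\<close>, the displacements to \<open>y\<close> and
    \<open>u\<close>, weighted by \<open>t\<close> and \<open>1 - t\<close>, add up to
    \<open>t * (y - z)\<close>.\<close>
  have "(\<Sum>i<N. gr xi k i * (t * (y i - v xi k i) + (1 - t) * (u xi k i - v xi k i))) = t * S"
  proof -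
    have "t * (y i - v xi k i) + (1 - t) * (u xi k i - v xi k i) = t * (y i - z xi k i)" for i
      unfolding v_eq t_def[symmetric] by (simp add: algebra_simps)
    then show ?thesis by (simp add: S_def sum_distrib_left mult.left_commute)
  qed
  then have "t * S = t * (\<Sum>i<N. gr xi k i * (y i - v xi k i))
      + (1 - t) * (\<Sum>i<N. gr xi k i * (u xi k i - v xi k i))"
    by (simp add: distrib_left sum.distrib sum_distrib_left mult.left_commute)
  then have "dr (v xi k) + t * S = t * (- Lag P (xk xi k) y) + (1 - t) * (- Lag P (xk xi k) (u xi k))"
    unfolding dr_linearization[symmetric] by (simp add: algebra_simps)
  moreover have "(1 - t) * (- Lag P (xk xi k) (u xi k)) \<le> (1 - t) * dr (u xi k)"
    using t by (intro mult_left_mono dr_ge[OF u_inD[OF xi k]]) auto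
  ultimately have lin: "dr (v xi k) + t * S \<le> t * (- Lag P (xk xi k) y) + (1 - t) * dr (u xi k)" by simp
  have "t * ((\<Sum>i<N. gr xi k i * \<Delta> xi k i) + (\<Sum>i<N. hr i (zt xi k i)))
      \<le> t * (S + (\<Sum>i<N. hr i (y i))
      + real N * t * (nsq (\<lambda>i. y i - z xi k i) - nsq (\<lambda>i. y i - zt xi k i) - W))"
    using t prox_inequality[OF y, of xi k] unfolding S_def W_def t_def by (intro mult_left_mono) auto
  moreover have "(\<Sum>j<N. Dh (xi(k := j)) (Suc k)) / real N
      = (\<Sum>j<N. dr (u (xi(k := j)) (Suc k))) / real N
        + (\<Sum>j<N. \<Sum>i<N. Hh (xi(k := j)) (Suc k) i) / real N"
    by (simp add: Dh_def sum.distrib add_divide_distrib del: Hh.simps)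
  \<comment> \<open>One half absorbs the loss of the descent estimate, the other becomes the
    negative term of the claim.\<close>
  moreover have "real N * t\<^sup>2 / 2 * W = real N * t\<^sup>2 * W - real N * t\<^sup>2 / 2 * W" by simp
  ultimately show ?thesis
    using expected_descent[OF xi k] expected_Hh[of xi k] lin
    unfolding Dh_def[of xi k] t_def[symmetric] W_def[symmetric]
    by (simp add: algebra_simps power2_eq_square del: Hh.simps)
qed

text \<open>\<open>Y\<close> may depend on the whole path, later draws included: the one-step
  estimate holds for every path, and resampling occurs only inside \<open>Dh\<close> while the
  reference point stays at \<open>Y xi\<close>.\<close>

lemma expected_step_scaled:
  assumes k: "k \<le> K" and Y: "\<And>xi. xi \<in> \<Omega> \<Longrightarrow> udom (Y xi)"
  shows "1 / (\<theta> k)\<^sup>2 * E (\<lambda>xi. Dh xi (Suc k))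
    \<le> (1 - \<theta> k) / (\<theta> k)\<^sup>2 * E (\<lambda>xi. Dh xi k)
      + E (\<lambda>xi. 1 / \<theta> k * (- Lag P (xk xi k) (Y xi) + (\<Sum>i<N. hr i (Y xi i))))
      + real N * E (\<lambda>xi. nsq (\<lambda>i. Y xi i - z xi k i) - nsq (\<lambda>i. Y xi i - zt xi k i))
      - real N / 2 * E (\<lambda>xi. nsq (\<lambda>i. \<Delta> xi k i))"
proof -
  have "1 / (\<theta> k)\<^sup>2 * E (\<lambda>xi. Dh xi (Suc k))
      = E (\<lambda>xi. 1 / (\<theta> k)\<^sup>2 * ((\<Sum>j<N. Dh (xi(k := j)) (Suc k)) / real N))"
    unfolding Exi_cmult Exi_resample[OF N_pos k, of "\<lambda>xi. Dh xi (Suc k)"] ..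
  also have "\<dots> \<le> E (\<lambda>xi. (1 - \<theta> k) / (\<theta> k)\<^sup>2 * Dh xi k
      + 1 / \<theta> k * (- Lag P (xk xi k) (Y xi) + (\<Sum>i<N. hr i (Y xi i)))
      + real N * (nsq (\<lambda>i. Y xi i - z xi k i) - nsq (\<lambda>i. Y xi i - zt xi k i))
      - real N / 2 * nsq (\<lambda>i. \<Delta> xi k i))"
  proof (rule Exi_mono)
    fix xi assume xi: "xi \<in> \<Omega>"
    have sq: "(\<theta> k)\<^sup>2 > 0" using \<theta>_pos[of k] by simp
    have "1 / (\<theta> k)\<^sup>2 * ((\<Sum>j<N. Dh (xi(k := j)) (Suc k)) / real N)
      \<le> 1 / (\<theta> k)\<^sup>2 * ((1 - \<theta> k) * Dh xi k + \<theta> k * (- Lag P (xk xi k) (Y xi) + (\<Sum>i<N. hr i (Y xi i)))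
      + real N * (\<theta> k)\<^sup>2 * (nsq (\<lambda>i. Y xi i - z xi k i) - nsq (\<lambda>i. Y xi i - zt xi k i))
      - real N * (\<theta> k)\<^sup>2 / 2 * nsq (\<lambda>i. \<Delta> xi k i))"
      using sq by (intro mult_left_mono expected_step[OF xi k Y[OF xi]]) auto
    also have "\<dots> = (1 - \<theta> k) / (\<theta> k)\<^sup>2 * Dh xi k
      + 1 / \<theta> k * (- Lag P (xk xi k) (Y xi) + (\<Sum>i<N. hr i (Y xi i)))
      + real N * (nsq (\<lambda>i. Y xi i - z xi k i) - nsq (\<lambda>i. Y xi i - zt xi k i))
      - real N / 2 * nsq (\<lambda>i. \<Delta> xi k i)"
    proof -
      have *: "1 / t\<^sup>2 * (a + t * b + real N * t\<^sup>2 * c - real N * t\<^sup>2 / 2 * d)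
          = a / t\<^sup>2 + 1 / t * b + real N * c - real N / 2 * d" if "t > 0" for t a b c d :: real
        using that by (simp add: field_simps power2_eq_square)
      show ?thesis by (subst *[OF \<theta>_pos]) simp
    qed
    finally show "1 / (\<theta> k)\<^sup>2 * ((\<Sum>j<N. Dh (xi(k := j)) (Suc k)) / real N)
      \<le> (1 - \<theta> k) / (\<theta> k)\<^sup>2 * Dh xi k
      + 1 / \<theta> k * (- Lag P (xk xi k) (Y xi) + (\<Sum>i<N. hr i (Y xi i)))
      + real N * (nsq (\<lambda>i. Y xi i - z xi k i) - nsq (\<lambda>i. Y xi i - zt xi k i))
      - real N / 2 * nsq (\<lambda>i. \<Delta> xi k i)" .
  qed
  also have "\<dots> = (1 - \<theta> k) / (\<theta> k)\<^sup>2 * E (\<lambda>xi. Dh xi k)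
      + E (\<lambda>xi. 1 / \<theta> k * (- Lag P (xk xi k) (Y xi) + (\<Sum>i<N. hr i (Y xi i))))
      + real N * E (\<lambda>xi. nsq (\<lambda>i. Y xi i - z xi k i) - nsq (\<lambda>i. Y xi i - zt xi k i))
      - real N / 2 * E (\<lambda>xi. nsq (\<lambda>i. \<Delta> xi k i))"
    unfolding Exi_add Exi_diff[of _ _ "\<lambda>xi. (_ :: real) + _ xi"] Exi_diff by (simp only: Exi_add Exi_diff Exi_cmult)
  finally show ?thesis .
qed

text \<open>One draw performs, in expectation, the fraction \<open>1 / N\<close> of the change made
  by the full step. It is essential that \<open>y\<close> is the same for all paths: a
  path-dependent \<open>y\<close> would move under resampling.\<close>

lemma expected_z_distance:
  assumes k: "k \<le> K"
  shows "E (\<lambda>xi. nsq (\<lambda>i. y i - z xi k i)) - E (\<lambda>xi. nsq (\<lambda>i. y i - zt xi k i))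
    = real N * (E (\<lambda>xi. nsq (\<lambda>i. y i - z xi k i)) - E (\<lambda>xi. nsq (\<lambda>i. y i - z xi (Suc k) i)))"
proof -
  have "(\<Sum>j<N. nsq (\<lambda>i. y i - z (xi(k := j)) (Suc k) i)) / real N
      = nsq (\<lambda>i. y i - z xi k i)
        - (1 / real N) * (nsq (\<lambda>i. y i - z xi k i) - nsq (\<lambda>i. y i - zt xi k i))" for xi
  proof -
    have "(\<Sum>j<N. nsq (\<lambda>i. y i - z (xi(k := j)) (Suc k) i))
        = (\<Sum>j<N. nsq (\<lambda>i. y i - z xi k i) + (L j * (y j - zt xi k j)\<^sup>2 - L j * (y j - z xi k j)\<^sup>2))"
      unfolding normL_sq_def z_resample_Suc
      by (intro sum.cong refl) (simp add: sum_fun_upd[where f = "\<lambda>i w. L i * (y i - w)\<^sup>2"] del: fun_upd_apply)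
    also have "\<dots> = real N * nsq (\<lambda>i. y i - z xi k i)
        - (nsq (\<lambda>i. y i - z xi k i) - nsq (\<lambda>i. y i - zt xi k i))"
      by (simp add: sum.distrib sum_subtractf normL_sq_def)
    finally show ?thesis using N_pos by (simp add: field_simps)
  qed
  then have "E (\<lambda>xi. nsq (\<lambda>i. y i - z xi (Suc k) i)) = E (\<lambda>xi. nsq (\<lambda>i. y i - z xi k i)
        - (1 / real N) * (nsq (\<lambda>i. y i - z xi k i) - nsq (\<lambda>i. y i - zt xi k i)))"
    using Exi_resample[OF N_pos k, of "\<lambda>xi. nsq (\<lambda>i. y i - z xi (Suc k) i)"] by simp
  then show ?thesis using N_pos unfolding Exi_diff Exi_cmult by (simp add: field_simps)
qed

section \<open>Lyapunov bounds\<close>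

definition C where "C = (1 - 1 / real N) * (Dr u0 - Dr ustar) + nsq (\<lambda>i. u0 i - ustar i)"

abbreviation "\<alpha> k \<equiv> (1 - \<theta> k) / (\<theta> k)\<^sup>2"
abbreviation "gap k \<equiv> E (\<lambda>xi. Dh xi k) - Dr ustar"
abbreviation "Z k \<equiv> E (\<lambda>xi. nsq (\<lambda>i. ustar i - z xi k i))"
abbreviation "W k \<equiv> E (\<lambda>xi. nsq (\<lambda>i. \<Delta> xi k i))"

lemma \<alpha>_Suc: "\<alpha> (Suc k) = 1 / (\<theta> k)\<^sup>2"
  by (rule theta_recip_Suc[OF N_pos])

lemma \<alpha>_Suc_diff: "\<alpha> (Suc k) = \<alpha> k + 1 / \<theta> k"
  unfolding \<alpha>_Suc using \<theta>_pos[of k] by (simp add: field_simps power2_eq_square)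

lemma \<alpha>_nonneg: "\<alpha> k \<ge> 0"
  using \<theta>_le1[of k] by simp

lemma nsq_nonneg: "nsq w \<ge> 0"
  unfolding normL_sq_def using L_nonneg by (intro sum_nonneg) auto

lemma \<alpha>_gap_nonneg:
  assumes "k \<le> Suc K"
  shows "\<alpha> k * gap k \<ge> 0"
proof (cases k)
  case 0
  show ?thesis
  proof (cases "N = 1")
    case True
    \<comment> \<open>Here \<open>u0\<close> may lie outside the domain and the gap is uncontrolled,
      but \<open>\<alpha> 0 = 0\<close>.\<close>
    then show ?thesis using 0 by simp
  next
    case False
    then have "Dr ustar \<le> Dr u0" using u0_dom ustar_min by blast
    moreover have "E (\<lambda>xi. Dh xi 0) = Dr u0"
      by (simp add: Dh_def u_0 Dr_def Exi_const[OF N_pos])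
    ultimately show ?thesis using \<alpha>_nonneg[of 0] 0 by (intro mult_nonneg_nonneg) auto
  qed
next
  case (Suc l)
  have "E (\<lambda>xi. Dr ustar) \<le> E (\<lambda>xi. Dh xi (Suc l))"
    using Suc assms by (intro Exi_mono Dh_ge) auto
  then show ?thesis using \<alpha>_nonneg[of k] Suc unfolding Exi_const[OF N_pos]
    by (intro mult_nonneg_nonneg) auto
qed

text \<open>At \<open>ustar\<close> the linearized dual value is at most \<open>Dr ustar\<close>,
  and its weight \<open>1 / \<theta> k\<close> is exactly the increment of \<open>\<alpha>\<close>,
  so all values can be measured from \<open>Dr ustar\<close>.\<close>

lemma lyapunov_step:
  assumes k: "k \<le> K"
  shows "\<alpha> (Suc k) * gap (Suc k) + (real N)\<^sup>2 * Z (Suc k) + real N / 2 * W k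
    \<le> \<alpha> k * gap k + (real N)\<^sup>2 * Z k"
proof -
  have "1 / \<theta> k * (- Lag P (xk xi k) ustar + (\<Sum>i<N. hr i (ustar i))) \<le> 1 / \<theta> k * Dr ustar" for xi
    using dr_ge[OF udom_inD[OF ustar_dom], of "xk xi k"] \<theta>_pos[of k]
    by (intro mult_left_mono) (auto simp: Dr_def)
  then have "E (\<lambda>xi. 1 / \<theta> k * (- Lag P (xk xi k) ustar + (\<Sum>i<N. hr i (ustar i))))
      \<le> E (\<lambda>xi. 1 / \<theta> k * Dr ustar)"
    by (intro Exi_mono)
  also have "\<dots> = (\<alpha> (Suc k) - \<alpha> k) * Dr ustar" unfolding \<alpha>_Suc_diff Exi_const[OF N_pos] by simp
  finally have "\<alpha> (Suc k) * E (\<lambda>xi. Dh xi (Suc k)) \<le> \<alpha> k * E (\<lambda>xi. Dh xi k)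
      + (\<alpha> (Suc k) - \<alpha> k) * Dr ustar
      + real N * (E (\<lambda>xi. nsq (\<lambda>i. ustar i - z xi k i)) - E (\<lambda>xi. nsq (\<lambda>i. ustar i - zt xi k i)))
      - real N / 2 * W k"
    using expected_step_scaled[OF k, of "\<lambda>_. ustar"] ustar_dom
    unfolding \<alpha>_Suc Exi_diff by linarith
  moreover have "a' * (x' - d) + n\<^sup>2 * y' + w \<le> a * (x - d) + n\<^sup>2 * y"
    if "a' * x' \<le> a * x + (a' - a) * d + n * (n * (y - y')) - w" for a a' x x' d n y y' w :: real
    using that by (simp add: algebra_simps power2_eq_square)
  ultimately show ?thesis
    unfolding expected_z_distance[OF k] by blast
qed

lemma lyapunov:
  "k \<le> Suc K \<Longrightarrow> \<alpha> k * gap k + (real N)\<^sup>2 * Z k + real N / 2 * (\<Sum>j<k. W j) \<le> (real N)\<^sup>2 * C"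
proof (induction k)
  case 0
  have E0: "E (\<lambda>xi. Dh xi 0) = Dr u0"
    by (simp add: Dh_def u_0 Dr_def Exi_const[OF N_pos])
  have Z0: "Z 0 = nsq (\<lambda>i. u0 i - ustar i)"
    unfolding z_0 Exi_const[OF N_pos] by (simp add: normL_sq_def power2_commute)
  \<comment> \<open>Source of the factor \<open>1 - 1 / N\<close> of the initial gap in
    \<open>C\<close>.\<close>
  have \<alpha>0: "\<alpha> 0 = (real N)\<^sup>2 * (1 - 1 / real N)" using N_pos by (simp add: field_simps power2_eq_square)
  show ?case unfolding E0 Z0 \<alpha>0 C_def by (simp add: algebra_simps diff_divide_distrib)
next
  case (Suc k)
  then show ?case using lyapunov_step[of k] by (simp add: distrib_left)
qed

lemma W_nonneg: "W k \<ge> 0" and Z_nonneg: "Z k \<ge> 0"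
  by (simp_all add: Exi_nonneg nsq_nonneg)

lemma lyapunov_consequences:
  assumes k: "k \<le> Suc K"
  shows Z_le: "Z k \<le> C" and \<alpha>_gap_le: "\<alpha> k * gap k \<le> (real N)\<^sup>2 * C"
    and sum_W_le: "(\<Sum>j<k. W j) \<le> 2 * real N * C"
proof -
  have N2: "(real N)\<^sup>2 > 0" using N_pos by simp
  have 1: "0 \<le> real N / 2 * (\<Sum>j<k. W j)" by (intro mult_nonneg_nonneg sum_nonneg W_nonneg) auto
  have 2: "0 \<le> (real N)\<^sup>2 * Z k" using Z_nonneg[of k] by simp
  note l = lyapunov[OF k] \<alpha>_gap_nonneg[OF k]
  have "(real N)\<^sup>2 * Z k \<le> (real N)\<^sup>2 * C" using l 1 by linarith
  then show "Z k \<le> C" using N2 by simp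
  show "\<alpha> k * gap k \<le> (real N)\<^sup>2 * C" using l 1 2 by linarith
  have "real N / 2 * (\<Sum>j<k. W j) \<le> (real N)\<^sup>2 * C" using l 2 by linarith
  also have "\<dots> = real N / 2 * (2 * real N * C)" by (simp add: power2_eq_square)
  finally show "(\<Sum>j<k. W j) \<le> 2 * real N * C" using N_pos by simp
qed

lemma C_nonneg: "C \<ge> 0"
  using Z_le[of 0] Z_nonneg[of 0] by simp

section \<open>Martingale part of the increments\<close>

text \<open>A sum of martingale differences: given the past, \<open>N (z\<^sup>k\<^sup>+\<^sup>1 - z\<^sup>k)\<close> has mean \<open>\<Delta>\<^sup>k\<close>.\<close>

definition Mart :: "nat \<Rightarrow> (nat \<Rightarrow> nat) \<Rightarrow> nat \<Rightarrow> nat \<Rightarrow> real" where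
  "Mart K0 xi m i = (\<Sum>k=K0..<m. real N * (z xi (Suc k) i - z xi k i) - \<Delta> xi k i)"

text \<open>Given the past, the increment of coordinate \<open>i\<close> is \<open>N - 1\<close>
  times the full step with probability \<open>1 / N\<close> and minus the full step otherwise. Its
  mean is zero, so cross terms vanish and variances add.\<close>

lemma Mart_variance:
  assumes i: "i < N"
  shows "m \<le> Suc K \<Longrightarrow> E (\<lambda>xi. (Mart K0 xi m i)\<^sup>2) = (real N - 1) * (\<Sum>k=K0..<m. E (\<lambda>xi. (\<Delta> xi k i)\<^sup>2))"
proof (induction m)
  case 0
  then show ?case using Exi_const[OF N_pos] by (simp add: Mart_def)
next
  case (Suc m)
  show ?case
  proof (cases "m < K0")
    case True
    then show ?thesis using Exi_const[OF N_pos] by (simp add: Mart_def)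
  next
    case False
    have avg: "(\<Sum>j<N. (Mart K0 (xi(m := j)) (Suc m) i)\<^sup>2) / real N
        = (Mart K0 xi m i)\<^sup>2 + (real N - 1) * (\<Delta> xi m i)\<^sup>2" for xi
    proof -
      define M d where "M = Mart K0 xi m i" and "d = \<Delta> xi m i"
      have "Mart K0 (xi(m := j)) (Suc m) i = (if j = i then M + (real N - 1) * d else M - d)" for j
      proof -
        have "Mart K0 (xi(m := j)) m i = M"
          unfolding Mart_def M_def by (intro sum.cong refl) (simp add: past_resample)
        moreover have "real N * (z (xi(m := j)) (Suc m) i - z (xi(m := j)) m i) - \<Delta> (xi(m := j)) m i
            = (if j = i then (real N - 1) * d else - d)"
          unfolding z_resample_Suc d_def by (simp add: past_resample algebra_simps)
        ultimately show ?thesis using False unfolding Mart_def by simp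
      qed
      then have "(\<Sum>j<N. (Mart K0 (xi(m := j)) (Suc m) i)\<^sup>2)
          = (M + (real N - 1) * d)\<^sup>2 + (\<Sum>j\<in>{..<N} - {i}. (M - d)\<^sup>2)"
        using i by (simp add: sum.remove[of "{..<N}" i])
      also have "\<dots> = (M + (real N - 1) * d)\<^sup>2 + (real N - 1) * (M - d)\<^sup>2"
        using i by (simp add: of_nat_diff)
      also have "\<dots> = real N * (M\<^sup>2 + (real N - 1) * d\<^sup>2)"
        by (simp add: power2_eq_square algebra_simps)
      finally show ?thesis using N_pos by (simp add: M_def d_def)
    qed
    have "E (\<lambda>xi. (Mart K0 xi (Suc m) i)\<^sup>2)
        = E (\<lambda>xi. (Mart K0 xi m i)\<^sup>2 + (real N - 1) * (\<Delta> xi m i)\<^sup>2)"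
      using Exi_resample[OF N_pos, of m K "\<lambda>xi. (Mart K0 xi (Suc m) i)\<^sup>2"] Suc.prems
      unfolding avg by simp
    then show ?thesis
      using Suc False unfolding Exi_add Exi_cmult by (simp add: algebra_simps)
  qed
qed

lemma Mart_bound: "E (\<lambda>xi. nsq (Mart K0 xi (Suc K))) \<le> 2 * (real N)\<^sup>2 * C"
proof -
  have "E (\<lambda>xi. nsq (Mart K0 xi (Suc K))) = (\<Sum>i<N. L i * E (\<lambda>xi. (Mart K0 xi (Suc K) i)\<^sup>2))"
    unfolding normL_sq_def Exi_sum Exi_cmult ..
  also have "\<dots> = (\<Sum>i<N. L i * ((real N - 1) * (\<Sum>k=K0..<Suc K. E (\<lambda>xi. (\<Delta> xi k i)\<^sup>2))))"
    by (intro sum.cong refl arg_cong2[where f = "(*)"] Mart_variance) auto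
  also have "\<dots> = (real N - 1) * (\<Sum>i<N. \<Sum>k=K0..<Suc K. L i * E (\<lambda>xi. (\<Delta> xi k i)\<^sup>2))"
    by (simp add: sum_distrib_left mult.left_commute del: sum.op_ivl_Suc)
  also have "\<dots> = (real N - 1) * (\<Sum>k=K0..<Suc K. W k)"
    unfolding normL_sq_def Exi_sum Exi_cmult by (subst sum.swap) (rule refl)
  also have "\<dots> \<le> (real N - 1) * (\<Sum>k<Suc K. W k)"
    using N_pos by (intro mult_left_mono sum_mono2 W_nonneg) auto
  also have "\<dots> \<le> real N * (2 * real N * C)"
    using sum_W_le[of "Suc K"] N_pos by (intro mult_mono sum_nonneg W_nonneg) auto
  finally show ?thesis by (simp add: power2_eq_square)
qed

definition T :: "nat \<Rightarrow> (nat \<Rightarrow> nat) \<Rightarrow> nat \<Rightarrow> real" where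
  "T K0 xi i = (\<Sum>k=K0..K. \<Delta> xi k i)"

lemma T_Mart:
  assumes "K0 \<le> K"
  shows "T K0 xi i = real N * (z xi (Suc K) i - z xi K0 i) - Mart K0 xi (Suc K) i"
proof -
  have "(\<Sum>k=K0..<Suc K. z xi (Suc k) i - z xi k i) = z xi (Suc K) i - z xi K0 i"
    using assms by (subst sum_Suc_diff') auto
  then have "Mart K0 xi (Suc K) i = real N * (z xi (Suc K) i - z xi K0 i) - (\<Sum>k=K0..<Suc K. \<Delta> xi k i)"
    unfolding Mart_def sum_subtractf[of _ "\<lambda>k. \<Delta> xi k i"] by (simp only: sum_distrib_left[symmetric])
  then show ?thesis unfolding T_def atLeastLessThanSuc_atLeastAtMost by simp
qed

definition nrm :: "(nat \<Rightarrow> real) \<Rightarrow> real" where "nrm w = sqrt (nsq w)"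

lemma nrm_L2_set: "nrm w = L2_set (\<lambda>i. sqrt (L i) * w i) {..<N}"
  unfolding nrm_def L2_set_def normL_sq_def
  by (intro arg_cong[where f = sqrt] sum.cong) (auto simp: power_mult_distrib L_nonneg)

lemma nrm_add: "nrm (\<lambda>i. a i + b i) \<le> nrm a + nrm b"
  unfolding nrm_L2_set by (rule order_trans[OF _ L2_set_triangle_ineq]) (simp add: distrib_left)

lemma nrm_cmult: "c \<ge> 0 \<Longrightarrow> nrm (\<lambda>i. c * w i) = c * nrm w"
  by (simp add: nrm_def normL_sq_def power_mult_distrib mult.left_commute[of _ "c\<^sup>2"]
      sum_distrib_left[symmetric] real_sqrt_mult)

lemma nrm_uminus: "nrm (\<lambda>i. - w i) = nrm w"
  by (simp add: nrm_def normL_sq_def)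

lemma E_nrm_le: "E (\<lambda>xi. nsq (w xi)) \<le> c \<Longrightarrow> E (\<lambda>xi. nrm (w xi)) \<le> sqrt c"
  using Exi_le_sqrt[OF N_pos, of K "\<lambda>xi. nrm (w xi)"]
  by (simp add: nrm_def nsq_nonneg order_trans[OF _ real_sqrt_le_mono])

text \<open>Both ends of the telescoped \<open>z\<close> lie within \<open>sqrt C\<close> of
  \<open>ustar\<close> in mean, and the martingale contributes \<open>sqrt 2 * N * sqrt C\<close>.
  The constant 7 rounds up \<open>2 * (2 + sqrt 2)\<close>.\<close>

lemma T_bound:
  assumes "K0 \<le> K"
  shows "2 * real N * E (\<lambda>xi. nrm (T K0 xi)) \<le> 7 * (real N)\<^sup>2 * sqrt C"
proof -
  have "nrm (T K0 xi) \<le> real N * nrm (\<lambda>i. ustar i - z xi (Suc K) i)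
      + real N * nrm (\<lambda>i. ustar i - z xi K0 i) + nrm (Mart K0 xi (Suc K))" for xi
  proof -
    define a b c where "a = (\<lambda>i. ustar i - z xi (Suc K) i)" and "b = (\<lambda>i. ustar i - z xi K0 i)"
      and "c = Mart K0 xi (Suc K)"
    have "T K0 xi = (\<lambda>i. (- (real N * a i) + real N * b i) + - c i)"
      unfolding T_Mart[OF assms] a_def b_def c_def by (simp add: fun_eq_iff algebra_simps)
    then have "nrm (T K0 xi) \<le> nrm (\<lambda>i. - (real N * a i)) + nrm (\<lambda>i. real N * b i) + nrm (\<lambda>i. - c i)"
      using nrm_add[of "\<lambda>i. - (real N * a i) + real N * b i" "\<lambda>i. - c i"]
        nrm_add[of "\<lambda>i. - (real N * a i)" "\<lambda>i. real N * b i"] by simp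
    then show ?thesis unfolding nrm_uminus nrm_cmult[OF of_nat_0_le_iff] a_def b_def c_def .
  qed
  then have "E (\<lambda>xi. nrm (T K0 xi)) \<le> real N * E (\<lambda>xi. nrm (\<lambda>i. ustar i - z xi (Suc K) i))
      + real N * E (\<lambda>xi. nrm (\<lambda>i. ustar i - z xi K0 i)) + E (\<lambda>xi. nrm (Mart K0 xi (Suc K)))"
    unfolding Exi_add[symmetric] Exi_cmult[symmetric] by (intro Exi_mono)
  also have "\<dots> \<le> real N * sqrt C + real N * sqrt C + sqrt (2 * (real N)\<^sup>2 * C)"
    using assms by (intro add_mono mult_left_mono E_nrm_le Z_le Mart_bound) auto
  also have "\<dots> = real N * sqrt C * (2 + sqrt 2)" by (simp add: real_sqrt_mult algebra_simps)
  also have "\<dots> \<le> real N * sqrt C * (7 / 2)"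
  proof (rule mult_left_mono)
    have "sqrt 2 \<le> 3 / 2" by (rule real_le_lsqrt) (simp_all add: power2_eq_square)
    then show "2 + sqrt 2 \<le> 7 / 2" by simp
  qed (use C_nonneg in simp)
  finally have "2 * real N * E (\<lambda>xi. nrm (T K0 xi)) \<le> 2 * real N * (real N * sqrt C * (7 / 2))"
    by (intro mult_left_mono) auto
  then show ?thesis by (simp add: power2_eq_square)
qed

section \<open>The averaged primal point\<close>

abbreviation "S K0 \<equiv> \<Sum>k=K0..K. 1 / \<theta> k"
abbreviation "xh K0 xi \<equiv> xhat P u0 K0 K xi"

lemma S_pos: "K0 \<le> K \<Longrightarrow> S K0 > 0"
  using \<theta>_pos by (intro sum_pos) auto

lemma S_\<alpha>: "K0 \<le> K \<Longrightarrow> S K0 = \<alpha> (Suc K) - \<alpha> K0"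
proof -
  assume K: "K0 \<le> K"
  have "S K0 = (\<Sum>k=K0..<Suc K. \<alpha> (Suc k) - \<alpha> k)"
    unfolding \<alpha>_Suc_diff atLeastLessThanSuc_atLeastAtMost by simp
  also have "\<dots> = \<alpha> (Suc K) - \<alpha> K0" using K by (subst sum_Suc_diff') auto
  finally show ?thesis .
qed

lemma convex_xhat:
  assumes \<phi>: "convex_on UNIV \<phi>" and K: "K0 \<le> K"
  shows "S K0 * \<phi> (xh K0 xi) \<le> (\<Sum>k=K0..K. 1 / \<theta> k * \<phi> (xk xi k))"
proof -
  have "xh K0 xi = (\<Sum>k=K0..K. (1 / \<theta> k / S K0) *\<^sub>R xk xi k)"
    unfolding xhat_def v_def by (simp add: scaleR_sum_right mult.commute)
  moreover have "(\<Sum>k=K0..K. 1 / \<theta> k / S K0) = 1"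
    unfolding sum_divide_distrib[symmetric] using S_pos[OF K] by simp
  ultimately have "\<phi> (xh K0 xi) \<le> (\<Sum>k=K0..K. (1 / \<theta> k / S K0) * \<phi> (xk xi k))"
    using K S_pos[OF K] \<theta>_pos
    by (simp only:) (intro convex_on_sum[OF _ _ \<phi>], auto intro!: divide_nonneg_nonneg less_imp_le)
  also have "\<dots> = (\<Sum>k=K0..K. 1 / \<theta> k * \<phi> (xk xi k)) / S K0"
    by (simp add: sum_divide_distrib)
  finally show ?thesis using S_pos[OF K] by (simp add: le_divide_eq mult.commute)
qed

section \<open>Constraint violation at the averaged point\<close>

definition viol :: "nat \<Rightarrow> real^'t \<Rightarrow> real" where
  "viol i x = (if i < nn P + pp P then coef i x else max 0 (coef i x))"

lemma infeas_L2_set: "infeas_dualnorm P x = L2_set (\<lambda>i. viol i x / sqrt (L i)) {nn P..<N}"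
proof -
  have "(\<Sum>i=nn P..<N. (viol i x)\<^sup>2 / L i)
      = (\<Sum>j<pp P. (viol (nn P + j) x)\<^sup>2 / L (nn P + j))
        + (\<Sum>i<mm P. (viol (nn P + pp P + i) x)\<^sup>2 / L (nn P + pp P + i))"
    using sum_blocks[of "\<lambda>i. (viol i x)\<^sup>2 / L i"] sum_split_n[of "\<lambda>i. (viol i x)\<^sup>2 / L i"] by simp
  moreover have "(\<Sum>i=nn P..<N. (viol i x / sqrt (L i))\<^sup>2) = (\<Sum>i=nn P..<N. (viol i x)\<^sup>2 / L i)"
    by (intro sum.cong) (auto simp: power_divide L_nonneg)
  ultimately show ?thesis
    unfolding infeas_dualnorm_def L2_set_def by (simp add: viol_def coef_def)
qed

text \<open>Jensen's inequality transfers the residual bounds of the single iterates to the average.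
  For equations these bounds are identities and \<open>- coef i\<close> is convex as well, so both
  signs are controlled; for inequalities only the positive part is.\<close>

lemma viol_xhat:
  assumes K: "K0 \<le> K" and i: "i < N" "\<not> i < nn P"
  shows "S K0 * \<bar>viol i (xh K0 xi)\<bar> \<le> 2 * real N * L i * \<bar>T K0 xi i\<bar>"
proof -
  have sumT: "(\<Sum>k=K0..K. 2 * real N * L i * \<Delta> xi k i) = 2 * real N * L i * T K0 xi i"
    unfolding T_def by (simp add: sum_distrib_left)
  have ge: "1 / \<theta> k * coef i (xk xi k) \<le> 2 * real N * L i * \<Delta> xi k i" for k
    using coord_step_gradient(1)[OF i(1) \<theta>_pos i(2), of k "gr xi k i" "z xi k i"] \<theta>_pos[of k]
    unfolding zt_def[symmetric] by (simp add: graddual_coef field_simps)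
  have "S K0 * coef i (xh K0 xi) \<le> (\<Sum>k=K0..K. 1 / \<theta> k * coef i (xk xi k))"
    by (rule convex_xhat[OF coef_convex[OF i(1)] K])
  also have "\<dots> \<le> 2 * real N * L i * T K0 xi i" unfolding sumT[symmetric] by (intro sum_mono ge)
  finally have up: "S K0 * coef i (xh K0 xi) \<le> 2 * real N * L i * T K0 xi i" .
  have Tabs: "2 * real N * L i * \<bar>T K0 xi i\<bar> = \<bar>2 * real N * L i * T K0 xi i\<bar>"
    using L_pos[OF i(1)] by (simp add: abs_mult)
  have Sabs: "S K0 * \<bar>w\<bar> = \<bar>S K0 * w\<bar>" for w using S_pos[OF K] by (simp add: abs_mult)
  show ?thesis
  proof (cases "i < nn P + pp P")
    case True
    have eq: "1 / \<theta> k * (- coef i (xk xi k)) = - (2 * real N * L i * \<Delta> xi k i)" for k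
      using coord_step_gradient(2)[OF i(1) \<theta>_pos i(2) True, of k "gr xi k i" "z xi k i"] \<theta>_pos[of k]
      unfolding zt_def[symmetric] by (simp add: graddual_coef field_simps)
    have "convex_on UNIV (\<lambda>x. - 1 * coef i x)" using True i by (intro scaled_coef_convex) auto
    then have "S K0 * (- coef i (xh K0 xi)) \<le> (\<Sum>k=K0..K. 1 / \<theta> k * (- coef i (xk xi k)))"
      using convex_xhat[OF _ K, of "\<lambda>x. - coef i x"] by simp
    also have "\<dots> = - (2 * real N * L i * T K0 xi i)" unfolding eq sum_negf sumT ..
    finally show ?thesis using up True unfolding viol_def Tabs Sabs by simp
  next
    case False
    have "S K0 * \<bar>max 0 (coef i (xh K0 xi))\<bar> = max 0 (S K0 * coef i (xh K0 xi))"
      using S_pos[OF K] by (simp add: max_def zero_le_mult_iff)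
    then show ?thesis using up False unfolding viol_def Tabs by simp
  qed
qed

text \<open>Division by \<open>sqrt (L i)\<close> turns the factor \<open>L i\<close> of the
  residual bound into \<open>sqrt (L i)\<close>: the dual norm of the residual becomes the primal
  norm of the summed steps.\<close>

lemma infeas_xhat:
  assumes K: "K0 \<le> K"
  shows "S K0 * infeas_dualnorm P (xh K0 xi) \<le> 2 * real N * nrm (T K0 xi)"
proof -
  have "S K0 * infeas_dualnorm P (xh K0 xi) = L2_set (\<lambda>i. S K0 * (\<bar>viol i (xh K0 xi)\<bar> / sqrt (L i))) {nn P..<N}"
    unfolding infeas_L2_set using S_pos[OF K]
    by (subst L2_set_right_distrib) (auto simp: L2_set_def power_mult_distrib power_divide)
  also have "\<dots> \<le> L2_set (\<lambda>i. 2 * real N * (sqrt (L i) * \<bar>T K0 xi i\<bar>)) {nn P..<N}"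
  proof (rule L2_set_mono)
    fix i assume "i \<in> {nn P..<N}"
    then have i: "i < N" "\<not> i < nn P" by auto
    have sL: "sqrt (L i) > 0" "L i = sqrt (L i) * sqrt (L i)" using L_pos[OF i(1)] by auto
    have "S K0 * \<bar>viol i (xh K0 xi)\<bar> \<le> (2 * real N * (sqrt (L i) * \<bar>T K0 xi i\<bar>)) * sqrt (L i)"
    proof -
      have eq: "2 * real N * L i * \<bar>T K0 xi i\<bar> = (2 * real N * (sqrt (L i) * \<bar>T K0 xi i\<bar>)) * sqrt (L i)"
        using L_pos[OF i(1)] by simp
      show ?thesis using viol_xhat[OF K i, of xi] unfolding eq .
    qed
    then show "S K0 * (\<bar>viol i (xh K0 xi)\<bar> / sqrt (L i)) \<le> 2 * real N * (sqrt (L i) * \<bar>T K0 xi i\<bar>)"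
      using sL(1) by (simp add: pos_divide_le_eq)
    show "0 \<le> S K0 * (\<bar>viol i (xh K0 xi)\<bar> / sqrt (L i))" using S_pos[OF K] sL(1) by simp
  qed
  also have "\<dots> = 2 * real N * L2_set (\<lambda>i. sqrt (L i) * \<bar>T K0 xi i\<bar>) {nn P..<N}"
    by (subst L2_set_right_distrib) auto
  also have "\<dots> \<le> 2 * real N * nrm (T K0 xi)"
  proof (rule mult_left_mono)
    show "L2_set (\<lambda>i. sqrt (L i) * \<bar>T K0 xi i\<bar>) {nn P..<N} \<le> nrm (T K0 xi)"
      unfolding nrm_L2_set L2_set_def power_mult_distrib power2_abs
      by (intro real_sqrt_le_mono sum_mono2) auto
  qed simp
  finally show ?thesis .
qed

lemma infeas_bound:
  assumes K: "K0 \<le> K"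
  shows "S K0 * E (\<lambda>xi. infeas_dualnorm P (xh K0 xi)) \<le> 7 * (real N)\<^sup>2 * sqrt C"
proof -
  have "S K0 * E (\<lambda>xi. infeas_dualnorm P (xh K0 xi)) \<le> 2 * real N * E (\<lambda>xi. nrm (T K0 xi))"
    unfolding Exi_cmult[symmetric] by (intro Exi_mono infeas_xhat[OF K])
  then show ?thesis using T_bound[OF K] by linarith
qed

text \<open>Cauchy-Schwarz between the weighted norm and its dual, applied to the multiplier term;
  nonnegativity of \<open>ustar\<close> on the third block allows passing to positive parts.\<close>

lemma objective_ge: "- Dr ustar - nrm ustar * infeas_dualnorm P x \<le> Fobj P x"
proof -
  have "(\<Sum>i=nn P..<N. ustar i * coef i x)
      \<le> (\<Sum>i=nn P..<N. \<bar>sqrt (L i) * ustar i\<bar> * \<bar>viol i x / sqrt (L i)\<bar>)"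
  proof (rule sum_mono)
    fix i assume "i \<in> {nn P..<N}"
    then have i: "i < N" "\<not> i < nn P" by auto
    have "ustar i * coef i x \<le> ustar i * viol i x"
    proof (cases "i < nn P + pp P")
      case True
      then show ?thesis by (simp add: viol_def)
    next
      case False
      then have "ustar i \<ge> 0" using ustar_dom i hdom_block3 by (auto simp: udom_def)
      then show ?thesis using False by (simp add: viol_def mult_left_mono)
    qed
    also have "\<dots> \<le> \<bar>ustar i * viol i x\<bar>" by simp
    also have "\<dots> = \<bar>sqrt (L i) * ustar i\<bar> * \<bar>viol i x / sqrt (L i)\<bar>"
      using L_pos[OF i(1)] by (simp add: abs_mult)
    finally show "ustar i * coef i x \<le> \<bar>sqrt (L i) * ustar i\<bar> * \<bar>viol i x / sqrt (L i)\<bar>" .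
  qed
  also have "\<dots> \<le> L2_set (\<lambda>i. sqrt (L i) * ustar i) {nn P..<N} * infeas_dualnorm P x"
    unfolding infeas_L2_set by (rule L2_set_mult_ineq)
  also have "\<dots> \<le> nrm ustar * infeas_dualnorm P x"
  proof (rule mult_right_mono)
    show "L2_set (\<lambda>i. sqrt (L i) * ustar i) {nn P..<N} \<le> nrm ustar"
      unfolding nrm_L2_set L2_set_def by (intro real_sqrt_le_mono sum_mono2) auto
    show "0 \<le> infeas_dualnorm P x" unfolding infeas_L2_set by (rule L2_set_nonneg)
  qed
  finally show ?thesis using primal_ge_dual[OF ustar_dom, of x] by linarith
qed

abbreviation "Q \<equiv> (Mlip P)\<^sup>2 * (\<Sum>i<nn P. L i)"

lemma objective_lower_bound:
  assumes K: "K0 \<le> K"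
  shows "- (9 * (real N)\<^sup>2 * (C + nsq ustar + Q))
    \<le> S K0 * (E (\<lambda>xi. Fobj P (xh K0 xi)) + Dr ustar)"
proof -
  have "E (\<lambda>xi. - Dr ustar - nrm ustar * infeas_dualnorm P (xh K0 xi)) \<le> E (\<lambda>xi. Fobj P (xh K0 xi))"
    by (intro Exi_mono objective_ge)
  then have "- (nrm ustar * E (\<lambda>xi. infeas_dualnorm P (xh K0 xi)))
      \<le> E (\<lambda>xi. Fobj P (xh K0 xi)) + Dr ustar"
    unfolding Exi_diff Exi_cmult Exi_const[OF N_pos] by simp
  then have "S K0 * - (nrm ustar * E (\<lambda>xi. infeas_dualnorm P (xh K0 xi)))
      \<le> S K0 * (E (\<lambda>xi. Fobj P (xh K0 xi)) + Dr ustar)"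
    using S_pos[OF K] by (intro mult_left_mono) auto
  moreover have "nrm ustar * (S K0 * E (\<lambda>xi. infeas_dualnorm P (xh K0 xi)))
      \<le> nrm ustar * (7 * (real N)\<^sup>2 * sqrt C)"
    by (intro mult_left_mono infeas_bound[OF K]) (simp add: nrm_def nsq_nonneg)
  moreover have "nrm ustar * (7 * (real N)\<^sup>2 * sqrt C) \<le> 9 * (real N)\<^sup>2 * (C + nsq ustar + Q)"
  proof -
    \<comment> \<open>Splits the product into \<open>nsq ustar\<close> and \<open>C\<close>, each
      with coefficient 7/2.\<close>
    have "0 \<le> (nrm ustar - sqrt C)\<^sup>2" by simp
    then have "2 * (nrm ustar * sqrt C) \<le> nsq ustar + C"
      using C_nonneg by (simp add: power2_diff nrm_def nsq_nonneg)
    moreover have "0 \<le> Q" using L_nonneg n_le_N by (intro mult_nonneg_nonneg sum_nonneg) auto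
    moreover have "7 * a \<le> 9 * (c + b + q)" if "2 * a \<le> b + c" "0 \<le> q" "0 \<le> c" "0 \<le> b" for a b c q :: real
    proof -
      have "7 * a \<le> 4 * (b + c)" using that by simp
      also have "\<dots> \<le> 9 * (c + b + q)" using that by simp
      finally show ?thesis .
    qed
    ultimately have "7 * (nrm ustar * sqrt C) \<le> 9 * (C + nsq ustar + Q)"
      using C_nonneg nsq_nonneg[of ustar] by blast
    then have "(real N)\<^sup>2 * (7 * (nrm ustar * sqrt C)) \<le> (real N)\<^sup>2 * (9 * (C + nsq ustar + Q))"
      by (intro mult_left_mono) auto
    then show ?thesis by (simp only: mult_ac)
  qed
  ultimately show ?thesis by (simp add: mult_ac)
qed

section \<open>Upper bound for the objective\<close>

text \<open>The reference point depends on the sample path, so that its first block attains the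
  biconjugate of each \<open>\<phi>\<^sub>i\<close> at the averaged primal point.\<close>

definition uh :: "nat \<Rightarrow> (nat \<Rightarrow> nat) \<Rightarrow> nat \<Rightarrow> real" where
  "uh K0 xi i = (if i < nn P then (SOME s. s \<in> hdom i
      \<and> hr i s = (s * (Acol P i \<bullet> xh K0 xi) - phis P i (Acol P i \<bullet> xh K0 xi)) / real (nn P)
      \<and> \<bar>s\<bar> \<le> Mlip P) else 0)"

lemma uh_block1:
  assumes "i < nn P"
  shows "uh K0 xi i \<in> hdom i"
    and "hr i (uh K0 xi i)
      = (uh K0 xi i * (Acol P i \<bullet> xh K0 xi) - phis P i (Acol P i \<bullet> xh K0 xi)) / real (nn P)"
    and "\<bar>uh K0 xi i\<bar> \<le> Mlip P"
  using someI_ex[OF conjugate_subgradient[OF assms, of "Acol P i \<bullet> xh K0 xi"]] assms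
  by (simp_all add: uh_def)

lemma uh_udom: "udom (uh K0 xi)"
  unfolding udom_def
proof (intro allI impI)
  fix i
  show "uh K0 xi i \<in> hdom i"
  proof (cases "i < nn P")
    case True
    then show ?thesis by (rule uh_block1(1))
  next
    case False
    then show ?thesis using hdom_block2[OF False] hdom_block3[of i 0]
      by (cases "i < nn P + pp P") (auto simp: uh_def)
  qed
qed

lemma nsq_uh: "nsq (uh K0 xi) \<le> Q"
proof -
  have "nsq (uh K0 xi) = (\<Sum>i<nn P. L i * (uh K0 xi i)\<^sup>2)"
    unfolding normL_sq_def sum_split_n by (simp add: uh_def)
  also have "\<dots> \<le> (\<Sum>i<nn P. L i * (Mlip P)\<^sup>2)"
  proof (intro sum_mono mult_left_mono)
    fix i assume "i \<in> {..<nn P}"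
    then have i: "i < nn P" by simp
    show "(uh K0 xi i)\<^sup>2 \<le> (Mlip P)\<^sup>2" using uh_block1(3)[OF i, of K0 xi] by (rule abs_le_square_iff[THEN iffD1, OF order_trans]) simp
    show "0 \<le> L i" using i n_le_N L_nonneg by simp
  qed
  finally show ?thesis unfolding sum_distrib_right[symmetric] by (simp only: mult.commute)
qed

text \<open>Zeros in the last two blocks remove the constraint terms, so the objective itself is
  recovered even at an infeasible averaged point.\<close>

lemma Lag_uh: "Lag P (xh K0 xi) (uh K0 xi) - (\<Sum>i<N. hr i (uh K0 xi i)) = Fobj P (xh K0 xi)"
proof -
  have "(\<Sum>i=nn P..<N. hr i (uh K0 xi i)) = 0"
    using uh_udom by (intro sum.neutral) (auto simp: udom_def hr_blocks23)
  moreover have "(\<Sum>i<nn P. uh K0 xi i * coef i (xh K0 xi)) - (\<Sum>i<nn P. hr i (uh K0 xi i))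
      = (\<Sum>i<nn P. phis P i (Acol P i \<bullet> xh K0 xi) / real (nn P))"
    unfolding sum_subtractf[symmetric]
    by (intro sum.cong refl) (simp add: uh_block1(2) coef_def diff_divide_distrib)
  moreover have "(\<Sum>i=nn P..<N. uh K0 xi i * coef i (xh K0 xi)) = 0" by (simp add: uh_def)
  ultimately show ?thesis
    unfolding Lag_coef Fobj_def sum_split_n by (simp add: sum_divide_distrib)
qed

lemma sum_Lag_uh:
  assumes K: "K0 \<le> K"
  shows "(\<Sum>k=K0..K. 1 / \<theta> k * (- Lag P (xk xi k) (uh K0 xi) + (\<Sum>i<N. hr i (uh K0 xi i))))
    \<le> - (S K0 * Fobj P (xh K0 xi))"
proof -
  define c where "c = (\<Sum>i<N. hr i (uh K0 xi i))"
  have "S K0 * Lag P (xh K0 xi) (uh K0 xi) \<le> (\<Sum>k=K0..K. 1 / \<theta> k * Lag P (xk xi k) (uh K0 xi))"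
    using mu_pos
    by (intro convex_xhat[OF strongly_convex_imp_convex[OF Lag_strongly_convex[OF udom_inD[OF uh_udom]]] K])
      simp
  moreover have "(\<Sum>k=K0..K. 1 / \<theta> k * (- Lag P (xk xi k) (uh K0 xi) + c))
      = - (\<Sum>k=K0..K. 1 / \<theta> k * Lag P (xk xi k) (uh K0 xi)) + S K0 * c"
    unfolding distrib_left sum.distrib sum_distrib_right by (simp add: sum_negf)
  moreover have "S K0 * Fobj P (xh K0 xi) = S K0 * Lag P (xh K0 xi) (uh K0 xi) - S K0 * c"
    unfolding Lag_uh[symmetric] c_def by (rule right_diff_distrib)
  ultimately show ?thesis unfolding c_def[symmetric] by linarith
qed

text \<open>The sum starts at \<open>K0\<close>, which leaves the dual value there with weight
  \<open>\<alpha> K0\<close>; the Lyapunov bound, valid at every index, controls it later.\<close>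

lemma telescoped_steps:
  assumes K: "K0 \<le> K"
  shows "\<alpha> (Suc K) * E (\<lambda>xi. Dh xi (Suc K)) \<le> \<alpha> K0 * E (\<lambda>xi. Dh xi K0)
      - S K0 * E (\<lambda>xi. Fobj P (xh K0 xi))
      + real N * (\<Sum>k=K0..K. E (\<lambda>xi. nsq (\<lambda>i. uh K0 xi i - z xi k i) - nsq (\<lambda>i. uh K0 xi i - zt xi k i)))"
proof -
  define p where "p = (\<lambda>k. E (\<lambda>xi. 1 / \<theta> k * (- Lag P (xk xi k) (uh K0 xi) + (\<Sum>i<N. hr i (uh K0 xi i)))))"
  define q where "q = (\<lambda>k. real N * E (\<lambda>xi. nsq (\<lambda>i. uh K0 xi i - z xi k i) - nsq (\<lambda>i. uh K0 xi i - zt xi k i)))"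
  have step: "\<alpha> (Suc k) * E (\<lambda>xi. Dh xi (Suc k)) - \<alpha> k * E (\<lambda>xi. Dh xi k) \<le> p k + q k" if "k \<le> K" for k
  proof -
    have "0 \<le> real N / 2 * W k" by (intro mult_nonneg_nonneg W_nonneg) simp
    then show ?thesis using expected_step_scaled[where Y = "uh K0", OF that uh_udom] unfolding \<alpha>_Suc p_def q_def by linarith
  qed
  have "\<alpha> (Suc K) * E (\<lambda>xi. Dh xi (Suc K)) - \<alpha> K0 * E (\<lambda>xi. Dh xi K0)
      = (\<Sum>k=K0..<Suc K. \<alpha> (Suc k) * E (\<lambda>xi. Dh xi (Suc k)) - \<alpha> k * E (\<lambda>xi. Dh xi k))"
    using K by (subst sum_Suc_diff') auto
  also have "\<dots> \<le> (\<Sum>k=K0..<Suc K. p k + q k)" by (intro sum_mono step) auto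
  also have "\<dots> = (\<Sum>k=K0..K. p k) + (\<Sum>k=K0..K. q k)"
    unfolding atLeastLessThanSuc_atLeastAtMost by (rule sum.distrib)
  finally have 1: "\<alpha> (Suc K) * E (\<lambda>xi. Dh xi (Suc K)) - \<alpha> K0 * E (\<lambda>xi. Dh xi K0)
      \<le> (\<Sum>k=K0..K. p k) + (\<Sum>k=K0..K. q k)" .
  have 2: "(\<Sum>k=K0..K. p k) \<le> - (S K0 * E (\<lambda>xi. Fobj P (xh K0 xi)))"
  proof -
    have "(\<Sum>k=K0..K. p k) \<le> E (\<lambda>xi. - S K0 * Fobj P (xh K0 xi))"
      unfolding p_def Exi_sum[symmetric] using sum_Lag_uh[OF K] by (intro Exi_mono) simp
    then show ?thesis unfolding Exi_cmult by simp
  qed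
  have 3: "(\<Sum>k=K0..K. q k) = real N * (\<Sum>k=K0..K. E (\<lambda>xi. nsq (\<lambda>i. uh K0 xi i - z xi k i) - nsq (\<lambda>i. uh K0 xi i - zt xi k i)))"
    unfolding q_def by (rule sum_distrib_left[symmetric])
  show ?thesis using 1 2 unfolding 3 by linarith
qed

text \<open>The square of the path-dependent \<open>uh\<close> cancels in each difference. The
  squares of \<open>z\<close> and \<open>zt\<close> obey the distance identity with reference point
  0, and the cross terms add up to a product with \<open>T\<close>.\<close>

lemma distance_terms:
  assumes K: "K0 \<le> K"
  shows "(\<Sum>k=K0..K. E (\<lambda>xi. nsq (\<lambda>i. uh K0 xi i - z xi k i) - nsq (\<lambda>i. uh K0 xi i - zt xi k i)))
    = E (\<lambda>xi. \<Sum>i<N. L i * (real N * ((z xi K0 i)\<^sup>2 - (z xi (Suc K) i)\<^sup>2) + 2 * uh K0 xi i * T K0 xi i))"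
proof -
  define A where "A = (\<lambda>k. E (\<lambda>xi. nsq (z xi k)))"
  have sq0: "nsq (\<lambda>i. 0 - w i) = nsq w" for w by (simp add: normL_sq_def)
  have first: "(\<Sum>k=K0..K. E (\<lambda>xi. nsq (z xi k) - nsq (zt xi k))) = real N * (A K0 - A (Suc K))"
  proof -
    have "E (\<lambda>xi. nsq (z xi k) - nsq (zt xi k)) = real N * (A k - A (Suc k))" if "k \<le> K" for k
      using expected_z_distance[OF that, of "\<lambda>_. 0"] unfolding sq0 Exi_diff A_def .
    then have "(\<Sum>k=K0..K. E (\<lambda>xi. nsq (z xi k) - nsq (zt xi k))) = (\<Sum>k=K0..<Suc K. real N * (A k - A (Suc k)))"
      unfolding atLeastLessThanSuc_atLeastAtMost by (intro sum.cong) auto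
    also have "\<dots> = - real N * (\<Sum>k=K0..<Suc K. A (Suc k) - A k)"
      unfolding sum_distrib_left by (intro sum.cong refl) (simp add: algebra_simps)
    also have "\<dots> = real N * (A K0 - A (Suc K))"
      using K by (subst sum_Suc_diff') (auto simp: algebra_simps)
    finally show ?thesis .
  qed
  have expand: "nsq (\<lambda>i. w i - z xi k i) - nsq (\<lambda>i. w i - zt xi k i)
      = (nsq (z xi k) - nsq (zt xi k)) + (\<Sum>i<N. L i * (2 * w i * \<Delta> xi k i))" for w xi k
    unfolding normL_sq_def sum_subtractf[symmetric] sum.distrib[symmetric]
    by (intro sum.cong refl) (simp add: power2_eq_square algebra_simps)
  have "(\<Sum>k=K0..K. \<Sum>i<N. L i * (2 * uh K0 xi i * \<Delta> xi k i)) = (\<Sum>i<N. L i * (2 * uh K0 xi i * T K0 xi i))" for xi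
    unfolding T_def by (subst sum.swap) (simp only: sum_distrib_left)
  then have second: "(\<Sum>k=K0..K. E (\<lambda>xi. \<Sum>i<N. L i * (2 * uh K0 xi i * \<Delta> xi k i)))
      = E (\<lambda>xi. \<Sum>i<N. L i * (2 * uh K0 xi i * T K0 xi i))"
    unfolding Exi_sum[symmetric, where I = "{K0..K}"] by simp
  have "E (\<lambda>xi. \<Sum>i<N. L i * (real N * ((z xi K0 i)\<^sup>2 - (z xi (Suc K) i)\<^sup>2) + 2 * uh K0 xi i * T K0 xi i))
      = E (\<lambda>xi. real N * (nsq (z xi K0) - nsq (z xi (Suc K))) + (\<Sum>i<N. L i * (2 * uh K0 xi i * T K0 xi i)))"
    unfolding normL_sq_def sum_subtractf[symmetric] sum_distrib_left sum.distrib[symmetric]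
    by (intro arg_cong[where f = E] ext sum.cong refl) (simp add: algebra_simps)
  also have "\<dots> = real N * (A K0 - A (Suc K)) + E (\<lambda>xi. \<Sum>i<N. L i * (2 * uh K0 xi i * T K0 xi i))"
    unfolding Exi_add Exi_cmult Exi_diff A_def ..
  finally show ?thesis
    unfolding expand Exi_add sum.distrib first second ..
qed

lemma distance_terms_bound:
  assumes K: "K0 \<le> K"
  shows "real N * (\<Sum>k=K0..K. E (\<lambda>xi. nsq (\<lambda>i. uh K0 xi i - z xi k i) - nsq (\<lambda>i. uh K0 xi i - zt xi k i)))
    \<le> (real N)\<^sup>2 * (5 * C + 3 * nsq ustar + 4 * Q)"
proof -
  have pt: "n * (n * (a\<^sup>2 - b\<^sup>2) + 2 * w * (n * (b - a) - m))
      \<le> n\<^sup>2 * (4 * w\<^sup>2 + 3 * y\<^sup>2 + 3 * (y - a)\<^sup>2) + m\<^sup>2" for n a b w m y :: real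
  proof -
    \<comment> \<open>The slack as a sum of squares: \<open>b\<close> and \<open>m\<close> are
      eliminated by completing squares with \<open>w\<close>, \<open>a\<close> is written as
      \<open>y - (y - a)\<close>, and the three products among \<open>w\<close>, \<open>y\<close>
      and \<open>y - a\<close> are completed likewise.\<close>
    have "0 \<le> n\<^sup>2 * ((w + y)\<^sup>2 + (y + (y - a))\<^sup>2 + (w - (y - a))\<^sup>2) + n\<^sup>2 * (w - b)\<^sup>2 + (n * w + m)\<^sup>2"
      by simp
    also have "\<dots> = n\<^sup>2 * (4 * w\<^sup>2 + 3 * y\<^sup>2 + 3 * (y - a)\<^sup>2) + m\<^sup>2
        - n * (n * (a\<^sup>2 - b\<^sup>2) + 2 * w * (n * (b - a) - m))"
      by (simp add: power2_eq_square algebra_simps)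
    finally show ?thesis by simp
  qed
  have "real N * (\<Sum>i<N. L i * (real N * ((z xi K0 i)\<^sup>2 - (z xi (Suc K) i)\<^sup>2) + 2 * uh K0 xi i * T K0 xi i))
      \<le> (real N)\<^sup>2 * (4 * Q + 3 * nsq ustar + 3 * nsq (\<lambda>i. ustar i - z xi K0 i)) + nsq (Mart K0 xi (Suc K))"
    for xi
  proof -
    have "real N * (\<Sum>i<N. L i * (real N * ((z xi K0 i)\<^sup>2 - (z xi (Suc K) i)\<^sup>2) + 2 * uh K0 xi i * T K0 xi i))
      = (\<Sum>i<N. L i * (real N * (real N * ((z xi K0 i)\<^sup>2 - (z xi (Suc K) i)\<^sup>2) + 2 * uh K0 xi i * T K0 xi i)))"
      by (simp only: sum_distrib_left mult.left_commute)
    also have "\<dots> \<le> (\<Sum>i<N. L i * ((real N)\<^sup>2 * (4 * (uh K0 xi i)\<^sup>2 + 3 * (ustar i)\<^sup>2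
        + 3 * (ustar i - z xi K0 i)\<^sup>2) + (Mart K0 xi (Suc K) i)\<^sup>2))"
      unfolding T_Mart[OF K] by (intro sum_mono mult_left_mono pt L_nonneg) auto
    also have "\<dots> = (real N)\<^sup>2 * (4 * nsq (uh K0 xi) + 3 * nsq ustar + 3 * nsq (\<lambda>i. ustar i - z xi K0 i))
        + nsq (Mart K0 xi (Suc K))"
      unfolding normL_sq_def sum_distrib_left sum.distrib[symmetric]
      by (intro sum.cong refl) (simp add: algebra_simps)
    also have "\<dots> \<le> (real N)\<^sup>2 * (4 * Q + 3 * nsq ustar + 3 * nsq (\<lambda>i. ustar i - z xi K0 i))
        + nsq (Mart K0 xi (Suc K))"
      using nsq_uh[of K0 xi] by (intro add_right_mono mult_left_mono) auto
    finally show ?thesis .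
  qed
  then have "real N * (\<Sum>k=K0..K. E (\<lambda>xi. nsq (\<lambda>i. uh K0 xi i - z xi k i) - nsq (\<lambda>i. uh K0 xi i - zt xi k i)))
      \<le> E (\<lambda>xi. (real N)\<^sup>2 * (4 * Q + 3 * nsq ustar + 3 * nsq (\<lambda>i. ustar i - z xi K0 i)) + nsq (Mart K0 xi (Suc K)))"
    unfolding distance_terms[OF K] Exi_cmult[symmetric] by (intro Exi_mono)
  also have "\<dots> = (real N)\<^sup>2 * (4 * Q + 3 * nsq ustar + 3 * Z K0) + E (\<lambda>xi. nsq (Mart K0 xi (Suc K)))"
    unfolding Exi_add Exi_cmult Exi_const[OF N_pos] ..
  also have "\<dots> \<le> (real N)\<^sup>2 * (4 * Q + 3 * nsq ustar + 3 * C) + 2 * (real N)\<^sup>2 * C"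
    using Z_le[of K0] K by (intro add_mono mult_left_mono Mart_bound) auto
  also have "\<dots> = (real N)\<^sup>2 * (5 * C + 3 * nsq ustar + 4 * Q)" by (simp add: algebra_simps)
  finally show ?thesis .
qed

text \<open>\<open>C\<close> collects 1 from the dual gap at \<open>K0\<close>, 3 from the distance
  between \<open>ustar\<close> and \<open>z\<close> at \<open>K0\<close>, and 2 from the martingale.
  The resulting coefficients 6, 3 and 4 all lie below 9.\<close>

lemma objective_upper_bound:
  assumes K: "K0 \<le> K"
  shows "S K0 * (E (\<lambda>xi. Fobj P (xh K0 xi)) + Dr ustar) \<le> 9 * (real N)\<^sup>2 * (C + nsq ustar + Q)"
proof -
  have 1: "\<alpha> K0 * gap K0 \<le> (real N)\<^sup>2 * C" using \<alpha>_gap_le[of K0] K by simp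
  have 2: "0 \<le> \<alpha> (Suc K) * gap (Suc K)" by (rule \<alpha>_gap_nonneg) simp
  have "s * (e + d) \<le> a * (x - d) - a' * (x' - d) + r" if "a' * x' \<le> a * x - s * e + r" "s = a' - a"
    for s e d a a' x x' r :: real
    using that(1) unfolding that(2) by (simp add: algebra_simps)
  from this[OF telescoped_steps[OF K] S_\<alpha>[OF K], of "Dr ustar"]
  have "S K0 * (E (\<lambda>xi. Fobj P (xh K0 xi)) + Dr ustar)
      \<le> (real N)\<^sup>2 * C + (real N)\<^sup>2 * (5 * C + 3 * nsq ustar + 4 * Q)"
    using 1 2 distance_terms_bound[OF K] by linarith
  also have "\<dots> = (real N)\<^sup>2 * (6 * C + 3 * nsq ustar + 4 * Q)" by (simp add: algebra_simps)
  also have "\<dots> \<le> (real N)\<^sup>2 * (9 * (C + nsq ustar + Q))"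
  proof (rule mult_left_mono)
    have "0 \<le> Q" using L_nonneg n_le_N by (intro mult_nonneg_nonneg sum_nonneg) auto
    moreover have "6 * c + 3 * b + 4 * q \<le> 9 * (c + b + q)" if "0 \<le> q" "0 \<le> c" "0 \<le> b" for b c q :: real
      using that by simp
    ultimately show "6 * C + 3 * nsq ustar + 4 * Q \<le> 9 * (C + nsq ustar + Q)"
      using C_nonneg nsq_nonneg[of ustar] by blast
  qed simp
  finally show ?thesis by (simp only: mult_ac)
qed

end

theorem theorem1:
  fixes P :: "'t::finite cdata"
    and xopt :: "real^'t"
    and ustar u0 :: "nat \<Rightarrow> real"
    and ups :: real
    and K K0 :: nat
  assumes n_pos: "nn P \<ge> 1"
    and A1: "assumption1 P"
    and Lpos: "\<forall>i<nhat P. Lc P i > 0"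
    and xopt_feas: "feasible P xopt"
    and xopt_opt: "\<forall>x. feasible P x \<longrightarrow> Fobj P xopt \<le> Fobj P x"
    and ustar_opt: "\<forall>u. Dfun P ustar \<le> Dfun P u"
    and ups: "ups > 1"
    and K0K: "K0 \<le> K"
    and K0bound: "real K0 \<le> real_of_int \<lfloor>real K / (ups * (1 + 1 / real (nhat P))) + 1\<rfloor>"
    and u0D: "inD P u0"
  shows
    "(ereal (((real K)\<^sup>2 / 4 + real (nhat P) * real K) * (1 - 1 / ups)
        * \<bar>Exi (nhat P) K (\<lambda>xi. Fobj P (xhat P u0 K0 K xi)) - Fobj P xopt\<bar>)
     \<le> ereal (9 * (real (nhat P))\<^sup>2) *
        (ereal (1 - theta (nhat P) 0) * (Dfun P u0 - Dfun P ustar)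
         + ereal (normL_sq P (\<lambda>i. u0 i - ustar i) + normL_sq P ustar
                  + (Mlip P)\<^sup>2 * (\<Sum>i<nn P. Lc P i))))
   \<and>
    (ereal (((real K)\<^sup>2 / 4 + real (nhat P) * real K) * (1 - 1 / ups)
        * Exi (nhat P) K (\<lambda>xi. infeas_dualnorm P (xhat P u0 K0 K xi)))
     \<le> ereal (7 * (real (nhat P))\<^sup>2) *
        esqrt (ereal (1 - theta (nhat P) 0) * (Dfun P u0 - Dfun P ustar)
               + ereal (normL_sq P (\<lambda>i. u0 i - ustar i))))"
proof -
  interpret ardca_problem P by unfold_locales (fact n_pos A1 Lpos)+
  \<comment> \<open>A dual point of finite value forces \<open>ustar\<close> into the domain, and
    its value identifies \<open>Fobj P xopt\<close> with \<open>- Dr ustar\<close>.\<close>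
  obtain ud where ud: "udom ud" "Dr ud \<le> - Fobj P xopt"
    using strong_duality xopt_opt by blast
  have ustar_dom: "udom ustar"
  proof (rule ccontr)
    assume "\<not> udom ustar"
    then show False using ustar_opt[rule_format, of ud] Dfun_infinite Dfun_Dr[OF ud(1)] by simp
  qed
  have ustar_min: "Dr ustar \<le> Dr u" if "udom u" for u
    using ustar_opt[rule_format, of u] Dfun_Dr[OF that] Dfun_Dr[OF ustar_dom] by simp
  have value_eq: "Fobj P xopt = - Dr ustar"
    using ustar_min[OF ud(1)] ud(2) weak_duality[OF ustar_dom xopt_feas] by simp
  show ?thesis
  proof (cases "N = 1 \<or> udom u0")
    \<comment> \<open>The dual value at \<open>u0\<close> is infinite and its factor positive, so
      both right-hand sides are infinite.\<close>
    case False
    then have "N > 1" using N_pos by linarith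
    then have inf: "ereal (1 - theta N 0) * (Dfun P u0 - Dfun P ustar) = \<infinity>"
      using Dfun_infinite[of u0] False Dfun_Dr[OF ustar_dom] by simp
    have "esqrt \<infinity> = \<infinity>" unfolding esqrt_def infinity_ereal_def by (simp only: ereal.case)
    then show ?thesis unfolding inf using N_pos by simp
  next
    case True
    interpret ardca_run P u0 ustar K
      by unfold_locales (use True u0D ustar_dom ustar_min in auto)
    define R where "R = ((real K)\<^sup>2 / 4 + real N * real K) * (1 - 1 / ups)"
    have "real K0 \<le> real K / (ups * (1 + 1 / real N)) + 1" using K0bound by linarith
    also have "\<dots> \<le> real K / ups + 1"
    proof -
      have "0 < 1 + 1 / real N" by (simp add: add_pos_nonneg)
      then show ?thesis using ups by (intro add_right_mono divide_left_mono mult_pos_pos) auto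
    qed
    finally have R_le: "R \<le> S K0" unfolding R_def by (rule theta_weights_lower_bound[OF N_pos ups K0K])
    have gap: "ereal (1 - \<theta> 0) * (Dfun P u0 - Dfun P ustar) = ereal ((1 - 1 / real N) * (Dr u0 - Dr ustar))"
    proof (cases "udom u0")
      case True
      then show ?thesis by (simp add: Dfun_Dr ustar_dom)
    next
      case False
      \<comment> \<open>Only \<open>N = 1\<close> is left: \<open>1 - \<theta> 0\<close> is zero,
        and zero times infinity is zero in the extended reals.\<close>
      then show ?thesis using True by (simp flip: zero_ereal_def)
    qed
    have "R * \<bar>E (\<lambda>xi. Fobj P (xh K0 xi)) - Fobj P xopt\<bar> \<le> S K0 * \<bar>E (\<lambda>xi. Fobj P (xh K0 xi)) - Fobj P xopt\<bar>"
      by (intro mult_right_mono R_le) simp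
    also have "\<dots> = \<bar>S K0 * (E (\<lambda>xi. Fobj P (xh K0 xi)) + Dr ustar)\<bar>"
      using S_pos[OF K0K] by (simp add: abs_mult value_eq)
    also have "\<dots> \<le> 9 * (real N)\<^sup>2 * (C + nsq ustar + Q)"
      using objective_lower_bound[OF K0K] objective_upper_bound[OF K0K] by (simp add: abs_le_iff)
    finally have 1: "R * \<bar>E (\<lambda>xi. Fobj P (xh K0 xi)) - Fobj P xopt\<bar> \<le> 9 * (real N)\<^sup>2 * (C + nsq ustar + Q)" .
    have "R * E (\<lambda>xi. infeas_dualnorm P (xh K0 xi)) \<le> S K0 * E (\<lambda>xi. infeas_dualnorm P (xh K0 xi))"
      by (intro mult_right_mono R_le Exi_nonneg) (simp add: infeas_L2_set L2_set_nonneg)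
    also have "\<dots> \<le> 7 * (real N)\<^sup>2 * sqrt C" by (rule infeas_bound[OF K0K])
    finally have 2: "R * E (\<lambda>xi. infeas_dualnorm P (xh K0 xi)) \<le> 7 * (real N)\<^sup>2 * sqrt C" .
    show ?thesis
      unfolding gap R_def[symmetric] using 1 2 by (simp add: esqrt_def C_def add_ac)
  qed
qed

end
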